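(* Let $\mathcal{R}$ be the component completion rule of order $k\ge3$. Then: (i) every trajectory of $\mathcal{R}$ starting at a graphon has a destination; (ii) every destination of $\mathcal{R}$ is component complete; moreover, if $\Omega=\bigsqcup_{i=0}^K\Omega_i$ is a component decomposition of a graphon $W$, then $\mathrm{dest}(W)$ is component complete with the same component decomposition (i.e. $\mathrm{dest}(W)=1$ a.e. on $\Omega_i^2$ for all $i\ge1$ and $\mathrm{dest}(W)=0$ a.e. on $\Omega^2\setminus\bigsqcup_{i=1}^K\Omega_i^2$); (iii) every component complete graphon is a destination of $\mathcal{R}$.
   Context: Let $(\Omega,\pi)$ be an atomless probability space with separable $\sigma$-algebra. A kernel is a bounded symmetric measurable $W:\Omega^2\to\mathbb{R}$ (up to a.e. equality); $\mathcal{W}$ is the Banach space of kernels with $\|\cdot\|_\infty$; graphons are kernels with values in $[0,1]$; $d_\square(U,W)=\sup_{S,T\subseteq\Omega}|\int_{S\times T}(U-W)\,d\pi^2|$. $\mathcal{H}_k$ is the set of graphs on $[k]$. A rule of order $k$ is a matrix $\mathcal{R}\in[0,1]^{\mathcal{H}_k\times\mathcal{H}_k}$ with row sums $1$. For a kernel $W$, $F\in\mathcal{H}_k$, distinct $a,b$, $x,y$: $t^{x,y}_{\mathrm{ind}}(F^{a,b},W)=\int\prod_{ij\in E(F)}W(x_i,x_j)\prod_{ij\notin E(F)}(1-W(x_i,x_j))\prod_{i\ne a,b}d\pi(x_i)$ with $x_a=x,x_b=y$. Velocity: $\mathfrak{V}_{\mathcal{R}}W(x,y)=\sum_{F,H}\sum_{a\ne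 b}\mathcal{R}_{F,H}t^{x,y}_{\mathrm{ind}}(F^{a,b},W)(\mathbb{1}[ab\in E(H)\setminus E(F)]-\mathbb{1}[ab\in E(F)\setminus E(H)])$. For a graphon $W$, the trajectory $t\mapsto\Phi^tW$, $t\ge0$, is the unique solution of $\frac{d}{dt}\Phi^tW=\mathfrak{V}_{\mathcal{R}}(\Phi^tW)$ in $(\mathcal{W},\|\cdot\|_\infty)$ with $\Phi^0W=W$; its destination $\mathrm{dest}(W)$ is the graphon $S$ with $d_\square(\Phi^tW,S)\to0$ as $t\to\infty$; a destination of $\mathcal{R}$ means $\mathrm{dest}(W)$ for some graphon $W$. The component completion graph $\mathcal{C}(F)$ of $F\in\mathcal{H}_k$ is the graph on $[k]$ whose edges are the pairs of distinct vertices joined by a path in $F$; the component completion rule has $\mathcal{R}_{F,\mathcal{C}(F)}=1$ for all $F$. A graphon $W$ is disconnected if $W=0$ a.e. or there is a measurable $A\subseteq\Omega$ with $\pi(A)\in(0,1)$ and $W=0$ a.e. on $A\times(\Omega\setminus A)$; otherwise connected. A component decomposition of $W$ is a partition $\Omega=\bigsqcup_{i=0}^K\Omega_i$ ($0\le K\le\infty$) into measurable sets with $\alpha_i:=\pi(\Omega_i)>0$ for $i\ge1$ ($\Omega_0$ may be empty), such that for each $i\ge1$ the restriction $W|_{\Omega_i^2}$ is a connected graphon on the probability space $(\Omega_i,\alpha_i^{-1}\pi|_{\Omega_i})$, and $W=0$ a.e. on $\Omega^2\setminus\bigsqcup_{i=1}^K\Omega_i^2$. A graphon is component complete if it has a component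 decomposition with $W|_{\Omega_i^2}=1$ a.e. for all $i\ge1$. *)

theory Defs
  imports "HOL-Probability.Probability"
begin

definition atomless :: "'a measure \<Rightarrow> bool" where
  "atomless M \<longleftrightarrow> (\<forall>A\<in>sets M. measure M A > 0 \<longrightarrow>
     (\<exists>B\<in>sets M. B \<subseteq> A \<and> 0 < measure M B \<and> measure M B < measure M A))"

text \<open>Separability of the \<open>\<sigma>\<close>-algebra in the pseudometric given by the measure of the symmetric
  difference. Every countably generated \<open>\<sigma>\<close>-algebra is separable in this sense.\<close>

definition separable_sigma_algebra :: "'a measure \<Rightarrow> bool" where
  "separable_sigma_algebra M \<longleftrightarrow> (\<exists>D. countable D \<and> D \<subseteq> sets M \<and>
     (\<forall>A\<in>sets M. \<forall>e>0. \<exists>B\<in>D. measure M ((A - B) \<union> (B - A)) < e))"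

text \<open>Kernels and graphons are considered up to a.e. equality; the predicates below hold of exactly
  those functions that represent a kernel (graphon), and are invariant under a.e. modification by
  measurable functions.\<close>

definition kernel :: "'a measure \<Rightarrow> ('a \<times> 'a \<Rightarrow> real) \<Rightarrow> bool" where
  "kernel M W \<longleftrightarrow> W \<in> borel_measurable (M \<Otimes>\<^sub>M M) \<and>
     (\<exists>C. AE z in M \<Otimes>\<^sub>M M. \<bar>W z\<bar> \<le> C) \<and>
     (AE (x, y) in M \<Otimes>\<^sub>M M. W (x, y) = W (y, x))"

definition graphon :: "'a measure \<Rightarrow> ('a \<times> 'a \<Rightarrow> real) \<Rightarrow> bool" where
  "graphon M W \<longleftrightarrow> kernel M W \<and> (AE z in M \<Otimes>\<^sub>M M. 0 \<le> W z \<and> W z \<le> 1)"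

definition linf_norm :: "'a measure \<Rightarrow> ('a \<times> 'a \<Rightarrow> real) \<Rightarrow> ereal" where
  "linf_norm M W = esssup (M \<Otimes>\<^sub>M M) (\<lambda>z. ereal \<bar>W z\<bar>)"

definition cut_dist :: "'a measure \<Rightarrow> ('a \<times> 'a \<Rightarrow> real) \<Rightarrow> ('a \<times> 'a \<Rightarrow> real) \<Rightarrow> real" where
  "cut_dist M U W =
     (SUP (S, T)\<in>sets M \<times> sets M. \<bar>LINT z:S \<times> T|M \<Otimes>\<^sub>M M. (U z - W z)\<bar>)"

text \<open>A graph on the vertex set \<open>{1..k}\<close> is given by its set of edges.\<close>

definition graphs :: "nat \<Rightarrow> nat set set set" where
  "graphs k = Pow {e. e \<subseteq> {1..k} \<and> card e = 2}"

definition is_rule :: "nat \<Rightarrow> (nat set set \<Rightarrow> nat set set \<Rightarrow> real) \<Rightarrow> bool" where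
  "is_rule k R \<longleftrightarrow> (\<forall>F\<in>graphs k. (\<forall>H\<in>graphs k. 0 \<le> R F H \<and> R F H \<le> 1) \<and>
     (\<Sum>H\<in>graphs k. R F H) = 1)"

definition t_ind ::
  "nat \<Rightarrow> 'a measure \<Rightarrow> nat set set \<Rightarrow> nat \<Rightarrow> nat \<Rightarrow> ('a \<times> 'a \<Rightarrow> real) \<Rightarrow> 'a \<Rightarrow> 'a \<Rightarrow> real" where
  "t_ind k M F a b W x y =
     (LINT u|PiM ({1..k} - {a, b}) (\<lambda>_. M).
        (let v = u(a := x, b := y) in
          (\<Prod>(i, j)\<in>{(i, j). i \<in> {1..k} \<and> j \<in> {1..k} \<and> i < j \<and> {i, j} \<in> F}. W (v i, v j)) *
          (\<Prod>(i, j)\<in>{(i, j). i \<in> {1..k} \<and> j \<in> {1..k} \<and> i < j \<and> {i, j} \<notin> F}. (1 - W (v i, v j)))))"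

definition velocity ::
  "nat \<Rightarrow> 'a measure \<Rightarrow> (nat set set \<Rightarrow> nat set set \<Rightarrow> real) \<Rightarrow>
    ('a \<times> 'a \<Rightarrow> real) \<Rightarrow> 'a \<times> 'a \<Rightarrow> real" where
  "velocity k M R W = (\<lambda>(x, y).
     \<Sum>F\<in>graphs k. \<Sum>H\<in>graphs k. \<Sum>(a, b)\<in>{(a, b). a \<in> {1..k} \<and> b \<in> {1..k} \<and> a \<noteq> b}.
       R F H * t_ind k M F a b W x y *
         (of_bool ({a, b} \<in> H - F) - of_bool ({a, b} \<in> F - H)))"

text \<open>\<open>trajectory k M R W \<Phi>\<close>: the map \<open>t \<mapsto> \<Phi> t\<close>, \<open>t \<ge> 0\<close>, into the space of kernels solves the
  differential equation in the \<open>L\<^sup>\<infinity>\<close> norm (one-sided derivative at \<open>0\<close>) with initial value \<open>W\<close>.\<close>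

definition trajectory ::
  "nat \<Rightarrow> 'a measure \<Rightarrow> (nat set set \<Rightarrow> nat set set \<Rightarrow> real) \<Rightarrow>
    ('a \<times> 'a \<Rightarrow> real) \<Rightarrow> (real \<Rightarrow> 'a \<times> 'a \<Rightarrow> real) \<Rightarrow> bool" where
  "trajectory k M R W \<Phi> \<longleftrightarrow>
     (\<forall>t\<ge>0. kernel M (\<Phi> t)) \<and>
     (AE z in M \<Otimes>\<^sub>M M. \<Phi> 0 z = W z) \<and>
     (\<forall>t\<ge>0. ((\<lambda>s. linf_norm M (\<lambda>z. (\<Phi> s z - \<Phi> t z) / (s - t) - velocity k M R (\<Phi> t) z))
        \<longlongrightarrow> 0) (at t within {0..}))"

definition converges_to ::
  "'a measure \<Rightarrow> (real \<Rightarrow> 'a \<times> 'a \<Rightarrow> real) \<Rightarrow> ('a \<times> 'a \<Rightarrow> real) \<Rightarrow> bool" where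
  "converges_to M \<Phi> S \<longleftrightarrow> graphon M S \<and> ((\<lambda>t. cut_dist M (\<Phi> t) S) \<longlongrightarrow> 0) at_top"

text \<open>\<open>is_dest k M R W S\<close>: \<open>S\<close> represents \<open>dest(W)\<close>, which is determined only up to a.e. equality.\<close>

definition is_dest ::
  "nat \<Rightarrow> 'a measure \<Rightarrow> (nat set set \<Rightarrow> nat set set \<Rightarrow> real) \<Rightarrow>
    ('a \<times> 'a \<Rightarrow> real) \<Rightarrow> ('a \<times> 'a \<Rightarrow> real) \<Rightarrow> bool" where
  "is_dest k M R W S \<longleftrightarrow> (\<exists>\<Phi>. trajectory k M R W \<Phi> \<and> converges_to M \<Phi> S)"

definition destination_of_rule ::
  "nat \<Rightarrow> 'a measure \<Rightarrow> (nat set set \<Rightarrow> nat set set \<Rightarrow> real) \<Rightarrow> ('a \<times> 'a \<Rightarrow> real) \<Rightarrow> bool" where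
  "destination_of_rule k M R S \<longleftrightarrow> (\<exists>W. graphon M W \<and> is_dest k M R W S)"

definition component_completion :: "nat \<Rightarrow> nat set set \<Rightarrow> nat set set" where
  "component_completion k F =
     {{i, j} | i j. i \<in> {1..k} \<and> j \<in> {1..k} \<and> i \<noteq> j \<and> (i, j) \<in> {(p, q). {p, q} \<in> F}\<^sup>*}"

definition component_completion_rule :: "nat \<Rightarrow> nat set set \<Rightarrow> nat set set \<Rightarrow> real" where
  "component_completion_rule k F H = of_bool (H = component_completion k F)"

lemma component_completion_in_graphs: "component_completion k F \<in> graphs k"
  by (auto simp: component_completion_def graphs_def)

lemma is_rule_component_completion_rule: "is_rule k (component_completion_rule k)"
proof -
  have "finite {e. e \<subseteq> {1..k} \<and> card e = 2}"
    by (rule finite_subset[of _ "Pow {1..k}"]) auto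
  then have "finite (graphs k)"
    by (simp add: graphs_def)
  then have "(\<Sum>H\<in>graphs k. component_completion_rule k F H) = 1" for F
    using component_completion_in_graphs[of k F]
    by (simp add: component_completion_rule_def of_bool_def sum.delta)
  then show ?thesis
    by (simp add: is_rule_def component_completion_rule_def)
qed

definition disconnected :: "'a measure \<Rightarrow> ('a \<times> 'a \<Rightarrow> real) \<Rightarrow> bool" where
  "disconnected M W \<longleftrightarrow> (AE z in M \<Otimes>\<^sub>M M. W z = 0) \<or>
     (\<exists>A\<in>sets M. 0 < measure M A \<and> measure M A < 1 \<and>
        (AE z in M \<Otimes>\<^sub>M M. z \<in> A \<times> (space M - A) \<longrightarrow> W z = 0))"

definition normalized_restriction :: "'a measure \<Rightarrow> 'a set \<Rightarrow> 'a measure" where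
  "normalized_restriction M A = scale_measure (inverse (emeasure M A)) (restrict_space M A)"

text \<open>The parts are \<open>P i\<close> for \<open>0 \<le> i \<le> K\<close>; for \<open>K = \<infinity>\<close> the index ranges over all natural numbers.\<close>

definition component_decomposition ::
  "'a measure \<Rightarrow> ('a \<times> 'a \<Rightarrow> real) \<Rightarrow> enat \<Rightarrow> (nat \<Rightarrow> 'a set) \<Rightarrow> bool" where
  "component_decomposition M W K P \<longleftrightarrow>
     (\<forall>i. enat i \<le> K \<longrightarrow> P i \<in> sets M) \<and>
     disjoint_family_on P {i. enat i \<le> K} \<and>
     (\<Union>i\<in>{i. enat i \<le> K}. P i) = space M \<and>
     (\<forall>i\<ge>1. enat i \<le> K \<longrightarrow> measure M (P i) > 0 \<and>
        graphon (normalized_restriction M (P i)) W \<and>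
        \<not> disconnected (normalized_restriction M (P i)) W) \<and>
     (AE z in M \<Otimes>\<^sub>M M. z \<notin> (\<Union>i\<in>{i. 1 \<le> i \<and> enat i \<le> K}. P i \<times> P i) \<longrightarrow> W z = 0)"

definition component_complete_with ::
  "'a measure \<Rightarrow> ('a \<times> 'a \<Rightarrow> real) \<Rightarrow> enat \<Rightarrow> (nat \<Rightarrow> 'a set) \<Rightarrow> bool" where
  "component_complete_with M W K P \<longleftrightarrow> component_decomposition M W K P \<and>
     (\<forall>i\<ge>1. enat i \<le> K \<longrightarrow> (AE z in M \<Otimes>\<^sub>M M. z \<in> P i \<times> P i \<longrightarrow> W z = 1))"

definition component_complete :: "'a measure \<Rightarrow> ('a \<times> 'a \<Rightarrow> real) \<Rightarrow> bool" where
  "component_complete M W \<longleftrightarrow> graphon M W \<and> (\<exists>K P. component_complete_with M W K P)"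

end

theory Submission
  imports Defs
begin

text \<open>
  The velocity of the component completion rule is nonnegative on graphons, so every trajectory increases
  pointwise and converges to some \<open>S\<close>, pointwise and hence in the cut distance. The velocity vanishes at
  \<open>S\<close>, which means that a graph sampled from \<open>S\<close> is almost surely a disjoint union of cliques; on three
  vertices this says \<open>S(x, y) > 0\<close> and \<open>S(y, z) > 0\<close> imply \<open>S(x, z) = 1\<close> for almost all triples. Hence the
  neighbourhood of almost every point is null or a clique without edges leaving it, and separability lists these
  cliques. A block diagonal support is preserved by the flow, since two points joined by a path lie in the same
  block, and since \<open>S \<ge> W\<close> a connected block of \<open>W\<close> contains only one clique of \<open>S\<close>. Conversely, the velocity vanishes
  at a component complete graphon, whose trajectory is therefore constant.

  Every graphon has a representative that is symmetric and \<open>[0, 1]\<close>-valued everywhere, and the velocity of such a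
  representative is Lipschitz for the supremum over all points. Its trajectory is constructed as a limit of Euler
  polygons and satisfies the differential equation everywhere; almost everywhere statements enter only through
  uniqueness, which identifies an arbitrary trajectory with this one.
\<close>

section \<open>Euler polygons\<close>

text \<open>The velocity is Lipschitz only on bounded sets, so a solution must be kept in
  \<open>[0, 1]\<close> while it is constructed. If the completion adds \<open>{a, b}\<close> to
  \<open>F\<close>, then \<open>{a, b}\<close> is not an edge of \<open>F\<close>, and every density
  in the velocity carries the factor \<open>1 - W (x, y)\<close>. The velocity is thus at most a
  constant times \<open>1 - W (x, y)\<close>, and a short Euler step cannot overshoot 1. The
  polygons stay in a pointwise defined class that is closed under pointwise limits and can also
  carry a support condition, so range, symmetry and support all pass to the limit. The second-order
  remainder of a polygon is bounded independently of the mesh. This one estimate gives convergence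
  of the polygons, the differential equation, and stationarity at infinite time: over a fixed time
  \<open>s\<close> the increments tend to 0, so \<open>s\<close> times the limiting velocity is of
  order \<open>s\<close> squared. An arbitrary trajectory consists of kernels not known in advance
  to be bounded by 1; hence the Lipschitz estimates admit values up to 2, and a barrier argument
  controls the excess.\<close>

lemma geometric_Cauchy_limit:
  fixes a :: "nat \<Rightarrow> real"
  assumes step: "\<And>n. \<bar>a n - a (Suc n)\<bar> \<le> c / 2 ^ n"
  shows "a \<longlonglongrightarrow> lim a" and "\<bar>a n - lim a\<bar> \<le> 2 * c / 2 ^ n"
proof -
  \<comment> \<open>The exact partial sum of the geometric series makes the induction on
    \<open>m\<close> close; the bound \<open>2 * c / 2 ^ n\<close> alone would not.\<close>
  have far: "\<bar>a n - a (n + m)\<bar> \<le> 2 * c / 2 ^ n - 2 * c / 2 ^ (n + m)" for n m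
  proof (induction m)
    case (Suc m)
    have "\<bar>a n - a (n + Suc m)\<bar> \<le> \<bar>a n - a (n + m)\<bar> + \<bar>a (n + m) - a (Suc (n + m))\<bar>"
      by simp
    also have "\<dots> \<le> 2 * c / 2 ^ n - 2 * c / 2 ^ (n + m) + c / 2 ^ (n + m)"
      using Suc step[of "n + m"] by simp
    also have "\<dots> = 2 * c / 2 ^ n - 2 * c / 2 ^ (n + Suc m)"
      by (simp add: field_simps)
    finally show ?case .
  qed simp
  have "0 \<le> c"
    using step[of 0] by simp
  have "Cauchy a"
  proof (rule metric_CauchyI)
    fix e :: real assume "0 < e"
    have "(\<lambda>n. 2 * c * (1 / 2) ^ n) \<longlonglongrightarrow> 2 * c * 0"
      by (intro tendsto_intros LIMSEQ_realpow_zero) auto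
    then have "\<forall>\<^sub>F n in sequentially. 2 * c * (1 / 2) ^ n < e / 2"
      using \<open>0 < e\<close> by (intro order_tendstoD(2)) auto
    then obtain N where N: "2 * c * (1 / 2) ^ N < e / 2"
      by (auto simp: eventually_sequentially)
    have near: "\<bar>a N - a m\<bar> < e / 2" if "m \<ge> N" for m
    proof -
      have "\<bar>a N - a m\<bar> \<le> 2 * c / 2 ^ N - 2 * c / 2 ^ m"
        using far[of N "m - N"] that by simp
      also have "\<dots> \<le> 2 * c * (1 / 2) ^ N"
        using \<open>0 \<le> c\<close> by (simp add: power_divide)
      finally show ?thesis
        using N by simp
    qed
    show "\<exists>M. \<forall>m\<ge>M. \<forall>n\<ge>M. dist (a m) (a n) < e"
    proof (intro exI allI impI)
      fix m n assume "N \<le> m" "N \<le> n"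
      then show "dist (a m) (a n) < e"
        using near[of m] near[of n] unfolding dist_real_def by linarith
    qed
  qed
  then show lim: "a \<longlonglongrightarrow> lim a"
    using Cauchy_convergent convergent_LIMSEQ_iff by blast
  have "(\<lambda>m. \<bar>a n - a (m + n)\<bar>) \<longlonglongrightarrow> \<bar>a n - lim a\<bar>"
    by (intro tendsto_intros LIMSEQ_ignore_initial_segment lim)
  moreover have "\<bar>a n - a (m + n)\<bar> \<le> 2 * c / 2 ^ n" for m
  proof -
    have "0 \<le> 2 * c / 2 ^ (n + m)"
      using \<open>0 \<le> c\<close> by simp
    then show ?thesis
      using far[of n m] by (simp only: add.commute[of m n])
  qed
  ultimately show "\<bar>a n - lim a\<bar> \<le> 2 * c / 2 ^ n"
    by (intro LIMSEQ_le_const2) auto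
qed

text \<open>The autonomous equation \<open>f' = V f\<close> for functions on \<open>X\<close>, with
  pointwise estimates. \<open>G\<close> is the invariant class, preserved by steps up to
  \<open>h0\<close> and by pointwise limits; \<open>V\<close> is controlled only there.\<close>

locale euler_scheme =
  fixes X :: "'z set" and G :: "('z \<Rightarrow> real) \<Rightarrow> bool"
    and V :: "('z \<Rightarrow> real) \<Rightarrow> 'z \<Rightarrow> real" and L B h0 :: real
  assumes nonneg: "0 \<le> L" "0 \<le> B" "0 < h0"
    and V_nonneg: "\<And>f z. G f \<Longrightarrow> z \<in> X \<Longrightarrow> 0 \<le> V f z"
    and V_le: "\<And>f z. G f \<Longrightarrow> z \<in> X \<Longrightarrow> V f z \<le> B"
    and V_lipschitz: "\<And>f g c z. G f \<Longrightarrow> G g \<Longrightarrow> (\<And>z. z \<in> X \<Longrightarrow> \<bar>f z - g z\<bar> \<le> c) \<Longrightarrow> z \<in> X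
      \<Longrightarrow> \<bar>V f z - V g z\<bar> \<le> L * c"
    and G_step: "\<And>f h. G f \<Longrightarrow> 0 \<le> h \<Longrightarrow> h \<le> h0 \<Longrightarrow> G (\<lambda>z. f z + h * V f z)"
    and G_limit: "\<And>f g. (\<And>n::nat. G (f n)) \<Longrightarrow> (\<And>z. z \<in> X \<Longrightarrow> (\<lambda>n. f n z) \<longlonglongrightarrow> g z) \<Longrightarrow> G g"
begin

definition mesh :: "nat \<Rightarrow> real" where
  "mesh n = h0 / 2 ^ n"

definition polygon :: "('z \<Rightarrow> real) \<Rightarrow> nat \<Rightarrow> nat \<Rightarrow> 'z \<Rightarrow> real" where
  "polygon W n j = ((\<lambda>f z. f z + mesh n * V f z) ^^ j) W"

text \<open>The number of complete steps of length \<open>mesh n\<close> up to time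
  \<open>t\<close>. Polygons are evaluated at mesh points without interpolation, at the price of an
  error of at most one step.\<close>

definition index :: "nat \<Rightarrow> real \<Rightarrow> nat" where
  "index n t = nat \<lfloor>t / mesh n\<rfloor>"

definition flow :: "('z \<Rightarrow> real) \<Rightarrow> real \<Rightarrow> 'z \<Rightarrow> real" where
  "flow W t z = lim (\<lambda>n. polygon W n (index n t) z)"

lemma mesh_pos: "0 < mesh n"
  using nonneg by (simp add: mesh_def)

lemma mesh_le: "mesh n \<le> h0"
  using nonneg by (simp add: mesh_def divide_le_eq)

lemma mesh_Suc: "mesh (Suc n) = mesh n / 2"
  by (simp add: mesh_def)

lemma mesh_tendsto: "mesh \<longlonglongrightarrow> 0"
proof -
  have "(\<lambda>n. h0 * (1 / 2) ^ n) \<longlonglongrightarrow> h0 * 0"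
    by (intro tendsto_intros LIMSEQ_realpow_zero) auto
  then show ?thesis
    by (simp add: mesh_def[abs_def] power_divide)
qed

lemma polygon_0: "polygon W n 0 = W"
  by (simp add: polygon_def)

lemma polygon_Suc: "polygon W n (Suc j) z = polygon W n j z + mesh n * V (polygon W n j) z"
  by (simp add: polygon_def)

lemma polygon_G: "G W \<Longrightarrow> G (polygon W n j)"
proof (induction j)
  case (Suc j)
  then have "G (\<lambda>z. polygon W n j z + mesh n * V (polygon W n j) z)"
    using mesh_pos[of n] mesh_le[of n] by (intro G_step) auto
  then show ?case
    by (simp add: polygon_Suc[abs_def])
qed (simp add: polygon_0)

lemma polygon_increment:
  assumes "G W" "z \<in> X"
  shows "0 \<le> polygon W n (j + m) z - polygon W n j z"
    and "polygon W n (j + m) z - polygon W n j z \<le> real m * mesh n * B"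
proof -
  have "0 \<le> mesh n * V (polygon W n i) z \<and> mesh n * V (polygon W n i) z \<le> mesh n * B" for i
    using V_nonneg V_le polygon_G assms mesh_pos[of n] by (simp add: mult_left_mono)
  then have *: "0 \<le> polygon W n (Suc i) z - polygon W n i z \<and>
      polygon W n (Suc i) z - polygon W n i z \<le> mesh n * B" for i
    by (simp add: polygon_Suc)
  show "0 \<le> polygon W n (j + m) z - polygon W n j z"
  proof (induction m)
    case (Suc m) then show ?case using *[of "j + m"] by simp
  qed simp
  show "polygon W n (j + m) z - polygon W n j z \<le> real m * mesh n * B"
  proof (induction m)
    case (Suc m) then show ?case using *[of "j + m"] by (simp add: algebra_simps)
  qed simp
qed

text \<open>After \<open>i\<close> further steps the values have moved by at most
  \<open>i h B\<close>, so the velocity has changed by at most \<open>L i h B\<close>; these errors,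
  each multiplied by \<open>h\<close>, are summed. The bound involves only the elapsed time
  \<open>m h\<close>, hence survives refinement of the mesh.\<close>

lemma polygon_quadratic:
  assumes "G W" "z \<in> X"
  shows "\<bar>polygon W n (j + m) z - polygon W n j z - real m * mesh n * V (polygon W n j) z\<bar>
    \<le> L * B * (real m * mesh n)\<^sup>2"
proof (induction m)
  case (Suc m)
  let ?h = "mesh n" and ?v = "\<lambda>i. V (polygon W n i) z"
  have "\<bar>?v (j + m) - ?v j\<bar> \<le> L * (real m * ?h * B)"
    using assms polygon_increment[OF assms(1), of _ n j m]
    by (intro V_lipschitz polygon_G) auto
  then have v: "?h * \<bar>?v (j + m) - ?v j\<bar> \<le> ?h * (L * (real m * ?h * B))"
    using mesh_pos[of n] by (intro mult_left_mono) auto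
  have "\<bar>polygon W n (j + Suc m) z - polygon W n j z - real (Suc m) * ?h * ?v j\<bar>
    = \<bar>(polygon W n (j + m) z - polygon W n j z - real m * ?h * ?v j) + ?h * (?v (j + m) - ?v j)\<bar>"
    by (simp add: polygon_Suc algebra_simps)
  also have "\<dots> \<le> L * B * (real m * ?h)\<^sup>2 + ?h * (L * (real m * ?h * B))"
    using Suc v mesh_pos[of n] by (intro order_trans[OF abs_triangle_ineq] add_mono) (auto simp: abs_mult)
  also have "\<dots> = L * B * ?h\<^sup>2 * (real m * real m + real m)"
    by (simp add: power2_eq_square algebra_simps)
  also have "\<dots> \<le> L * B * ?h\<^sup>2 * (real (Suc m) * real (Suc m))"
    using nonneg by (intro mult_left_mono mult_nonneg_nonneg) (auto simp: algebra_simps)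
  also have "\<dots> = L * B * (real (Suc m) * ?h)\<^sup>2"
    by (simp add: power2_eq_square algebra_simps)
  finally show ?case .
qed simp

text \<open>A discrete Gronwall estimate. One coarse step differs from two fine ones by at most
  \<open>L B h^2\<close>, by \<open>polygon_quadratic\<close> with \<open>m = 2\<close>, and a
  discrepancy already present grows by a factor of at most \<open>1 + h L\<close>. The total is of
  order \<open>h\<close> while \<open>j h\<close> stays bounded.\<close>

lemma polygon_refine:
  assumes "G W" "z \<in> X"
  shows "\<bar>polygon W n j z - polygon W (Suc n) (2 * j) z\<bar>
    \<le> L * B * (mesh n)\<^sup>2 * real j * (1 + mesh n * L) ^ j"
  using assms(2)
proof (induction j arbitrary: z)
  case (Suc j)
  let ?h = "mesh n" and ?e = "polygon W n" and ?f = "polygon W (Suc n)"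
  let ?d = "L * B * ?h\<^sup>2 * real j * (1 + ?h * L) ^ j"
  have V: "\<bar>V (?e j) z - V (?f (2 * j)) z\<bar> \<le> L * ?d"
    using Suc assms(1) by (intro V_lipschitz polygon_G) auto
  have "\<bar>?f (2 * j + 2) z - ?f (2 * j) z - real 2 * mesh (Suc n) * V (?f (2 * j)) z\<bar>
    \<le> L * B * (real 2 * mesh (Suc n))\<^sup>2"
    by (rule polygon_quadratic[OF assms(1) Suc.prems])
  then have two: "\<bar>?f (2 * Suc j) z - ?f (2 * j) z - ?h * V (?f (2 * j)) z\<bar> \<le> L * B * ?h\<^sup>2"
    by (simp add: mesh_Suc)
  have "?h * \<bar>V (?e j) z - V (?f (2 * j)) z\<bar> \<le> ?h * (L * ?d)"
    using V mesh_pos[of n] by (intro mult_left_mono) auto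
  then have V': "\<bar>?h * (V (?e j) z - V (?f (2 * j)) z)\<bar> \<le> ?h * (L * ?d)"
    using mesh_pos[of n] by (simp add: abs_mult)
  have "\<bar>?e (Suc j) z - ?f (2 * Suc j) z\<bar>
    \<le> \<bar>?e j z - ?f (2 * j) z\<bar> + \<bar>?h * (V (?e j) z - V (?f (2 * j)) z)\<bar>
      + \<bar>?f (2 * Suc j) z - ?f (2 * j) z - ?h * V (?f (2 * j)) z\<bar>"
    by (simp add: polygon_Suc[of W n] right_diff_distrib)
  also have "\<dots> \<le> ?d + ?h * (L * ?d) + L * B * ?h\<^sup>2"
    using Suc.IH[OF Suc.prems] V' two by linarith
  also have "\<dots> \<le> ?d + ?h * (L * ?d) + L * B * ?h\<^sup>2 * (1 + ?h * L) ^ Suc j"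
  proof -
    have "1 \<le> (1 + ?h * L) ^ Suc j"
      using nonneg mesh_pos[of n] by (intro one_le_power) simp
    then have "L * B * ?h\<^sup>2 * 1 \<le> L * B * ?h\<^sup>2 * (1 + ?h * L) ^ Suc j"
      using nonneg by (intro mult_left_mono) auto
    then show ?thesis by simp
  qed
  also have "\<dots> = L * B * ?h\<^sup>2 * real (Suc j) * (1 + ?h * L) ^ Suc j"
    by (simp add: algebra_simps)
  finally show ?case .
qed (simp add: polygon_0)

lemma index_bounds:
  assumes "0 \<le> t"
  shows "real (index n t) * mesh n \<le> t" and "t < (real (index n t) + 1) * mesh n"
proof -
  have "real (index n t) = of_int \<lfloor>t / mesh n\<rfloor>"
    using assms mesh_pos[of n] by (simp add: index_def)
  then have "real (index n t) \<le> t / mesh n" "t / mesh n < real (index n t) + 1"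
    by linarith+
  then show "real (index n t) * mesh n \<le> t" "t < (real (index n t) + 1) * mesh n"
    using mesh_pos[of n] by (auto simp: field_simps)
qed

lemma index_mono: "s \<le> t \<Longrightarrow> index n s \<le> index n t"
  using mesh_pos[of n] by (auto simp: index_def intro!: nat_mono floor_mono divide_right_mono)

text \<open>A coarse cell consists of two fine cells; the alternative tells which of them contains
  \<open>t\<close>.\<close>

lemma index_Suc:
  assumes "0 \<le> t"
  shows "index (Suc n) t = 2 * index n t \<or> index (Suc n) t = 2 * index n t + 1"
proof -
  have "2 * (real (index n t)) < real (index (Suc n) t) + 1"
    using index_bounds(1)[OF assms, of n] index_bounds(2)[OF assms, of "Suc n"] mesh_pos[of n]
    by (simp add: mesh_Suc) (smt (verit, best) mult_less_cancel_right_pos distrib_right)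
  moreover have "real (index (Suc n) t) < 2 * (real (index n t) + 1)"
  proof -
    have "real (index (Suc n) t) * mesh n < 2 * (real (index n t) + 1) * mesh n"
      using index_bounds(2)[OF assms, of n] index_bounds(1)[OF assms, of "Suc n"]
      by (simp add: mesh_Suc algebra_simps)
    then show ?thesis
      using mesh_pos[of n] by (simp add: mult_less_cancel_right)
  qed
  ultimately have "real (2 * index n t) < real (index (Suc n) t + 1)"
    and "real (index (Suc n) t) < real (2 * index n t + 2)"
    by simp_all
  then have "2 * index n t < index (Suc n) t + 1" and "index (Suc n) t < 2 * index n t + 2"
    by (simp_all only: of_nat_less_iff)
  then show ?thesis by linarith
qed

lemma index_tendsto:
  assumes "0 \<le> t"
  shows "(\<lambda>n. real (index n t) * mesh n) \<longlonglongrightarrow> t"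
proof (rule tendsto_sandwich)
  show "(\<lambda>n. t - mesh n) \<longlonglongrightarrow> t"
    using tendsto_diff[OF tendsto_const mesh_tendsto, of t] by simp
  show "\<forall>\<^sub>F n in sequentially. t - mesh n \<le> real (index n t) * mesh n"
    using index_bounds(2)[OF assms] by (intro always_eventually allI) (simp add: algebra_simps less_imp_le)
  show "\<forall>\<^sub>F n in sequentially. real (index n t) * mesh n \<le> t"
    using index_bounds(1)[OF assms] by simp
qed simp

text \<open>The error in passing from level \<open>n\<close> to level \<open>n + 1\<close>,
  multiplied by \<open>2 ^ n\<close>: the accumulated local errors, using
  \<open>(1 + h L) ^ j \<le> exp (L t)\<close>, and \<open>B h\<close> for a possible extra fine
  step. It does not depend on the point.\<close>

definition rate :: "real \<Rightarrow> real" where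
  "rate t = (L * B * t * exp (L * t) + B) * h0"

lemma polygon_index_Suc:
  assumes "G W" "z \<in> X" "0 \<le> t"
  shows "\<bar>polygon W n (index n t) z - polygon W (Suc n) (index (Suc n) t) z\<bar> \<le> rate t / 2 ^ n"
proof -
  let ?j = "index n t" and ?h = "mesh n"
  have jh: "real ?j * ?h \<le> t"
    using index_bounds(1)[OF assms(3)] .
  have "(1 + ?h * L) ^ ?j \<le> exp (?h * L) ^ ?j"
    using nonneg mesh_pos[of n] by (intro power_mono) auto
  also have "\<dots> = exp (L * (real ?j * ?h))"
    by (simp add: exp_of_nat_mult[symmetric] algebra_simps)
  also have "\<dots> \<le> exp (L * t)"
    using jh nonneg by (simp add: mult_left_mono)
  finally have "L * B * ?h * (real ?j * ?h) * (1 + ?h * L) ^ ?j \<le> L * B * ?h * t * exp (L * t)"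
    using nonneg jh mesh_pos[of n] assms(3) by (intro mult_mono mult_left_mono mult_nonneg_nonneg) auto
  then have 1: "\<bar>polygon W n ?j z - polygon W (Suc n) (2 * ?j) z\<bar> \<le> L * B * ?h * t * exp (L * t)"
    using polygon_refine[OF assms(1,2), of n ?j] by (simp add: power2_eq_square algebra_simps)
  have 2: "\<bar>polygon W (Suc n) (2 * ?j) z - polygon W (Suc n) (index (Suc n) t) z\<bar> \<le> B * ?h"
  proof -
    obtain m :: nat where m: "m \<le> 1" "index (Suc n) t = 2 * ?j + m"
      using index_Suc[OF assms(3), of n] by auto
    have "real m * mesh (Suc n) * B \<le> 1 * ?h * B"
      using m nonneg mesh_pos[of n] by (intro mult_right_mono mult_mono) (auto simp: mesh_Suc)
    then show ?thesis
      using polygon_increment[OF assms(1,2), of "Suc n" "2 * ?j" m] m by (simp add: algebra_simps)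
  qed
  have "\<bar>polygon W n ?j z - polygon W (Suc n) (index (Suc n) t) z\<bar>
      \<le> L * B * ?h * t * exp (L * t) + B * ?h"
    using 1 2 by linarith
  also have "\<dots> = rate t / 2 ^ n"
    by (simp add: rate_def mesh_def field_simps)
  finally show ?thesis .
qed

lemma
  assumes "G W" "z \<in> X" "0 \<le> t"
  shows polygon_tendsto_flow: "(\<lambda>n. polygon W n (index n t) z) \<longlonglongrightarrow> flow W t z"
    and polygon_flow_dist: "\<bar>polygon W n (index n t) z - flow W t z\<bar> \<le> 2 * rate t / 2 ^ n"
  using geometric_Cauchy_limit[where a = "\<lambda>n. polygon W n (index n t) z" and c = "rate t",
      OF polygon_index_Suc[OF assms]] by (auto simp: flow_def)

lemma flow_0: "flow W 0 z = W z"
  by (simp add: flow_def index_def polygon_0)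

lemma flow_G: "G W \<Longrightarrow> 0 \<le> t \<Longrightarrow> G (flow W t)"
  by (rule G_limit[of "\<lambda>n. polygon W n (index n t)"]) (auto intro: polygon_G polygon_tendsto_flow)

lemma flow_mono:
  assumes "G W" "z \<in> X" "0 \<le> s" "s \<le> t"
  shows "flow W s z \<le> flow W t z"
proof (rule LIMSEQ_le[OF polygon_tendsto_flow polygon_tendsto_flow])
  show "\<exists>N. \<forall>n\<ge>N. polygon W n (index n s) z \<le> polygon W n (index n t) z"
  proof (intro exI allI impI)
    fix n
    show "polygon W n (index n s) z \<le> polygon W n (index n t) z"
      using polygon_increment(1)[OF assms(1,2), of n "index n s" "index n t - index n s"]
        index_mono[OF assms(4), of n] by simp
  qed
qed (use assms in auto)

text \<open>The limit of \<open>polygon_quadratic\<close>: the differential equation from the right,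
  with an error uniform in the point and the time.\<close>

lemma flow_quadratic:
  assumes "G W" "z \<in> X" "0 \<le> t" "0 \<le> s"
  shows "\<bar>flow W (t + s) z - flow W t z - s * V (flow W t) z\<bar> \<le> L * B * s\<^sup>2"
proof -
  let ?m = "\<lambda>n. index n (t + s) - index n t"
  have le: "index n t \<le> index n (t + s)" for n
    using assms by (intro index_mono) auto
  have *: "\<bar>polygon W n (index n (t + s)) z - polygon W n (index n t) z
      - real (?m n) * mesh n * V (polygon W n (index n t)) z\<bar> \<le> L * B * (real (?m n) * mesh n)\<^sup>2" for n
    using polygon_quadratic[OF assms(1,2), of n "index n t" "?m n"] le by simp
  \<comment> \<open>\<open>V\<close> is Lipschitz for the supremum over \<open>X\<close>, so
    pointwise convergence of the polygons would not suffice; the bound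
    \<open>polygon_flow_dist\<close> is uniform over \<open>X\<close>.\<close>
  have V: "(\<lambda>n. V (polygon W n (index n t)) z) \<longlonglongrightarrow> V (flow W t) z"
  proof (rule Lim_transform2[OF tendsto_const])
    have "(\<lambda>n. L * (2 * rate t * (1 / 2) ^ n)) \<longlonglongrightarrow> L * (2 * rate t * 0)"
      by (intro tendsto_intros LIMSEQ_realpow_zero) auto
    then have "(\<lambda>n. L * (2 * rate t * (1 / 2) ^ n)) \<longlonglongrightarrow> 0"
      by simp
    then show "(\<lambda>n. V (flow W t) z - V (polygon W n (index n t)) z) \<longlonglongrightarrow> 0"
    proof (rule Lim_null_comparison[OF always_eventually, rotated])
      show "\<forall>n. norm (V (flow W t) z - V (polygon W n (index n t)) z) \<le> L * (2 * rate t * (1 / 2) ^ n)"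
      proof
        fix n
        have "\<bar>V (polygon W n (index n t)) z - V (flow W t) z\<bar> \<le> L * (2 * rate t / 2 ^ n)"
          using assms polygon_flow_dist by (intro V_lipschitz polygon_G flow_G) auto
        then show "norm (V (flow W t) z - V (polygon W n (index n t)) z) \<le> L * (2 * rate t * (1 / 2) ^ n)"
          by (simp add: power_divide abs_minus_commute)
      qed
    qed
  qed
  have "(\<lambda>n. real (index n (t + s)) * mesh n - real (index n t) * mesh n) \<longlonglongrightarrow> (t + s) - t"
    using assms by (intro tendsto_intros index_tendsto) auto
  then have m: "(\<lambda>n. real (?m n) * mesh n) \<longlonglongrightarrow> s"
    using le by (simp add: of_nat_diff left_diff_distrib)
  show ?thesis
  proof (rule LIMSEQ_le)
    show "(\<lambda>n. \<bar>polygon W n (index n (t + s)) z - polygon W n (index n t) z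
      - real (?m n) * mesh n * V (polygon W n (index n t)) z\<bar>)
      \<longlonglongrightarrow> \<bar>flow W (t + s) z - flow W t z - s * V (flow W t) z\<bar>"
      using assms by (intro tendsto_intros polygon_tendsto_flow V m) auto
    show "(\<lambda>n. L * B * (real (?m n) * mesh n)\<^sup>2) \<longlonglongrightarrow> L * B * s\<^sup>2"
      by (intro tendsto_intros m)
  qed (use * in auto)
qed

end

section \<open>Induced densities on fibres\<close>

definition vertex_pairs :: "nat \<Rightarrow> (nat \<times> nat) set" where
  "vertex_pairs k = {(i, j). i \<in> {1..k} \<and> j \<in> {1..k} \<and> i < j}"

text \<open>The integrand of \<open>t_ind\<close>, with edges and non-edges merged into one product
  over increasing pairs, so that estimates are made factor by factor.\<close>

definition ind_weight :: "nat \<Rightarrow> nat set set \<Rightarrow> ('a \<times> 'a \<Rightarrow> real) \<Rightarrow> (nat \<Rightarrow> 'a) \<Rightarrow> real" where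
  "ind_weight k F W v =
     (\<Prod>(i, j)\<in>vertex_pairs k. if {i, j} \<in> F then W (v i, v j) else 1 - W (v i, v j))"

text \<open>Index set of the terms of the velocity with nonzero coefficient; as in the velocity
  itself, each pair occurs in both orders.\<close>

definition completed_pairs :: "nat \<Rightarrow> (nat set set \<times> nat \<times> nat) set" where
  "completed_pairs k = {(F, a, b). F \<in> graphs k \<and> a \<in> {1..k} \<and> b \<in> {1..k} \<and> a \<noteq> b \<and>
     {a, b} \<in> component_completion k F - F}"

lemma finite_vertex_pairs [simp]: "finite (vertex_pairs k)"
  by (rule finite_subset[of _ "{1..k} \<times> {1..k}"]) (auto simp: vertex_pairs_def)

lemma finite_graphs [simp]: "finite (graphs k)"
proof -
  have "finite {e. e \<subseteq> {1..k} \<and> card e = 2}"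
    by (rule finite_subset[of _ "Pow {1..k}"]) auto
  then show ?thesis
    by (simp add: graphs_def)
qed

lemma finite_completed_pairs [simp]: "finite (completed_pairs k)"
  by (rule finite_subset[of _ "graphs k \<times> {1..k} \<times> {1..k}"]) (auto simp: completed_pairs_def)

lemma t_ind_eq:
  "t_ind k M F a b W x y =
     (LINT u|PiM ({1..k} - {a, b}) (\<lambda>_. M). ind_weight k F W (u(a := x, b := y)))"
proof -
  have "(\<Prod>(i, j)\<in>{(i, j). i \<in> {1..k} \<and> j \<in> {1..k} \<and> i < j \<and> {i, j} \<in> F}. W (v i, v j)) *
      (\<Prod>(i, j)\<in>{(i, j). i \<in> {1..k} \<and> j \<in> {1..k} \<and> i < j \<and> {i, j} \<notin> F}. (1 - W (v i, v j)))
    = ind_weight k F W v" for v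
  proof -
    have 1: "{(i, j). i \<in> {1..k} \<and> j \<in> {1..k} \<and> i < j \<and> {i, j} \<in> F}
      = vertex_pairs k \<inter> {p. {fst p, snd p} \<in> F}"
      and 2: "{(i, j). i \<in> {1..k} \<and> j \<in> {1..k} \<and> i < j \<and> {i, j} \<notin> F}
      = vertex_pairs k \<inter> - {p. {fst p, snd p} \<in> F}"
      by (auto simp: vertex_pairs_def)
    show ?thesis
      unfolding 1 2 unfolding ind_weight_def split_def
      by (rule prod.If_cases[OF finite_vertex_pairs, symmetric])
  qed
  then show ?thesis
    by (simp add: t_ind_def Let_def)
qed

lemma subset_component_completion:
  assumes "F \<in> graphs k"
  shows "F \<subseteq> component_completion k F"
proof
  fix e assume "e \<in> F"
  then have "e \<subseteq> {1..k}" "card e = 2"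
    using assms by (auto simp: graphs_def)
  then obtain i j where "e = {i, j}" "i \<noteq> j" "i \<in> {1..k}" "j \<in> {1..k}"
    by (auto simp: card_2_iff)
  with \<open>e \<in> F\<close> show "e \<in> component_completion k F"
    by (auto simp: component_completion_def)
qed

text \<open>The rule is deterministic, so the sum over \<open>H\<close> collapses to the completion
  of \<open>F\<close>; completion removes no edge, so the negative terms vanish. This is the source
  of the sign of the velocity.\<close>

lemma velocity_component_completion:
  "velocity k M (component_completion_rule k) W (x, y) =
     (\<Sum>(F, a, b)\<in>completed_pairs k. t_ind k M F a b W x y)"
proof -
  let ?P = "{(a, b). a \<in> {1..k} \<and> b \<in> {1..k} \<and> a \<noteq> b}"
  let ?C = "component_completion k"
  have fin: "finite ?P"
    by (rule finite_subset[of _ "{1..k} \<times> {1..k}"]) auto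
  have "velocity k M (component_completion_rule k) W (x, y)
    = (\<Sum>F\<in>graphs k. \<Sum>(a, b)\<in>?P. t_ind k M F a b W x y * of_bool ({a, b} \<in> ?C F - F))"
    unfolding velocity_def prod.case
  proof (rule sum.cong[OF refl])
    fix F assume F: "F \<in> graphs k"
    have "(\<Sum>H\<in>graphs k. \<Sum>(a, b)\<in>?P. component_completion_rule k F H * t_ind k M F a b W x y *
        (of_bool ({a, b} \<in> H - F) - of_bool ({a, b} \<in> F - H)))
      = (\<Sum>H\<in>graphs k. if H = ?C F then \<Sum>(a, b)\<in>?P. t_ind k M F a b W x y *
        (of_bool ({a, b} \<in> H - F) - of_bool ({a, b} \<in> F - H)) else 0)"
      by (intro sum.cong refl) (auto simp: component_completion_rule_def split_def)
    also have "\<dots> = (\<Sum>(a, b)\<in>?P. t_ind k M F a b W x y *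
        (of_bool ({a, b} \<in> ?C F - F) - of_bool ({a, b} \<in> F - ?C F)))"
      using component_completion_in_graphs[of k F] by (simp add: sum.delta')
    also have "\<dots> = (\<Sum>(a, b)\<in>?P. t_ind k M F a b W x y * of_bool ({a, b} \<in> ?C F - F))"
    proof -
      have "{a, b} \<notin> F - ?C F" for a b
        using subset_component_completion[OF F] by auto
      then show ?thesis
        by (intro sum.cong refl) (simp only: split_def, simp)
    qed
    finally show "(\<Sum>H\<in>graphs k. \<Sum>(a, b)\<in>?P. component_completion_rule k F H * t_ind k M F a b W x y *
        (of_bool ({a, b} \<in> H - F) - of_bool ({a, b} \<in> F - H)))
      = (\<Sum>(a, b)\<in>?P. t_ind k M F a b W x y * of_bool ({a, b} \<in> ?C F - F))" .
  qed
  also have "\<dots> = (\<Sum>(F, a, b)\<in>graphs k \<times> ?P. t_ind k M F a b W x y * of_bool ({a, b} \<in> ?C F - F))"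
    by (rule sum.cartesian_product)
  also have "\<dots> = (\<Sum>(F, a, b)\<in>completed_pairs k. t_ind k M F a b W x y)"
    using fin
    by (intro sum.mono_neutral_cong_right) (auto simp: completed_pairs_def)
  finally show ?thesis .
qed

text \<open>The factors are exchanged one at a time; \<open>1 \<le> R\<close> allows every exchange
  to be charged the full power of \<open>R\<close>.\<close>

lemma abs_prod_diff_le:
  fixes f g :: "'b \<Rightarrow> real"
  assumes "finite A" "1 \<le> R" "0 \<le> c"
    and "\<And>i. i \<in> A \<Longrightarrow> \<bar>f i\<bar> \<le> R" "\<And>i. i \<in> A \<Longrightarrow> \<bar>g i\<bar> \<le> R" "\<And>i. i \<in> A \<Longrightarrow> \<bar>f i - g i\<bar> \<le> c"
  shows "\<bar>prod f A - prod g A\<bar> \<le> real (card A) * R ^ card A * c"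
  using assms(1,4-)
proof (induction A rule: finite_induct)
  case (insert i A)
  have g: "\<bar>prod g A\<bar> \<le> R ^ card A"
    using insert.prems(2) assms(2) by (auto simp: abs_prod intro!: prod_le_power)
  have "\<bar>prod f (insert i A) - prod g (insert i A)\<bar> = \<bar>f i * (prod f A - prod g A) + (f i - g i) * prod g A\<bar>"
    using insert by (simp add: algebra_simps)
  also have "\<dots> \<le> \<bar>f i\<bar> * \<bar>prod f A - prod g A\<bar> + \<bar>f i - g i\<bar> * \<bar>prod g A\<bar>"
    by (rule order_trans[OF abs_triangle_ineq]) (simp add: abs_mult)
  also have "\<dots> \<le> R * (real (card A) * R ^ card A * c) + c * R ^ card A"
    using insert g assms(2,3) by (intro add_mono mult_mono) auto
  also have "\<dots> \<le> R * (real (card A) * R ^ card A * c) + R * (c * R ^ card A)"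
    using assms(2,3) mult_right_mono[of 1 R "c * R ^ card A"] by simp
  also have "\<dots> = real (card (insert i A)) * R ^ card (insert i A) * c"
    using insert by (simp add: algebra_simps)
  finally show ?case .
qed simp

text \<open>The 3 comes from \<open>1 - W\<close> with \<open>\<bar>W\<bar> \<le> 2\<close>. The
  range 2 leaves room for kernels within distance 1 of a graphon, which occur in the uniqueness
  argument.\<close>

lemma abs_ind_weight_le:
  assumes "\<And>i j. (i, j) \<in> vertex_pairs k \<Longrightarrow> \<bar>W (v i, v j)\<bar> \<le> 2"
  shows "\<bar>ind_weight k F W v\<bar> \<le> 3 ^ card (vertex_pairs k)"
  unfolding ind_weight_def abs_prod
proof (rule prod_le_power)
  fix p assume "p \<in> vertex_pairs k"
  with assms[of "fst p" "snd p"]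
  show "0 \<le> \<bar>case p of (i, j) \<Rightarrow> if {i, j} \<in> F then W (v i, v j) else 1 - W (v i, v j)\<bar> \<and>
    \<bar>case p of (i, j) \<Rightarrow> if {i, j} \<in> F then W (v i, v j) else 1 - W (v i, v j)\<bar> \<le> 3"
    by (auto simp: split_def)
qed auto

lemma ind_weight_diff:
  assumes "0 \<le> c"
    and "\<And>i j. (i, j) \<in> vertex_pairs k \<Longrightarrow> \<bar>U (v i, v j)\<bar> \<le> 2"
    and "\<And>i j. (i, j) \<in> vertex_pairs k \<Longrightarrow> \<bar>W (v i, v j)\<bar> \<le> 2"
    and "\<And>i j. (i, j) \<in> vertex_pairs k \<Longrightarrow> \<bar>U (v i, v j) - W (v i, v j)\<bar> \<le> c"
  shows "\<bar>ind_weight k F U v - ind_weight k F W v\<bar>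
    \<le> real (card (vertex_pairs k)) * 3 ^ card (vertex_pairs k) * c"
  unfolding ind_weight_def
proof (rule abs_prod_diff_le)
  fix p assume "p \<in> vertex_pairs k"
  then have p: "(fst p, snd p) \<in> vertex_pairs k"
    by simp
  show "\<bar>case p of (i, j) \<Rightarrow> if {i, j} \<in> F then U (v i, v j) else 1 - U (v i, v j)\<bar> \<le> 3"
    using assms(2)[OF p] by (auto simp: split_def)
  show "\<bar>case p of (i, j) \<Rightarrow> if {i, j} \<in> F then W (v i, v j) else 1 - W (v i, v j)\<bar> \<le> 3"
    using assms(3)[OF p] by (auto simp: split_def)
  show "\<bar>(case p of (i, j) \<Rightarrow> if {i, j} \<in> F then U (v i, v j) else 1 - U (v i, v j)) -
        (case p of (i, j) \<Rightarrow> if {i, j} \<in> F then W (v i, v j) else 1 - W (v i, v j))\<bar> \<le> c"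
    using assms(4)[OF p] by (auto simp: split_def)
qed (use assms in auto)

lemma ind_weight_nonneg:
  assumes "\<And>i j. (i, j) \<in> vertex_pairs k \<Longrightarrow> 0 \<le> W (v i, v j) \<and> W (v i, v j) \<le> 1"
  shows "0 \<le> ind_weight k F W v"
  unfolding ind_weight_def using assms by (intro prod_nonneg) auto

text \<open>All other factors lie in \<open>[0, 1]\<close>. Applied to the pair that the completion
  adds, this is what keeps Euler steps below 1.\<close>

lemma ind_weight_le_factor:
  assumes W: "\<And>i j. (i, j) \<in> vertex_pairs k \<Longrightarrow> 0 \<le> W (v i, v j) \<and> W (v i, v j) \<le> 1"
    and p: "(i, j) \<in> vertex_pairs k" "{i, j} \<notin> F"
  shows "ind_weight k F W v \<le> 1 - W (v i, v j)"
proof -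
  let ?f = "\<lambda>(i, j). if {i, j} \<in> F then W (v i, v j) else 1 - W (v i, v j)"
  have "prod ?f (vertex_pairs k - {(i, j)}) \<le> 1"
  proof (rule prod_le_1)
    fix p assume "p \<in> vertex_pairs k - {(i, j)}"
    then show "0 \<le> ?f p \<and> ?f p \<le> 1"
      using W[of "fst p" "snd p"] by (auto simp: split_def)
  qed
  then have "(1 - W (v i, v j)) * prod ?f (vertex_pairs k - {(i, j)}) \<le> (1 - W (v i, v j)) * 1"
    using W[OF p(1)] by (intro mult_left_mono) auto
  then show ?thesis
    using p by (simp add: ind_weight_def prod.remove[OF finite_vertex_pairs p(1)])
qed

section \<open>Fubini for the product measure with two coordinates singled out\<close>

context prob_space
begin

lemma pair_prob_space_self: "pair_prob_space M M"
  by unfold_locales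

lemma prob_space_PiM_const: "prob_space (PiM I (\<lambda>_. M))"
  by (rule prob_space_PiM) unfold_locales

lemma measurable_fun_upd2:
  assumes "a \<in> I" "b \<in> I" "a \<noteq> b"
  shows "(\<lambda>((x, y), u). u(a := x, b := y)) \<in> (M \<Otimes>\<^sub>M M) \<Otimes>\<^sub>M PiM (I - {a, b}) (\<lambda>_. M) \<rightarrow>\<^sub>M PiM I (\<lambda>_. M)"
  unfolding split_def
  by (rule measurable_fun_upd[where J = "I - {b}"], use assms in blast,
      rule measurable_fun_upd[where J = "I - {a, b}"]) (use assms in auto)

lemma measurable_fun_upd2':
  assumes "a \<in> I" "b \<in> I" "a \<noteq> b" "x \<in> space M" "y \<in> space M"
  shows "(\<lambda>u. u(a := x, b := y)) \<in> PiM (I - {a, b}) (\<lambda>_. M) \<rightarrow>\<^sub>M PiM I (\<lambda>_. M)"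
  using measurable_compose[OF measurable_Pair1' measurable_fun_upd2[OF assms(1-3)], of "(x, y)"] assms(4,5)
  by (simp add: space_pair_measure)

lemma fiber_in_space:
  assumes "u \<in> space (PiM (I - {a, b}) (\<lambda>_. M))" "x \<in> space M" "y \<in> space M" "i \<in> I"
  shows "(u(a := x, b := y)) i \<in> space M"
  using assms by (auto simp: space_PiM PiE_iff)

lemma nn_integral_PiM_split2:
  assumes "finite I" "a \<in> I" "b \<in> I" "a \<noteq> b" "g \<in> borel_measurable (PiM I (\<lambda>_. M))"
  shows "(\<integral>\<^sup>+v. g v \<partial>PiM I (\<lambda>_. M))
    = (\<integral>\<^sup>+z. (\<integral>\<^sup>+u. g (u(a := fst z, b := snd z)) \<partial>PiM (I - {a, b}) (\<lambda>_. M)) \<partial>(M \<Otimes>\<^sub>M M))"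
proof -
  interpret PP: product_prob_space "\<lambda>_::'b. M" I by unfold_locales
  interpret PJ: prob_space "PiM (I - {a, b}) (\<lambda>_. M)" by (rule prob_space_PiM_const)
  let ?J = "I - {a, b}"
  have I: "I = insert a (insert b ?J)" "I - {a} = insert b ?J"
    using assms by auto
  note [measurable] = assms(5)
  have "(\<integral>\<^sup>+v. g v \<partial>PiM I (\<lambda>_. M)) = (\<integral>\<^sup>+v. g v \<partial>PiM (insert a (insert b ?J)) (\<lambda>_. M))"
    using I(1) by simp
  also have "\<dots> = (\<integral>\<^sup>+x. (\<integral>\<^sup>+u. g (u(a := x)) \<partial>PiM (insert b ?J) (\<lambda>_. M)) \<partial>M)"
    using assms I(1) by (intro PP.product_nn_integral_insert_rev) auto
  also have "\<dots> = (\<integral>\<^sup>+x. (\<integral>\<^sup>+y. (\<integral>\<^sup>+u. g (u(a := x, b := y)) \<partial>PiM ?J (\<lambda>_. M)) \<partial>M) \<partial>M)"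
  proof (rule nn_integral_cong)
    fix x assume x: "x \<in> space M"
    have "(\<lambda>u. u(a := x)) \<in> PiM (insert b ?J) (\<lambda>_. M) \<rightarrow>\<^sub>M PiM I (\<lambda>_. M)"
      using I x assms by (intro measurable_fun_upd[where J = "insert b ?J"]) auto
    from measurable_compose[OF this assms(5)]
    have "(\<integral>\<^sup>+u. g (u(a := x)) \<partial>PiM (insert b ?J) (\<lambda>_. M))
      = (\<integral>\<^sup>+y. (\<integral>\<^sup>+u. g ((u(b := y))(a := x)) \<partial>PiM ?J (\<lambda>_. M)) \<partial>M)"
      using assms by (intro PP.product_nn_integral_insert_rev) auto
    then show "(\<integral>\<^sup>+u. g (u(a := x)) \<partial>PiM (insert b ?J) (\<lambda>_. M))
      = (\<integral>\<^sup>+y. (\<integral>\<^sup>+u. g (u(a := x, b := y)) \<partial>PiM ?J (\<lambda>_. M)) \<partial>M)"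
      using assms(4) by (simp add: fun_upd_twist)
  qed
  also have "\<dots> = (\<integral>\<^sup>+z. (\<integral>\<^sup>+u. g (u(a := fst z, b := snd z)) \<partial>PiM ?J (\<lambda>_. M)) \<partial>(M \<Otimes>\<^sub>M M))"
  proof -
    have "(\<lambda>(z, u). g (u(a := fst z, b := snd z))) \<in> borel_measurable ((M \<Otimes>\<^sub>M M) \<Otimes>\<^sub>M PiM ?J (\<lambda>_. M))"
      using measurable_compose[OF measurable_fun_upd2[OF assms(2-4)] assms(5)]
      by (simp add: split_def)
    then have "(\<lambda>z. \<integral>\<^sup>+u. g (u(a := fst z, b := snd z)) \<partial>PiM ?J (\<lambda>_. M)) \<in> borel_measurable (M \<Otimes>\<^sub>M M)"
      by (rule PJ.borel_measurable_nn_integral)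
    from nn_integral_fst[OF this] show ?thesis
      by simp
  qed
  finally show ?thesis .
qed

text \<open>Connects statements about a random sample of all vertices with statements about
  \<open>t_ind\<close>, where two vertices are fixed. Both sides say that the indicator of the
  failures has integral 0.\<close>

lemma AE_PiM_split2:
  assumes "finite I" "a \<in> I" "b \<in> I" "a \<noteq> b" "Measurable.pred (PiM I (\<lambda>_. M)) Q"
  shows "(AE v in PiM I (\<lambda>_. M). Q v) \<longleftrightarrow>
    (AE z in M \<Otimes>\<^sub>M M. AE u in PiM (I - {a, b}) (\<lambda>_. M). Q (u(a := fst z, b := snd z)))"
proof -
  interpret PJ: prob_space "PiM (I - {a, b}) (\<lambda>_. M)" by (rule prob_space_PiM_const)
  let ?g = "\<lambda>v. indicator {v. \<not> Q v} v :: ennreal"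
  have [measurable]: "?g \<in> borel_measurable (PiM I (\<lambda>_. M))"
    using assms(5) by measurable
  have m: "(\<lambda>(z, u). ?g (u(a := fst z, b := snd z))) \<in> borel_measurable ((M \<Otimes>\<^sub>M M) \<Otimes>\<^sub>M PiM (I - {a, b}) (\<lambda>_. M))"
    using measurable_compose[OF measurable_fun_upd2[OF assms(2-4)], of ?g borel]
    by (simp add: split_def)
  have "(AE v in PiM I (\<lambda>_. M). Q v) \<longleftrightarrow> (\<integral>\<^sup>+v. ?g v \<partial>PiM I (\<lambda>_. M)) = 0"
    by (subst nn_integral_0_iff_AE) (auto simp: indicator_def)
  also have "\<dots> \<longleftrightarrow> (AE z in M \<Otimes>\<^sub>M M. (\<integral>\<^sup>+u. ?g (u(a := fst z, b := snd z)) \<partial>PiM (I - {a, b}) (\<lambda>_. M)) = 0)"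
    using PJ.borel_measurable_nn_integral[OF m] assms
    by (subst nn_integral_PiM_split2) (auto simp: nn_integral_0_iff_AE)
  also have "\<dots> \<longleftrightarrow> (AE z in M \<Otimes>\<^sub>M M. AE u in PiM (I - {a, b}) (\<lambda>_. M). Q (u(a := fst z, b := snd z)))"
  proof (rule AE_cong)
    fix z assume "z \<in> space (M \<Otimes>\<^sub>M M)"
    then have "(\<lambda>u. ?g (u(a := fst z, b := snd z))) \<in> borel_measurable (PiM (I - {a, b}) (\<lambda>_. M))"
      using assms by (intro measurable_compose[OF measurable_fun_upd2']) (auto simp: space_pair_measure)
    then show "(\<integral>\<^sup>+u. ?g (u(a := fst z, b := snd z)) \<partial>PiM (I - {a, b}) (\<lambda>_. M)) = 0 \<longleftrightarrow>
      (AE u in PiM (I - {a, b}) (\<lambda>_. M). Q (u(a := fst z, b := snd z)))"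
      by (subst nn_integral_0_iff_AE) (auto simp: indicator_def)
  qed
  finally show ?thesis .
qed

lemma AE_PiM_pair:
  assumes "finite I" "i \<in> I" "j \<in> I" "i \<noteq> j" "AE z in M \<Otimes>\<^sub>M M. Q z"
  shows "AE v in PiM I (\<lambda>_. M). Q (v i, v j)"
proof -
  interpret PJ: prob_space "PiM (I - {i, j}) (\<lambda>_. M)" by (rule prob_space_PiM_const)
  \<comment> \<open>The failures of \<open>Q\<close> are covered by a measurable null set, since the
    splitting lemma requires a measurable predicate.\<close>
  obtain N where N: "N \<in> null_sets (M \<Otimes>\<^sub>M M)" "{z \<in> space (M \<Otimes>\<^sub>M M). \<not> Q z} \<subseteq> N"
    using assms(5) by (auto simp: eventually_ae_filter)
  have [measurable]: "N \<in> sets (M \<Otimes>\<^sub>M M)"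
    using N by auto
  have "AE z in M \<Otimes>\<^sub>M M. z \<notin> N"
    using N by (rule_tac AE_not_in)
  then have "AE z in M \<Otimes>\<^sub>M M. AE u in PiM (I - {i, j}) (\<lambda>_. M).
      ((u(i := fst z, j := snd z)) i, (u(i := fst z, j := snd z)) j) \<notin> N"
    using assms(4) by simp
  moreover have "Measurable.pred (PiM I (\<lambda>_. M)) (\<lambda>v. (v i, v j) \<notin> N)"
    using assms(2,3) by measurable
  ultimately have "AE v in PiM I (\<lambda>_. M). (v i, v j) \<notin> N"
    using assms by (subst AE_PiM_split2[of I i j]) auto
  then show ?thesis
    using AE_space
  proof eventually_elim
    case (elim v)
    then have "(v i, v j) \<in> space (M \<Otimes>\<^sub>M M)"
      using assms(2,3) by (auto simp: space_PiM space_pair_measure)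
    with elim N show ?case by auto
  qed
qed

text \<open>For almost every \<open>(x, y)\<close>, the fibre over it sees a kernel only up to a.e.
  equality. Almost everywhere hypotheses on kernels reach the velocity through this lemma.\<close>

lemma AE_fiber_pairs:
  assumes "a \<in> {1..k}" "b \<in> {1..k}" "a \<noteq> b" "AE z in M \<Otimes>\<^sub>M M. Q z"
  shows "AE z in M \<Otimes>\<^sub>M M. AE u in PiM ({1..k} - {a, b}) (\<lambda>_. M).
    \<forall>(i, j)\<in>vertex_pairs k. Q ((u(a := fst z, b := snd z)) i, (u(a := fst z, b := snd z)) j)"
proof -
  obtain N where N: "N \<in> null_sets (M \<Otimes>\<^sub>M M)" "{z \<in> space (M \<Otimes>\<^sub>M M). \<not> Q z} \<subseteq> N"
    using assms(4) by (auto simp: eventually_ae_filter)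
  have [measurable]: "N \<in> sets (M \<Otimes>\<^sub>M M)"
    using N by auto
  have N': "AE z in M \<Otimes>\<^sub>M M. z \<notin> N"
    using N by (rule_tac AE_not_in)
  let ?Q = "\<lambda>v. \<forall>p\<in>vertex_pairs k. (v (fst p), v (snd p)) \<notin> N"
  have "AE v in PiM {1..k} (\<lambda>_. M). ?Q v"
    by (rule AE_finite_allI[OF finite_vertex_pairs])
      (auto simp: vertex_pairs_def intro!: AE_PiM_pair[OF _ _ _ _ N'])
  moreover have "Measurable.pred (PiM {1..k} (\<lambda>_. M)) ?Q"
  proof (rule pred_intros_finite(3))
    fix p assume "p \<in> vertex_pairs k"
    then have [measurable]: "fst p \<in> {1..k}" "snd p \<in> {1..k}"
      by (auto simp: vertex_pairs_def)
    show "Measurable.pred (PiM {1..k} (\<lambda>_. M)) (\<lambda>v. (v (fst p), v (snd p)) \<notin> N)"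
      by measurable
  qed auto
  ultimately have "AE z in M \<Otimes>\<^sub>M M. AE u in PiM ({1..k} - {a, b}) (\<lambda>_. M). ?Q (u(a := fst z, b := snd z))"
    using assms by (subst (asm) AE_PiM_split2[of "{1..k}" a b]) auto
  note AE = this
  show ?thesis
  proof (rule AE_mp[OF AE], rule AE_I2, rule impI)
    fix z assume z: "z \<in> space (M \<Otimes>\<^sub>M M)"
      and Q: "AE u in PiM ({1..k} - {a, b}) (\<lambda>_. M). ?Q (u(a := fst z, b := snd z))"
    show "AE u in PiM ({1..k} - {a, b}) (\<lambda>_. M). \<forall>(i, j)\<in>vertex_pairs k.
      Q ((u(a := fst z, b := snd z)) i, (u(a := fst z, b := snd z)) j)"
    proof (rule AE_mp[OF Q], rule AE_I2, rule impI)
      fix u assume u: "u \<in> space (PiM ({1..k} - {a, b}) (\<lambda>_. M))" "?Q (u(a := fst z, b := snd z))"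
      define v where "v = u(a := fst z, b := snd z)"
      have "v i \<in> space M" if "i \<in> {1..k}" for i
        using fiber_in_space[OF u(1) _ _ that] z by (simp add: v_def space_pair_measure mem_Times_iff)
      then have "Q (v (fst p), v (snd p))" if "p \<in> vertex_pairs k" for p
      proof -
        have "(v (fst p), v (snd p)) \<in> space (M \<Otimes>\<^sub>M M)"
          using that \<open>\<And>i. i \<in> {1..k} \<Longrightarrow> v i \<in> space M\<close>
          by (auto simp: vertex_pairs_def space_pair_measure)
        moreover have "(v (fst p), v (snd p)) \<notin> N"
          using u(2) that unfolding v_def by blast
        ultimately show ?thesis
          using N(2) by blast
      qed
      then show "\<forall>(i, j)\<in>vertex_pairs k. Q ((u(a := fst z, b := snd z)) i, (u(a := fst z, b := snd z)) j)"
        unfolding v_def[symmetric] by fastforce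
    qed
  qed
qed

end

section \<open>The velocity of the component completion rule\<close>

definition lipschitz_const :: "nat \<Rightarrow> real" where
  "lipschitz_const k = real (card (completed_pairs k)) *
     (real (card (vertex_pairs k)) * 3 ^ card (vertex_pairs k))"

lemma lipschitz_const_nonneg: "0 \<le> lipschitz_const k"
  by (simp add: lipschitz_const_def)

text \<open>A nonzero weight forces each edge of \<open>F\<close> to join points related by
  \<open>D\<close>, and transitivity composes these relations along the path. This is how the flow
  respects blocks.\<close>

lemma ind_weight_path:
  assumes "sym D" "trans D" "F \<in> graphs k" "ind_weight k F W v \<noteq> 0"
    and off: "\<And>i j. (i, j) \<in> vertex_pairs k \<Longrightarrow> (v i, v j) \<notin> D \<Longrightarrow> W (v i, v j) = 0"
    and path: "(i, j) \<in> {(p, q). {p, q} \<in> F}\<^sup>*" "i \<noteq> j"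
  shows "(v i, v j) \<in> D"
proof -
  have edge: "(v p, v q) \<in> D" if "{p, q} \<in> F" for p q
  proof -
    have "{p, q} \<subseteq> {1..k}" "card {p, q} = 2"
      using that assms(3) by (auto simp: graphs_def)
    then have pq: "p \<in> {1..k}" "q \<in> {1..k}" "p \<noteq> q"
      by auto
    have *: "(v r, v s) \<in> D" if "(r, s) \<in> vertex_pairs k" "{r, s} \<in> F" for r s
    proof (rule ccontr)
      assume "(v r, v s) \<notin> D"
      then have "ind_weight k F W v = 0"
        unfolding ind_weight_def using that off[of r s] by (intro prod_zero) (auto intro!: bexI[of _ "(r, s)"])
      with assms(4) show False by simp
    qed
    show ?thesis
    proof (cases "p < q")
      case True
      then show ?thesis using * that pq by (simp add: vertex_pairs_def)
    next
      case False
      then have "(v q, v p) \<in> D"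
        using * that pq by (simp add: vertex_pairs_def insert_commute)
      then show ?thesis using assms(1) by (auto dest: symD)
    qed
  qed
  \<comment> \<open>\<open>D\<close> need not be reflexive (points outside all blocks are not
    related to themselves), so the start of the path is a separate case.\<close>
  from path(1) have "i = j \<or> (v i, v j) \<in> D"
  proof (induction rule: rtrancl_induct)
    case (step y z)
    then show ?case
      using edge[of y z] assms(2) by (auto dest: transD)
  qed simp
  with path(2) show ?thesis by simp
qed

text \<open>The completion consists of unordered pairs, so the path may be given from
  \<open>b\<close> to \<open>a\<close>; the edge relation is symmetric.\<close>

lemma completed_pairs_path:
  assumes "(F, a, b) \<in> completed_pairs k"
  shows "(a, b) \<in> {(p, q). {p, q} \<in> F}\<^sup>*"
proof -
  have sym: "sym ({(p, q). {p, q} \<in> F}\<^sup>*)"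
    by (intro sym_rtrancl symI) (auto simp: insert_commute)
  from assms show ?thesis
    using symD[OF sym] by (auto simp: completed_pairs_def component_completion_def doubleton_eq_iff)
qed

context prob_space
begin

abbreviation vel :: "nat \<Rightarrow> ('a \<times> 'a \<Rightarrow> real) \<Rightarrow> 'a \<times> 'a \<Rightarrow> real" where
  "vel k \<equiv> velocity k M (component_completion_rule k)"

lemma borel_measurable_ind_weight:
  assumes [measurable]: "W \<in> borel_measurable (M \<Otimes>\<^sub>M M)"
  shows "ind_weight k F W \<in> borel_measurable (PiM {1..k} (\<lambda>_. M))"
  unfolding ind_weight_def[abs_def] split_def
proof (rule borel_measurable_prod)
  fix p assume "p \<in> vertex_pairs k"
  then have [measurable]: "fst p \<in> {1..k}" "snd p \<in> {1..k}"
    by (auto simp: vertex_pairs_def)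
  show "(\<lambda>v. if {fst p, snd p} \<in> F then W (v (fst p), v (snd p)) else 1 - W (v (fst p), v (snd p)))
    \<in> borel_measurable (PiM {1..k} (\<lambda>_. M))"
    by measurable
qed

lemma borel_measurable_ind_weight_fiber:
  assumes "W \<in> borel_measurable (M \<Otimes>\<^sub>M M)" "(F, a, b) \<in> completed_pairs k" "x \<in> space M" "y \<in> space M"
  shows "(\<lambda>u. ind_weight k F W (u(a := x, b := y))) \<in> borel_measurable (PiM ({1..k} - {a, b}) (\<lambda>_. M))"
  using assms
  by (intro measurable_compose[OF measurable_fun_upd2' borel_measurable_ind_weight])
    (auto simp: completed_pairs_def)

lemma borel_measurable_velocity:
  assumes "W \<in> borel_measurable (M \<Otimes>\<^sub>M M)"
  shows "vel k W \<in> borel_measurable (M \<Otimes>\<^sub>M M)"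
proof -
  have "vel k W = (\<lambda>z. \<Sum>p\<in>completed_pairs k. t_ind k M (fst p) (fst (snd p)) (snd (snd p)) W (fst z) (snd z))"
    by (auto simp: fun_eq_iff velocity_component_completion split_def)
  also have "\<dots> \<in> borel_measurable (M \<Otimes>\<^sub>M M)"
  proof (rule borel_measurable_sum)
    fix p assume p: "p \<in> completed_pairs k"
    obtain F a b where [simp]: "p = (F, a, b)"
      by (cases p) auto
    have ab: "a \<in> {1..k}" "b \<in> {1..k}" "a \<noteq> b"
      using p by (auto simp: completed_pairs_def)
    interpret PJ: prob_space "PiM ({1..k} - {a, b}) (\<lambda>_. M)" by (rule prob_space_PiM_const)
    have "(\<lambda>(z, u). ind_weight k F W (u(a := fst z, b := snd z)))
      \<in> borel_measurable ((M \<Otimes>\<^sub>M M) \<Otimes>\<^sub>M PiM ({1..k} - {a, b}) (\<lambda>_. M))"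
      using measurable_compose[OF measurable_fun_upd2[OF ab] borel_measurable_ind_weight[OF assms]]
      by (simp add: split_def)
    then have "(\<lambda>z. LINT u|PiM ({1..k} - {a, b}) (\<lambda>_. M). ind_weight k F W (u(a := fst z, b := snd z)))
      \<in> borel_measurable (M \<Otimes>\<^sub>M M)"
      by (rule PJ.borel_measurable_lebesgue_integral)
    then show "(\<lambda>z. t_ind k M (fst p) (fst (snd p)) (snd (snd p)) W (fst z) (snd z)) \<in> borel_measurable (M \<Otimes>\<^sub>M M)"
      by (simp add: t_ind_eq)
  qed
  finally show ?thesis .
qed

text \<open>Common core of the everywhere and the almost everywhere version below: the hypotheses
  concern only the fibre over the given point.\<close>

lemma velocity_lipschitz_at:
  assumes meas: "U \<in> borel_measurable (M \<Otimes>\<^sub>M M)" "W \<in> borel_measurable (M \<Otimes>\<^sub>M M)"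
    and xy: "x \<in> space M" "y \<in> space M" and "0 \<le> c"
    and AE: "\<And>F a b. (F, a, b) \<in> completed_pairs k \<Longrightarrow>
      AE u in PiM ({1..k} - {a, b}) (\<lambda>_. M). \<forall>(i, j)\<in>vertex_pairs k.
        (\<lambda>z. \<bar>U z\<bar> \<le> 2 \<and> \<bar>W z\<bar> \<le> 2 \<and> \<bar>U z - W z\<bar> \<le> c)
          ((u(a := x, b := y)) i, (u(a := x, b := y)) j)"
  shows "\<bar>vel k U (x, y) - vel k W (x, y)\<bar> \<le> lipschitz_const k * c"
proof -
  let ?K = "real (card (vertex_pairs k)) * 3 ^ card (vertex_pairs k) * c"
  have t: "\<bar>t_ind k M F a b U x y - t_ind k M F a b W x y\<bar> \<le> ?K" if p: "(F, a, b) \<in> completed_pairs k" for F a b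
  proof -
    interpret PJ: prob_space "PiM ({1..k} - {a, b}) (\<lambda>_. M)" by (rule prob_space_PiM_const)
    let ?v = "\<lambda>u. u(a := x, b := y)"
    note mU = borel_measurable_ind_weight_fiber[OF meas(1) p xy]
      and mW = borel_measurable_ind_weight_fiber[OF meas(2) p xy]
    have U: "AE u in PiM ({1..k} - {a, b}) (\<lambda>_. M). norm (ind_weight k F U (?v u)) \<le> 3 ^ card (vertex_pairs k)"
      using AE[OF p] by eventually_elim (simp only: real_norm_def, rule abs_ind_weight_le, blast)
    have W: "AE u in PiM ({1..k} - {a, b}) (\<lambda>_. M). norm (ind_weight k F W (?v u)) \<le> 3 ^ card (vertex_pairs k)"
      using AE[OF p] by eventually_elim (simp only: real_norm_def, rule abs_ind_weight_le, blast)
    note iU = PJ.integrable_const_bound[OF U mU] and iW = PJ.integrable_const_bound[OF W mW]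
    have "AE u in PiM ({1..k} - {a, b}) (\<lambda>_. M). \<bar>ind_weight k F U (?v u) - ind_weight k F W (?v u)\<bar> \<le> ?K"
      using AE[OF p] by eventually_elim (rule ind_weight_diff[OF \<open>0 \<le> c\<close>], blast+)
    then have "(LINT u|PiM ({1..k} - {a, b}) (\<lambda>_. M). \<bar>ind_weight k F U (?v u) - ind_weight k F W (?v u)\<bar>) \<le> ?K"
      using iU iW by (intro PJ.integral_le_const integrable_abs Bochner_Integration.integrable_diff) auto
    then have "\<bar>LINT u|PiM ({1..k} - {a, b}) (\<lambda>_. M). ind_weight k F U (?v u) - ind_weight k F W (?v u)\<bar> \<le> ?K"
      by (rule order_trans[OF integral_abs_bound])
    then show ?thesis
      unfolding t_ind_eq Bochner_Integration.integral_diff[OF iU iW] .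
  qed
  have "\<bar>vel k U (x, y) - vel k W (x, y)\<bar>
    = \<bar>\<Sum>p\<in>completed_pairs k. (case p of (F, a, b) \<Rightarrow> t_ind k M F a b U x y - t_ind k M F a b W x y)\<bar>"
    by (simp add: velocity_component_completion split_def sum_subtractf)
  also have "\<dots> \<le> (\<Sum>p\<in>completed_pairs k. \<bar>case p of (F, a, b) \<Rightarrow> t_ind k M F a b U x y - t_ind k M F a b W x y\<bar>)"
    by (rule sum_abs)
  also have "\<dots> \<le> (\<Sum>p\<in>completed_pairs k. ?K)"
    by (rule sum_mono) (use t in auto)
  also have "\<dots> = lipschitz_const k * c"
    by (simp add: lipschitz_const_def)
  finally show ?thesis .
qed

lemma fiber_pair_in_space:
  assumes "u \<in> space (PiM ({1..k} - {a, b}) (\<lambda>_. M))" "x \<in> space M" "y \<in> space M" "(i, j) \<in> vertex_pairs k"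
  shows "((u(a := x, b := y)) i, (u(a := x, b := y)) j) \<in> space (M \<Otimes>\<^sub>M M)"
proof -
  have "i \<in> {1..k}" "j \<in> {1..k}"
    using assms(4) by (auto simp: vertex_pairs_def)
  then show ?thesis
    using fiber_in_space[OF assms(1-3)] by (simp only: space_pair_measure mem_Sigma_iff simp_thms)
qed

lemma velocity_lipschitz:
  assumes meas: "U \<in> borel_measurable (M \<Otimes>\<^sub>M M)" "W \<in> borel_measurable (M \<Otimes>\<^sub>M M)"
    and "z \<in> space (M \<Otimes>\<^sub>M M)"
    and "\<And>z. z \<in> space (M \<Otimes>\<^sub>M M) \<Longrightarrow> \<bar>U z\<bar> \<le> 2" "\<And>z. z \<in> space (M \<Otimes>\<^sub>M M) \<Longrightarrow> \<bar>W z\<bar> \<le> 2"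
    and diff: "\<And>z. z \<in> space (M \<Otimes>\<^sub>M M) \<Longrightarrow> \<bar>U z - W z\<bar> \<le> c"
  shows "\<bar>vel k U z - vel k W z\<bar> \<le> lipschitz_const k * c"
proof -
  obtain x y where z: "z = (x, y)" "x \<in> space M" "y \<in> space M"
    using assms(3) by (auto simp: space_pair_measure)
  have "0 \<le> c"
    using diff[OF assms(3)] by simp
  show ?thesis
    unfolding z(1)
  proof (rule velocity_lipschitz_at[OF meas z(2,3) \<open>0 \<le> c\<close>])
    fix F a b assume "(F, a, b) \<in> completed_pairs k"
    show "AE u in PiM ({1..k} - {a, b}) (\<lambda>_. M). \<forall>(i, j)\<in>vertex_pairs k.
        (\<lambda>z. \<bar>U z\<bar> \<le> 2 \<and> \<bar>W z\<bar> \<le> 2 \<and> \<bar>U z - W z\<bar> \<le> c)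
          ((u(a := x, b := y)) i, (u(a := x, b := y)) j)"
    proof (rule AE_I2, rule ballI, rule case_prodI2)
      fix u p i j assume "u \<in> space (PiM ({1..k} - {a, b}) (\<lambda>_. M))" "p \<in> vertex_pairs k" "p = (i, j)"
      then have "((u(a := x, b := y)) i, (u(a := x, b := y)) j) \<in> space (M \<Otimes>\<^sub>M M)"
        using fiber_pair_in_space[OF _ z(2,3)] by simp
      then show "(\<lambda>z. \<bar>U z\<bar> \<le> 2 \<and> \<bar>W z\<bar> \<le> 2 \<and> \<bar>U z - W z\<bar> \<le> c)
          ((u(a := x, b := y)) i, (u(a := x, b := y)) j)"
        using assms by blast
    qed
  qed
qed

lemma velocity_lipschitz_AE:
  assumes meas: "U \<in> borel_measurable (M \<Otimes>\<^sub>M M)" "W \<in> borel_measurable (M \<Otimes>\<^sub>M M)" and "0 \<le> c"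
    and "AE z in M \<Otimes>\<^sub>M M. \<bar>U z\<bar> \<le> 2" "AE z in M \<Otimes>\<^sub>M M. \<bar>W z\<bar> \<le> 2"
    and "AE z in M \<Otimes>\<^sub>M M. \<bar>U z - W z\<bar> \<le> c"
  shows "AE z in M \<Otimes>\<^sub>M M. \<bar>vel k U z - vel k W z\<bar> \<le> lipschitz_const k * c"
proof -
  have Q: "AE z in M \<Otimes>\<^sub>M M. \<bar>U z\<bar> \<le> 2 \<and> \<bar>W z\<bar> \<le> 2 \<and> \<bar>U z - W z\<bar> \<le> c"
    using assms(4-6) by eventually_elim auto
  have "AE z in M \<Otimes>\<^sub>M M. \<forall>p\<in>completed_pairs k.
      AE u in PiM ({1..k} - {fst (snd p), snd (snd p)}) (\<lambda>_. M). \<forall>(i, j)\<in>vertex_pairs k.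
        (\<lambda>z. \<bar>U z\<bar> \<le> 2 \<and> \<bar>W z\<bar> \<le> 2 \<and> \<bar>U z - W z\<bar> \<le> c)
          ((u(fst (snd p) := fst z, snd (snd p) := snd z)) i, (u(fst (snd p) := fst z, snd (snd p) := snd z)) j)"
    by (intro AE_finite_allI[OF finite_completed_pairs] AE_fiber_pairs Q) (auto simp: completed_pairs_def)
  then show ?thesis
    using AE_space
  proof eventually_elim
    case (elim z)
    have "\<bar>vel k U (fst z, snd z) - vel k W (fst z, snd z)\<bar> \<le> lipschitz_const k * c"
    proof (rule velocity_lipschitz_at[OF meas _ _ \<open>0 \<le> c\<close>])
      show "fst z \<in> space M" "snd z \<in> space M"
        using elim(2) by (auto simp: space_pair_measure)
      fix F a b assume "(F, a, b) \<in> completed_pairs k"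
      from bspec[OF elim(1) this]
      show "AE u in PiM ({1..k} - {a, b}) (\<lambda>_. M). \<forall>(i, j)\<in>vertex_pairs k.
        (\<lambda>z. \<bar>U z\<bar> \<le> 2 \<and> \<bar>W z\<bar> \<le> 2 \<and> \<bar>U z - W z\<bar> \<le> c)
          ((u(a := fst z, b := snd z)) i, (u(a := fst z, b := snd z)) j)"
        by (simp only: fst_conv snd_conv)
    qed
    then show ?case by simp
  qed
qed

text \<open>Exchanging \<open>a\<close> and \<open>b\<close> permutes
  \<open>completed_pairs k\<close>.\<close>

lemma velocity_swap: "vel k W (x, y) = vel k W (y, x)"
proof -
  have inv: "(\<lambda>(F, a, b). (F, b, a)) ` completed_pairs k = completed_pairs k"
    by (force simp: completed_pairs_def insert_commute image_iff)
  have inj: "inj_on (\<lambda>(F, a, b). (F, b, a)) (completed_pairs k)"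
    by (auto simp: inj_on_def)
  have "vel k W (x, y) = (\<Sum>(F, a, b)\<in>(\<lambda>(F, a, b). (F, b, a)) ` completed_pairs k. t_ind k M F a b W x y)"
    by (simp add: inv velocity_component_completion)
  also have "\<dots> = (\<Sum>(F, a, b)\<in>completed_pairs k. t_ind k M F b a W x y)"
    by (subst sum.reindex[OF inj]) (auto intro!: sum.cong)
  also have "\<dots> = (\<Sum>(F, a, b)\<in>completed_pairs k. t_ind k M F a b W y x)"
  proof (intro sum.cong refl, clarify)
    fix F a b assume "(F, a, b) \<in> completed_pairs k"
    then have "a \<noteq> b" by (auto simp: completed_pairs_def)
    then show "t_ind k M F b a W x y = t_ind k M F a b W y x"
      by (simp add: t_ind_eq fun_upd_twist insert_commute)
  qed
  finally show ?thesis
    by (simp add: velocity_component_completion)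
qed

text \<open>A representative with the graphon properties at every point, so that steps and limits
  are taken pointwise and no null sets accumulate.\<close>

definition regular_graphon :: "('a \<times> 'a \<Rightarrow> real) \<Rightarrow> bool" where
  "regular_graphon W \<longleftrightarrow> W \<in> borel_measurable (M \<Otimes>\<^sub>M M) \<and>
     (\<forall>z\<in>space (M \<Otimes>\<^sub>M M). 0 \<le> W z \<and> W z \<le> 1) \<and>
     (\<forall>x\<in>space M. \<forall>y\<in>space M. W (x, y) = W (y, x))"

text \<open>The non-edge \<open>{a, b}\<close> of \<open>F\<close> contributes the factor
  \<open>1 - W (x, y)\<close>, which is constant along the fibre.\<close>

lemma ind_weight_fiber:
  assumes W: "regular_graphon W" and xy: "x \<in> space M" "y \<in> space M" and p: "(F, a, b) \<in> completed_pairs k"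
  shows "u \<in> space (PiM ({1..k} - {a, b}) (\<lambda>_. M)) \<Longrightarrow> 0 \<le> ind_weight k F W (u(a := x, b := y))"
    and "u \<in> space (PiM ({1..k} - {a, b}) (\<lambda>_. M)) \<Longrightarrow> ind_weight k F W (u(a := x, b := y)) \<le> 1 - W (x, y)"
    and "integrable (PiM ({1..k} - {a, b}) (\<lambda>_. M)) (\<lambda>u. ind_weight k F W (u(a := x, b := y)))"
proof -
  interpret PJ: prob_space "PiM ({1..k} - {a, b}) (\<lambda>_. M)" by (rule prob_space_PiM_const)
  let ?v = "\<lambda>u. u(a := x, b := y)"
  have ab: "a \<in> {1..k}" "b \<in> {1..k}" "a \<noteq> b" "{a, b} \<notin> F"
    using p by (auto simp: completed_pairs_def)
  have W01: "0 \<le> W (?v u i, ?v u j) \<and> W (?v u i, ?v u j) \<le> 1"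
    if "u \<in> space (PiM ({1..k} - {a, b}) (\<lambda>_. M))" "(i, j) \<in> vertex_pairs k" for u i j
    using fiber_pair_in_space[OF that(1) xy that(2)] W unfolding regular_graphon_def by blast
  show nonneg: "0 \<le> ind_weight k F W (?v u)" if u: "u \<in> space (PiM ({1..k} - {a, b}) (\<lambda>_. M))" for u
    by (rule ind_weight_nonneg[of k W "?v u" F, OF W01[OF u]])
  show le: "ind_weight k F W (?v u) \<le> 1 - W (x, y)" if u: "u \<in> space (PiM ({1..k} - {a, b}) (\<lambda>_. M))" for u
  proof (cases "a < b")
    case True
    then show ?thesis
      using ind_weight_le_factor[of k W "?v u" a b F, OF W01[OF u]] ab by (auto simp: vertex_pairs_def)
  next
    \<comment> \<open>The increasing pair is now \<open>(b, a)\<close>, so the factor is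
      \<open>1 - W (y, x)\<close> and the symmetry of \<open>W\<close> is used.\<close>
    case False
    then have "ind_weight k F W (?v u) \<le> 1 - W (y, x)"
      using ind_weight_le_factor[of k W "?v u" b a F, OF W01[OF u]] ab
      by (auto simp: vertex_pairs_def insert_commute)
    then show ?thesis
      using W xy by (auto simp: regular_graphon_def)
  qed
  have "0 \<le> W (x, y)"
    using W xy by (auto simp: regular_graphon_def space_pair_measure)
  then have "norm (ind_weight k F W (?v u)) \<le> 1" if u: "u \<in> space (PiM ({1..k} - {a, b}) (\<lambda>_. M))" for u
    using nonneg[OF u] le[OF u] unfolding real_norm_def by linarith
  then show "integrable (PiM ({1..k} - {a, b}) (\<lambda>_. M)) (\<lambda>u. ind_weight k F W (?v u))"
    using W xy p
    by (intro PJ.integrable_const_bound[where B = 1] borel_measurable_ind_weight_fiber AE_I2)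
      (auto simp: regular_graphon_def)
qed

lemma t_ind_bounds:
  assumes W: "regular_graphon W" and xy: "x \<in> space M" "y \<in> space M" and p: "(F, a, b) \<in> completed_pairs k"
  shows "0 \<le> t_ind k M F a b W x y" and "t_ind k M F a b W x y \<le> 1 - W (x, y)"
proof -
  interpret PJ: prob_space "PiM ({1..k} - {a, b}) (\<lambda>_. M)" by (rule prob_space_PiM_const)
  show "0 \<le> t_ind k M F a b W x y"
    unfolding t_ind_eq by (intro integral_nonneg_AE AE_I2 ind_weight_fiber(1)[OF assms])
  show "t_ind k M F a b W x y \<le> 1 - W (x, y)"
    unfolding t_ind_eq by (intro PJ.integral_le_const ind_weight_fiber(2,3)[OF assms] AE_I2)
qed

lemma velocity_bounds:
  assumes W: "regular_graphon W" and z: "z \<in> space (M \<Otimes>\<^sub>M M)"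
  shows "0 \<le> vel k W z" and "vel k W z \<le> real (card (completed_pairs k)) * (1 - W z)"
proof -
  obtain x y where xy: "z = (x, y)" "x \<in> space M" "y \<in> space M"
    using z by (auto simp: space_pair_measure)
  note t = t_ind_bounds[OF W xy(2,3)]
  show "0 \<le> vel k W z"
    unfolding xy(1) velocity_component_completion using t by (intro sum_nonneg) auto
  have "vel k W z \<le> (\<Sum>p\<in>completed_pairs k. 1 - W z)"
    unfolding xy(1) velocity_component_completion using t by (intro sum_mono) auto
  then show "vel k W z \<le> real (card (completed_pairs k)) * (1 - W z)"
    by simp
qed

text \<open>A contributing sample would contain a path from \<open>a\<close> to \<open>b\<close>,
  which puts \<open>(x, y)\<close> into \<open>D\<close>.\<close>

lemma velocity_zero_off:
  assumes "sym D" "trans D" and off: "\<And>z. z \<in> space (M \<Otimes>\<^sub>M M) \<Longrightarrow> z \<notin> D \<Longrightarrow> W z = 0"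
    and z: "z \<in> space (M \<Otimes>\<^sub>M M)" "z \<notin> D"
  shows "vel k W z = 0"
proof -
  obtain x y where xy: "z = (x, y)" "x \<in> space M" "y \<in> space M"
    using z by (auto simp: space_pair_measure)
  have "t_ind k M F a b W x y = 0" if p: "(F, a, b) \<in> completed_pairs k" for F a b
  proof -
    have ab: "F \<in> graphs k" "a \<in> {1..k}" "b \<in> {1..k}" "a \<noteq> b"
      using p by (auto simp: completed_pairs_def)
    let ?v = "\<lambda>u. u(a := x, b := y)"
    have "ind_weight k F W (?v u) = 0" if u: "u \<in> space (PiM ({1..k} - {a, b}) (\<lambda>_. M))" for u
    proof (rule ccontr)
      assume nz: "ind_weight k F W (?v u) \<noteq> 0"
      have "(?v u a, ?v u b) \<in> D"
      proof (rule ind_weight_path[OF assms(1,2) ab(1) nz _ completed_pairs_path[OF p] ab(4)])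
        fix i j assume "(i, j) \<in> vertex_pairs k" "(?v u i, ?v u j) \<notin> D"
        then show "W (?v u i, ?v u j) = 0"
          by (intro off fiber_pair_in_space[OF u xy(2,3)])
      qed
      then show False
        using z(2) xy(1) ab(4) by simp
    qed
    then show ?thesis
      unfolding t_ind_eq by (simp cong: Bochner_Integration.integral_cong)
  qed
  then show ?thesis
    unfolding xy(1) velocity_component_completion by (intro sum.neutral) auto
qed

text \<open>On \<open>D\<close> the upper bound on the velocity is 0, and off \<open>D\<close> the
  previous lemma applies.\<close>

lemma velocity_indicator:
  assumes "sym D" "trans D" and z: "z \<in> space (M \<Otimes>\<^sub>M M)"
    and D: "D \<in> sets (M \<Otimes>\<^sub>M M)"
  shows "vel k (indicator D) z = 0"
proof (cases "z \<in> D")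
  case True
  have "regular_graphon (indicator D)"
    using D \<open>sym D\<close> by (auto simp: regular_graphon_def indicator_def dest: symD)
  from velocity_bounds[OF this z, of k] True show ?thesis
    by simp
next
  case False
  then show ?thesis
    using assms by (intro velocity_zero_off) auto
qed

end

section \<open>Existence and uniqueness of trajectories\<close>

lemma mono_bounded_tendsto_at_top:
  fixes f :: "real \<Rightarrow> real"
  assumes mono: "\<And>s t. 0 \<le> s \<Longrightarrow> s \<le> t \<Longrightarrow> f s \<le> f t" and bdd: "\<And>t. 0 \<le> t \<Longrightarrow> f t \<le> c"
  shows "(f \<longlongrightarrow> lim (\<lambda>n. f (real n))) at_top"
proof -
  have "incseq (\<lambda>n. f (real n))"
    using mono by (auto simp: incseq_def)
  then have "convergent (\<lambda>n. f (real n))"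
    by (rule incseq_convergent[of _ c]) (use bdd in \<open>auto intro: convergentI\<close>)
  then have l: "(\<lambda>n. f (real n)) \<longlonglongrightarrow> lim (\<lambda>n. f (real n))" (is "_ \<longlonglongrightarrow> ?l")
    by (simp add: convergent_LIMSEQ_iff)
  have up: "f t \<le> ?l" if "0 \<le> t" for t
  proof -
    have "f t \<le> f (real (nat \<lceil>t\<rceil>))"
      using that by (intro mono) auto
    also have "\<dots> \<le> ?l"
      using \<open>incseq (\<lambda>n. f (real n))\<close> l by (rule incseq_le)
    finally show ?thesis .
  qed
  show ?thesis
  proof (rule order_tendstoI)
    fix a assume "a < ?l"
    then have "\<forall>\<^sub>F n in sequentially. a < f (real n)"
      using l by (rule_tac order_tendstoD)
    then obtain N where "a < f (real N)"
      by (auto simp: eventually_sequentially)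
    then show "\<forall>\<^sub>F t in at_top. a < f t"
      unfolding eventually_at_top_linorder
      using mono by (intro exI[of _ "real N"]) (meson less_le_trans of_nat_0_le_iff)
  next
    fix a assume "?l < a"
    then show "\<forall>\<^sub>F t in at_top. f t < a"
      unfolding eventually_at_top_linorder using up by (intro exI[of _ 0]) (auto intro: le_less_trans)
  qed
qed

context prob_space
begin

text \<open>\<open>D\<close> is \<open>UNIV\<close> for a general graphon and the union of the block
  squares when a decomposition is given. As the invariant class of the Euler scheme, this makes
  preservation of blocks part of the construction.\<close>

definition supported_graphon :: "('a \<times> 'a) set \<Rightarrow> ('a \<times> 'a \<Rightarrow> real) \<Rightarrow> bool" where
  "supported_graphon D W \<longleftrightarrow> regular_graphon W \<and> (\<forall>z\<in>space (M \<Otimes>\<^sub>M M) - D. W z = 0)"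

lemma supported_graphonD:
  assumes "supported_graphon D W"
  shows "regular_graphon W" "W \<in> borel_measurable (M \<Otimes>\<^sub>M M)"
    "\<And>z. z \<in> space (M \<Otimes>\<^sub>M M) \<Longrightarrow> 0 \<le> W z" "\<And>z. z \<in> space (M \<Otimes>\<^sub>M M) \<Longrightarrow> W z \<le> 1"
    "\<And>x y. x \<in> space M \<Longrightarrow> y \<in> space M \<Longrightarrow> W (x, y) = W (y, x)"
    "\<And>z. z \<in> space (M \<Otimes>\<^sub>M M) \<Longrightarrow> z \<notin> D \<Longrightarrow> W z = 0"
  using assms by (auto simp: supported_graphon_def regular_graphon_def)

lemma supported_graphon_step:
  assumes "sym D" "trans D" "supported_graphon D W" "0 \<le> h" "h * real (card (completed_pairs k)) \<le> 1"
  shows "supported_graphon D (\<lambda>z. W z + h * vel k W z)"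
proof -
  note W = supported_graphonD[OF assms(3)]
  have "0 \<le> W z + h * vel k W z \<and> W z + h * vel k W z \<le> 1" if z: "z \<in> space (M \<Otimes>\<^sub>M M)" for z
  proof -
    have "h * vel k W z \<le> h * (real (card (completed_pairs k)) * (1 - W z))"
      using velocity_bounds(2)[OF W(1) z] assms(4) by (intro mult_left_mono)
    also have "\<dots> = (h * real (card (completed_pairs k))) * (1 - W z)"
      by simp
    also have "\<dots> \<le> 1 * (1 - W z)"
      using assms(5) W(4)[OF z] by (intro mult_right_mono) auto
    finally show ?thesis
      using velocity_bounds(1)[OF W(1) z, of k] W(3)[OF z] assms(4) by simp
  qed
  moreover have "W z + h * vel k W z = 0" if "z \<in> space (M \<Otimes>\<^sub>M M)" "z \<notin> D" for z
    using velocity_zero_off[OF assms(1,2) W(6)] W(6) that by simp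
  moreover have "W (x, y) + h * vel k W (x, y) = W (y, x) + h * vel k W (y, x)"
    if "x \<in> space M" "y \<in> space M" for x y
    using W(5)[OF that] velocity_swap[of k W x y] by simp
  moreover have "(\<lambda>z. W z + h * vel k W z) \<in> borel_measurable (M \<Otimes>\<^sub>M M)"
    using W(2) borel_measurable_velocity[OF W(2)] by measurable
  ultimately show ?thesis
    by (simp add: supported_graphon_def regular_graphon_def)
qed

lemma supported_graphon_limit:
  assumes f: "\<And>n::nat. supported_graphon D (f n)"
    and lim: "\<And>z. z \<in> space (M \<Otimes>\<^sub>M M) \<Longrightarrow> (\<lambda>n. f n z) \<longlonglongrightarrow> g z"
  shows "supported_graphon D g"
proof -
  have "g \<in> borel_measurable (M \<Otimes>\<^sub>M M)"
    using supported_graphonD(2)[OF f] lim by (rule borel_measurable_LIMSEQ_real[rotated]) auto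
  moreover have "0 \<le> g z" "g z \<le> 1" if z: "z \<in> space (M \<Otimes>\<^sub>M M)" for z
    using supported_graphonD(3,4)[OF f z]
    by (auto intro: LIMSEQ_le_const[OF lim[OF z]] LIMSEQ_le_const2[OF lim[OF z]])
  moreover have "g z = 0" if z: "z \<in> space (M \<Otimes>\<^sub>M M)" "z \<notin> D" for z
    using lim[OF z(1)] supported_graphonD(6)[OF f z] LIMSEQ_unique[OF _ tendsto_const] by simp
  moreover have "g (x, y) = g (y, x)" if xy: "x \<in> space M" "y \<in> space M" for x y
  proof -
    have "(\<lambda>n. f n (x, y)) \<longlonglongrightarrow> g (x, y)" "(\<lambda>n. f n (y, x)) \<longlonglongrightarrow> g (y, x)"
      using xy by (auto intro!: lim simp: space_pair_measure)
    then show ?thesis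
      using supported_graphonD(5)[OF f xy] LIMSEQ_unique by simp
  qed
  ultimately show ?thesis
    by (simp add: supported_graphon_def regular_graphon_def)
qed

text \<open>A step \<open>h\<close> stays below 1 if \<open>h\<close> times the number of terms is
  at most 1; the \<open>+ 1\<close> in the denominator keeps the maximal step positive even without
  terms.\<close>

lemma euler_scheme_velocity:
  assumes "sym D" "trans D"
  shows "euler_scheme (space (M \<Otimes>\<^sub>M M)) (supported_graphon D) (vel k) (lipschitz_const k)
    (real (card (completed_pairs k))) (1 / (real (card (completed_pairs k)) + 1))"
proof
  fix W z assume W: "supported_graphon D W" and z: "z \<in> space (M \<Otimes>\<^sub>M M)"
  note W' = supported_graphonD[OF W]
  show "0 \<le> vel k W z"
    using velocity_bounds[OF W'(1) z] by simp
  have "real (card (completed_pairs k)) * (1 - W z) \<le> real (card (completed_pairs k)) * 1"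
    using W'(3)[OF z] by (intro mult_left_mono) auto
  then show "vel k W z \<le> real (card (completed_pairs k))"
    using velocity_bounds(2)[OF W'(1) z, of k] by simp
next
  fix U W c z
  assume U: "supported_graphon D U" and W: "supported_graphon D W"
    and c: "\<And>z. z \<in> space (M \<Otimes>\<^sub>M M) \<Longrightarrow> \<bar>U z - W z\<bar> \<le> c" and z: "z \<in> space (M \<Otimes>\<^sub>M M)"
  have "\<bar>U z\<bar> \<le> 2 \<and> \<bar>W z\<bar> \<le> 2" if "z \<in> space (M \<Otimes>\<^sub>M M)" for z
    using supported_graphonD(3,4)[OF U that] supported_graphonD(3,4)[OF W that] by simp
  then show "\<bar>vel k U z - vel k W z\<bar> \<le> lipschitz_const k * c"
    using supported_graphonD(2)[OF U] supported_graphonD(2)[OF W] c z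
    by (intro velocity_lipschitz) auto
next
  fix W h assume W: "supported_graphon D W" and h: "0 \<le> h" "h \<le> 1 / (real (card (completed_pairs k)) + 1)"
  have "h * real (card (completed_pairs k)) \<le> h * (real (card (completed_pairs k)) + 1)"
    using h(1) by (intro mult_left_mono) auto
  also have "\<dots> \<le> 1"
    using h(2) by (simp add: pos_le_divide_eq)
  finally show "supported_graphon D (\<lambda>z. W z + h * vel k W z)"
    using assms W h(1) by (intro supported_graphon_step)
next
  fix f g assume "\<And>n::nat. supported_graphon D (f n)"
    and "\<And>z. z \<in> space (M \<Otimes>\<^sub>M M) \<Longrightarrow> (\<lambda>n. f n z) \<longlonglongrightarrow> g z"
  then show "supported_graphon D g"
    by (rule supported_graphon_limit)
qed (auto simp: lipschitz_const_nonneg add_nonneg_pos)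

text \<open>The last clause is the differential equation from the right with quadratic error; the
  left derivative is recovered from it in \<open>regular_flow_trajectory\<close>.\<close>

definition regular_flow :: "nat \<Rightarrow> ('a \<times> 'a) set \<Rightarrow> (real \<Rightarrow> 'a \<times> 'a \<Rightarrow> real) \<Rightarrow> bool" where
  "regular_flow k D \<Psi> \<longleftrightarrow>
     (\<forall>t\<ge>0. supported_graphon D (\<Psi> t)) \<and>
     (\<forall>z\<in>space (M \<Otimes>\<^sub>M M). \<forall>s t. 0 \<le> s \<longrightarrow> s \<le> t \<longrightarrow> \<Psi> s z \<le> \<Psi> t z) \<and>
     (\<exists>C. \<forall>z\<in>space (M \<Otimes>\<^sub>M M). \<forall>t\<ge>0. \<forall>s\<ge>0. \<bar>\<Psi> (t + s) z - \<Psi> t z - s * vel k (\<Psi> t) z\<bar> \<le> C * s\<^sup>2)"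

lemma regular_flow_exists:
  assumes "sym D" "trans D" "supported_graphon D W"
  obtains \<Psi> where "regular_flow k D \<Psi>" "\<Psi> 0 = W"
proof -
  interpret E: euler_scheme "space (M \<Otimes>\<^sub>M M)" "supported_graphon D" "vel k" "lipschitz_const k"
    "real (card (completed_pairs k))" "1 / (real (card (completed_pairs k)) + 1)"
    by (rule euler_scheme_velocity[OF assms(1,2)])
  have "regular_flow k D (E.flow W)"
    unfolding regular_flow_def
    using E.flow_G[OF assms(3)] E.flow_mono[OF assms(3)] E.flow_quadratic[OF assms(3)] by blast
  moreover have "E.flow W 0 = W"
    by (rule ext) (rule E.flow_0)
  ultimately show ?thesis ..
qed

section \<open>The differential equation in the L-infinity norm\<close>

lemma linf_norm_nonneg:
  assumes [measurable]: "f \<in> borel_measurable (M \<Otimes>\<^sub>M M)"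
  shows "0 \<le> linf_norm M f"
proof -
  interpret P: pair_prob_space M M by (rule pair_prob_space_self)
  have "esssup (M \<Otimes>\<^sub>M M) (\<lambda>_. 0) \<le> linf_norm M f"
    unfolding linf_norm_def by (rule esssup_mono) auto
  then show ?thesis
    by (simp add: esssup_const P.emeasure_space_1)
qed

text \<open>Unfolds the essential supremum and clears the denominator \<open>s - t\<close>; the
  resulting almost everywhere inequalities can be combined pointwise.\<close>

lemma linf_derivative_iff:
  assumes \<Phi>: "\<And>s. 0 \<le> s \<Longrightarrow> \<Phi> s \<in> borel_measurable (M \<Otimes>\<^sub>M M)"
    and V: "V \<in> borel_measurable (M \<Otimes>\<^sub>M M)" and "0 \<le> t"
  shows "((\<lambda>s. linf_norm M (\<lambda>z. (\<Phi> s z - \<Phi> t z) / (s - t) - V z)) \<longlongrightarrow> 0) (at t within {0..}) \<longleftrightarrow>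
    (\<forall>e>0. \<exists>d>0. \<forall>s\<ge>0. s \<noteq> t \<longrightarrow> \<bar>s - t\<bar> < d \<longrightarrow>
      (AE z in M \<Otimes>\<^sub>M M. \<bar>\<Phi> s z - \<Phi> t z - (s - t) * V z\<bar> \<le> e * \<bar>s - t\<bar>))"
    (is "(?f \<longlongrightarrow> 0) _ \<longleftrightarrow> ?R")
proof -
  let ?q = "\<lambda>s z. (\<Phi> s z - \<Phi> t z) / (s - t) - V z"
  have meas: "?q s \<in> borel_measurable (M \<Otimes>\<^sub>M M)" if "0 \<le> s" for s
    using \<Phi>[OF that] \<Phi>[OF \<open>0 \<le> t\<close>] V by measurable
  have scale: "\<bar>?q s z\<bar> \<le> e \<longleftrightarrow> \<bar>\<Phi> s z - \<Phi> t z - (s - t) * V z\<bar> \<le> e * \<bar>s - t\<bar>" if "s \<noteq> t" for s z e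
  proof -
    have "\<Phi> s z - \<Phi> t z - (s - t) * V z = (s - t) * ?q s z"
      using that by (simp add: field_simps)
    then have "\<bar>\<Phi> s z - \<Phi> t z - (s - t) * V z\<bar> = \<bar>?q s z\<bar> * \<bar>s - t\<bar>"
      by (simp add: abs_mult)
    then show ?thesis
      using that by simp
  qed
  show ?thesis
  proof
    assume lim: "(?f \<longlongrightarrow> 0) (at t within {0..})"
    show ?R
    proof (intro allI impI)
      fix e :: real assume "0 < e"
      then have "\<forall>\<^sub>F s in at t within {0..}. ?f s < ereal e"
        using lim by (intro order_tendstoD(2)) auto
      then obtain d where d: "0 < d" "\<And>s. 0 \<le> s \<Longrightarrow> s \<noteq> t \<Longrightarrow> \<bar>s - t\<bar> < d \<Longrightarrow> ?f s < ereal e"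
        by (auto simp: eventually_at dist_real_def)
      show "\<exists>d>0. \<forall>s\<ge>0. s \<noteq> t \<longrightarrow> \<bar>s - t\<bar> < d \<longrightarrow>
        (AE z in M \<Otimes>\<^sub>M M. \<bar>\<Phi> s z - \<Phi> t z - (s - t) * V z\<bar> \<le> e * \<bar>s - t\<bar>)"
      proof (intro exI[of _ d] conjI allI impI d(1))
        fix s assume s: "0 \<le> s" "s \<noteq> t" "\<bar>s - t\<bar> < d"
        have "AE z in M \<Otimes>\<^sub>M M. ereal \<bar>?q s z\<bar> \<le> ?f s"
          unfolding linf_norm_def by (rule esssup_AE)
        then show "AE z in M \<Otimes>\<^sub>M M. \<bar>\<Phi> s z - \<Phi> t z - (s - t) * V z\<bar> \<le> e * \<bar>s - t\<bar>"
        proof eventually_elim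
          case (elim z)
          then have "ereal \<bar>?q s z\<bar> < ereal e"
            using d(2)[OF s] by (rule le_less_trans)
          then show ?case
            using scale[OF s(2), of z e] by simp
        qed
      qed
    qed
  next
    assume R: ?R
    show "(?f \<longlongrightarrow> 0) (at t within {0..})"
    proof (rule order_tendstoI)
      fix a :: ereal assume "a < 0"
      then show "\<forall>\<^sub>F s in at t within {0..}. a < ?f s"
        using linf_norm_nonneg[OF meas] by (auto simp: eventually_at_filter intro!: always_eventually intro: less_le_trans)
    next
      fix a :: ereal assume "0 < a"
      then obtain e where e: "0 < e" "ereal e < a"
        using ereal_dense2[of 0 a] by auto
      then obtain d where d: "0 < d" "\<And>s. 0 \<le> s \<Longrightarrow> s \<noteq> t \<Longrightarrow> \<bar>s - t\<bar> < d \<Longrightarrow>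
          (AE z in M \<Otimes>\<^sub>M M. \<bar>\<Phi> s z - \<Phi> t z - (s - t) * V z\<bar> \<le> e * \<bar>s - t\<bar>)"
        using R by blast
      have "?f s < a" if s: "0 \<le> s" "s \<noteq> t" "\<bar>s - t\<bar> < d" for s
      proof -
        have "AE z in M \<Otimes>\<^sub>M M. ereal \<bar>?q s z\<bar> \<le> ereal e"
          using d(2)[OF s] by eventually_elim (use scale[OF s(2)] in simp)
        then have "?f s \<le> ereal e"
          unfolding linf_norm_def using meas[OF s(1)] by (intro esssup_I) auto
        then show ?thesis using e(2) by (rule le_less_trans)
      qed
      then show "\<forall>\<^sub>F s in at t within {0..}. ?f s < a"
        unfolding eventually_at dist_real_def using d(1) by blast
    qed
  qed
qed

lemma regular_graphon_graphon:
  assumes "regular_graphon W"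
  shows "graphon M W"
proof -
  have "AE z in M \<Otimes>\<^sub>M M. \<bar>W z\<bar> \<le> 1"
    using assms by (intro AE_I2) (auto simp: regular_graphon_def)
  moreover have "AE z in M \<Otimes>\<^sub>M M. 0 \<le> W z \<and> W z \<le> 1"
    using assms by (intro AE_I2) (auto simp: regular_graphon_def)
  moreover have "AE (x, y) in M \<Otimes>\<^sub>M M. W (x, y) = W (y, x)"
    using assms by (intro AE_I2) (auto simp: regular_graphon_def space_pair_measure)
  ultimately show ?thesis
    using assms by (auto simp: graphon_def kernel_def regular_graphon_def)
qed

text \<open>For \<open>s < t\<close> the expansion is started at the earlier time \<open>s\<close>,
  and the velocity at \<open>s\<close> is exchanged for that at \<open>t\<close> at a cost of order
  \<open>(t - s)^2\<close>.\<close>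

lemma regular_flow_trajectory:
  assumes flow: "regular_flow k D \<Psi>" and init: "AE z in M \<Otimes>\<^sub>M M. \<Psi> 0 z = W z"
  shows "trajectory k M (component_completion_rule k) W \<Psi>"
proof -
  obtain C where C: "\<And>z t s. z \<in> space (M \<Otimes>\<^sub>M M) \<Longrightarrow> 0 \<le> t \<Longrightarrow> 0 \<le> s \<Longrightarrow>
      \<bar>\<Psi> (t + s) z - \<Psi> t z - s * vel k (\<Psi> t) z\<bar> \<le> C * s\<^sup>2"
    using flow unfolding regular_flow_def by blast
  have sup: "supported_graphon D (\<Psi> t)" if "0 \<le> t" for t
    using flow that by (auto simp: regular_flow_def)
  note \<Psi> = supported_graphonD[OF sup]
  let ?L = "lipschitz_const k" and ?B = "real (card (completed_pairs k))"
  have C0: "0 \<le> C"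
  proof -
    obtain x where "x \<in> space M" using not_empty by blast
    then have "(x, x) \<in> space (M \<Otimes>\<^sub>M M)" by (simp add: space_pair_measure)
    from C[OF this, of 0 1] show ?thesis by simp
  qed
  have B: "\<bar>vel k (\<Psi> t) z\<bar> \<le> ?B" if "0 \<le> t" "z \<in> space (M \<Otimes>\<^sub>M M)" for t z
  proof -
    have "?B * (1 - \<Psi> t z) \<le> ?B * 1"
      using \<Psi>(3)[OF that] by (intro mult_left_mono) auto
    then show ?thesis
      using velocity_bounds[OF \<Psi>(1)[OF that(1)] that(2), of k] by simp
  qed
  \<comment> \<open>\<open>C\<close> is the given remainder. On time intervals of length at most 1
    the flow is Lipschitz in time with constant \<open>?B + C\<close>, so
    \<open>?L * (?B + C)\<close> pays for the exchange of velocities.\<close>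
  define Q where "Q = C + ?L * (?B + C)"
  have Q0: "0 \<le> Q"
    using C0 lipschitz_const_nonneg[of k] by (simp add: Q_def)
  have key: "\<bar>\<Psi> s z - \<Psi> t z - (s - t) * vel k (\<Psi> t) z\<bar> \<le> Q * (s - t)\<^sup>2"
    if st: "0 \<le> s" "0 \<le> t" "\<bar>s - t\<bar> \<le> 1" and z: "z \<in> space (M \<Otimes>\<^sub>M M)" for s t z
  proof (cases "t \<le> s")
    case True
    have "C * (s - t)\<^sup>2 \<le> Q * (s - t)\<^sup>2"
      using C0 lipschitz_const_nonneg[of k] by (intro mult_right_mono) (auto simp: Q_def)
    then show ?thesis
      using C[OF z st(2), of "s - t"] True by simp
  next
    case False
    define r where "r = t - s"
    have r: "0 \<le> r" "r \<le> 1" "t = s + r"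
      using False st by (auto simp: r_def)
    have "\<bar>\<Psi> s z - \<Psi> t z\<bar> \<le> (?B + C) * r" if z: "z \<in> space (M \<Otimes>\<^sub>M M)" for z
    proof -
      have "\<bar>r * vel k (\<Psi> s) z\<bar> \<le> r * ?B"
        using B[OF st(1) z] r by (simp add: abs_mult mult_left_mono)
      moreover have "C * r\<^sup>2 \<le> C * r"
        using C0 r by (intro mult_left_mono) (auto simp: power2_eq_square mult_left_le)
      ultimately show ?thesis
        using C[OF z st(1) r(1)] r(3) by (simp add: algebra_simps)
    qed
    moreover have "\<bar>\<Psi> s z\<bar> \<le> 2 \<and> \<bar>\<Psi> t z\<bar> \<le> 2" if "z \<in> space (M \<Otimes>\<^sub>M M)" for z
      using \<Psi>(3,4)[OF st(1) that] \<Psi>(3,4)[OF st(2) that] by simp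
    ultimately have "\<bar>vel k (\<Psi> s) z - vel k (\<Psi> t) z\<bar> \<le> ?L * ((?B + C) * r)"
      using z by (intro velocity_lipschitz \<Psi>(2) st) auto
    then have "\<bar>r * (vel k (\<Psi> s) z - vel k (\<Psi> t) z)\<bar> \<le> r * (?L * ((?B + C) * r))"
      using r by (simp add: abs_mult mult_left_mono)
    then have "\<bar>\<Psi> s z - \<Psi> t z - (s - t) * vel k (\<Psi> t) z\<bar> \<le> C * r\<^sup>2 + r * (?L * ((?B + C) * r))"
      using C[OF z st(1) r(1)] r(3) by (simp add: algebra_simps)
    also have "\<dots> = Q * (s - t)\<^sup>2"
      by (simp add: Q_def r_def power2_eq_square algebra_simps)
    finally show ?thesis .
  qed
  have deriv: "((\<lambda>s. linf_norm M (\<lambda>z. (\<Psi> s z - \<Psi> t z) / (s - t) - vel k (\<Psi> t) z)) \<longlongrightarrow> 0) (at t within {0..})"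
    if t: "0 \<le> t" for t
  proof (subst linf_derivative_iff[OF \<Psi>(2) borel_measurable_velocity[OF \<Psi>(2)[OF t]] t], assumption, intro allI impI)
    fix e :: real assume "0 < e"
    show "\<exists>d>0. \<forall>s\<ge>0. s \<noteq> t \<longrightarrow> \<bar>s - t\<bar> < d \<longrightarrow>
      (AE z in M \<Otimes>\<^sub>M M. \<bar>\<Psi> s z - \<Psi> t z - (s - t) * vel k (\<Psi> t) z\<bar> \<le> e * \<bar>s - t\<bar>)"
    proof (intro exI[of _ "min 1 (e / (Q + 1))"] conjI allI impI AE_I2)
      show "0 < min 1 (e / (Q + 1))"
        using Q0 \<open>0 < e\<close> by simp
      fix s z assume s: "0 \<le> s" "s \<noteq> t" "\<bar>s - t\<bar> < min 1 (e / (Q + 1))" and z: "z \<in> space (M \<Otimes>\<^sub>M M)"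
      have "\<bar>s - t\<bar> * (Q + 1) \<le> e"
        using s(3) Q0 by (simp add: pos_less_divide_eq)
      then have "Q * \<bar>s - t\<bar> \<le> e"
        by (simp add: algebra_simps)
      then have "Q * \<bar>s - t\<bar> * \<bar>s - t\<bar> \<le> e * \<bar>s - t\<bar>"
        by (intro mult_right_mono) auto
      then show "\<bar>\<Psi> s z - \<Psi> t z - (s - t) * vel k (\<Psi> t) z\<bar> \<le> e * \<bar>s - t\<bar>"
        using key[OF s(1) t _ z] s(3) by (simp add: power2_eq_square abs_mult_self_eq mult.assoc)
    qed
  qed
  have "kernel M (\<Psi> t)" if "0 \<le> t" for t
    using regular_graphon_graphon[OF \<Psi>(1)[OF that]] by (simp add: graphon_def)
  then show ?thesis
    using init deriv by (simp add: trajectory_def)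
qed

lemma trajectory_derivative:
  assumes "trajectory k M (component_completion_rule k) W \<Phi>" "0 \<le> t" "0 < e"
  shows "\<exists>d>0. \<forall>s\<ge>0. s \<noteq> t \<longrightarrow> \<bar>s - t\<bar> < d \<longrightarrow>
      (AE z in M \<Otimes>\<^sub>M M. \<bar>\<Phi> s z - \<Phi> t z - (s - t) * vel k (\<Phi> t) z\<bar> \<le> e * \<bar>s - t\<bar>)"
proof -
  have meas: "\<Phi> s \<in> borel_measurable (M \<Otimes>\<^sub>M M)" if "0 \<le> s" for s
    using assms(1) that by (auto simp: trajectory_def kernel_def)
  have "((\<lambda>s. linf_norm M (\<lambda>z. (\<Phi> s z - \<Phi> t z) / (s - t) - vel k (\<Phi> t) z)) \<longlongrightarrow> 0) (at t within {0..})"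
    using assms(1,2) by (auto simp: trajectory_def)
  then show ?thesis
    using assms(3) linf_derivative_iff[of \<Phi> "vel k (\<Phi> t)" t, OF meas borel_measurable_velocity[OF meas[OF assms(2)]] assms(2)]
    by blast
qed

text \<open>Consider the first time at which the distance exceeds the barrier. As long as the barrier is at most 1,
  both solutions are bounded by 2, the range in which the velocity is Lipschitz.\<close>

lemma trajectories_distance:
  assumes \<Phi>: "trajectory k M (component_completion_rule k) W \<Phi>"
    and \<Psi>: "trajectory k M (component_completion_rule k) W \<Psi>"
    and \<Psi>1: "\<And>t. 0 \<le> t \<Longrightarrow> AE z in M \<Otimes>\<^sub>M M. \<bar>\<Psi> t z\<bar> \<le> 1"
    and "0 < \<epsilon>" "0 \<le> T" "\<epsilon> * exp ((lipschitz_const k + 1) * T) \<le> 1"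
  shows "AE z in M \<Otimes>\<^sub>M M. \<bar>\<Phi> T z - \<Psi> T z\<bar> \<le> \<epsilon> * exp ((lipschitz_const k + 1) * T)"
proof (rule ccontr)
  let ?L = "lipschitz_const k"
  define h where "h t = \<epsilon> * exp ((?L + 1) * t)" for t
  define B where "B = {t. 0 \<le> t \<and> t \<le> T \<and> \<not> (AE z in M \<Otimes>\<^sub>M M. \<bar>\<Phi> t z - \<Psi> t z\<bar> \<le> h t)}"
  assume "\<not> ?thesis"
  then have "T \<in> B"
    using assms by (simp add: B_def h_def)
  have h_pos: "0 < h t" for t
    using assms by (simp add: h_def)
  have h_mono: "h s \<le> h t" if "s \<le> t" for s t
    using that assms lipschitz_const_nonneg[of k] by (simp add: h_def mult_left_mono)
  have bdd: "bdd_below B"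
    by (rule bdd_belowI[of _ 0]) (auto simp: B_def)
  define \<tau> where "\<tau> = Inf B"
  have \<tau>: "0 \<le> \<tau>" "\<tau> \<le> T"
    using \<open>T \<in> B\<close> bdd by (auto simp: \<tau>_def B_def intro: cInf_greatest cInf_lower)
  have before: "AE z in M \<Otimes>\<^sub>M M. \<bar>\<Phi> s z - \<Psi> s z\<bar> \<le> h \<tau>" if s: "0 \<le> s" "s < \<tau>" for s
  proof -
    have "s \<notin> B"
      using s(2) bdd cInf_lower[of s B] by (auto simp: \<tau>_def)
    then have "AE z in M \<Otimes>\<^sub>M M. \<bar>\<Phi> s z - \<Psi> s z\<bar> \<le> h s"
      using s \<tau> by (auto simp: B_def)
    then show ?thesis
      by eventually_elim (use h_mono[of s \<tau>] s in auto)
  qed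
  \<comment> \<open>The barrier still holds at \<open>\<tau>\<close> itself, by continuity from the
    left. Only a sequence of earlier times is used, so that the exceptional null sets are countably
    many.\<close>
  have at: "AE z in M \<Otimes>\<^sub>M M. \<bar>\<Phi> \<tau> z - \<Psi> \<tau> z\<bar> \<le> h \<tau>"
  proof (cases "\<tau> = 0")
    case True
    have "AE z in M \<Otimes>\<^sub>M M. \<Phi> 0 z = W z" "AE z in M \<Otimes>\<^sub>M M. \<Psi> 0 z = W z"
      using \<Phi> \<Psi> by (auto simp: trajectory_def)
    then show ?thesis
      by eventually_elim (use h_pos[of 0] True in auto)
  next
    case False
    obtain d1 where d1: "0 < d1" "\<And>s. 0 \<le> s \<Longrightarrow> s \<noteq> \<tau> \<Longrightarrow> \<bar>s - \<tau>\<bar> < d1 \<Longrightarrow>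
        (AE z in M \<Otimes>\<^sub>M M. \<bar>\<Phi> s z - \<Phi> \<tau> z - (s - \<tau>) * vel k (\<Phi> \<tau>) z\<bar> \<le> 1 * \<bar>s - \<tau>\<bar>)"
      using trajectory_derivative[OF \<Phi> \<tau>(1), of 1] by auto
    obtain d2 where d2: "0 < d2" "\<And>s. 0 \<le> s \<Longrightarrow> s \<noteq> \<tau> \<Longrightarrow> \<bar>s - \<tau>\<bar> < d2 \<Longrightarrow>
        (AE z in M \<Otimes>\<^sub>M M. \<bar>\<Psi> s z - \<Psi> \<tau> z - (s - \<tau>) * vel k (\<Psi> \<tau>) z\<bar> \<le> 1 * \<bar>s - \<tau>\<bar>)"
      using trajectory_derivative[OF \<Psi> \<tau>(1), of 1] by auto
    define \<delta> where "\<delta> = min \<tau> (min d1 d2)"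
    have \<delta>: "0 < \<delta>" "\<delta> \<le> \<tau>" "\<delta> \<le> d1" "\<delta> \<le> d2"
      using False \<tau> d1(1) d2(1) by (auto simp: \<delta>_def)
    define r where "r n = \<delta> / real (n + 2)" for n :: nat
    have r: "0 < r n" "r n < \<delta>" for n
      using \<delta>(1) by (auto simp: r_def divide_less_eq)
    have r_lim: "r \<longlonglongrightarrow> 0"
      unfolding r_def by (rule LIMSEQ_ignore_initial_segment[OF lim_const_over_n])
    have "AE z in M \<Otimes>\<^sub>M M. \<forall>n. \<bar>\<Phi> \<tau> z - \<Psi> \<tau> z\<bar>
        \<le> h \<tau> + r n * (2 + \<bar>vel k (\<Phi> \<tau>) z\<bar> + \<bar>vel k (\<Psi> \<tau>) z\<bar>)"
    proof (subst AE_all_countable, rule allI)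
      fix n
      let ?s = "\<tau> - r n"
      have s: "0 \<le> ?s" "?s \<noteq> \<tau>" "?s < \<tau>" "\<bar>?s - \<tau>\<bar> < d1" "\<bar>?s - \<tau>\<bar> < d2"
        using r[of n] \<delta> by auto
      show "AE z in M \<Otimes>\<^sub>M M. \<bar>\<Phi> \<tau> z - \<Psi> \<tau> z\<bar>
        \<le> h \<tau> + r n * (2 + \<bar>vel k (\<Phi> \<tau>) z\<bar> + \<bar>vel k (\<Psi> \<tau>) z\<bar>)"
        using before[OF s(1,3)] d1(2)[OF s(1,2,4)] d2(2)[OF s(1,2,5)]
      proof eventually_elim
        case (elim z)
        have "\<bar>\<Phi> ?s z - \<Phi> \<tau> z\<bar> \<le> r n + r n * \<bar>vel k (\<Phi> \<tau>) z\<bar>"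
          using elim(2) r(1)[of n] abs_mult[of "r n" "vel k (\<Phi> \<tau>) z"] by simp
        moreover have "\<bar>\<Psi> ?s z - \<Psi> \<tau> z\<bar> \<le> r n + r n * \<bar>vel k (\<Psi> \<tau>) z\<bar>"
          using elim(3) r(1)[of n] abs_mult[of "r n" "vel k (\<Psi> \<tau>) z"] by simp
        ultimately have "\<bar>\<Phi> \<tau> z - \<Psi> \<tau> z\<bar>
          \<le> h \<tau> + (r n + r n * \<bar>vel k (\<Phi> \<tau>) z\<bar>) + (r n + r n * \<bar>vel k (\<Psi> \<tau>) z\<bar>)"
          using elim(1) by linarith
        then show ?case
          by (simp add: algebra_simps)
      qed
    qed
    then show ?thesis
    proof eventually_elim
      case (elim z)
      let ?c = "2 + \<bar>vel k (\<Phi> \<tau>) z\<bar> + \<bar>vel k (\<Psi> \<tau>) z\<bar>"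
      have "(\<lambda>n. h \<tau> + r n * ?c) \<longlonglongrightarrow> h \<tau> + 0 * ?c"
        by (intro tendsto_intros r_lim)
      then show ?case
        using elim by (intro LIMSEQ_le_const[of _ "h \<tau>"]) auto
    qed
  qed
  have "h \<tau> \<le> 1"
    by (rule order_trans[OF h_mono[OF \<tau>(2)]]) (use assms(6) in \<open>simp add: h_def\<close>)
  have meas: "\<Phi> \<tau> \<in> borel_measurable (M \<Otimes>\<^sub>M M)" "\<Psi> \<tau> \<in> borel_measurable (M \<Otimes>\<^sub>M M)"
    using \<Phi> \<Psi> \<tau> by (auto simp: trajectory_def kernel_def)
  have lip: "AE z in M \<Otimes>\<^sub>M M. \<bar>vel k (\<Phi> \<tau>) z - vel k (\<Psi> \<tau>) z\<bar> \<le> ?L * h \<tau>"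
  proof (rule velocity_lipschitz_AE[OF meas less_imp_le[OF h_pos] _ _ at])
    show "AE z in M \<Otimes>\<^sub>M M. \<bar>\<Phi> \<tau> z\<bar> \<le> 2"
      using at \<Psi>1[OF \<tau>(1)] by eventually_elim (use \<open>h \<tau> \<le> 1\<close> in linarith)
    show "AE z in M \<Otimes>\<^sub>M M. \<bar>\<Psi> \<tau> z\<bar> \<le> 2"
      using \<Psi>1[OF \<tau>(1)] by eventually_elim linarith
  qed
  \<comment> \<open>The error \<open>h \<tau> / 2\<close> is allowed to each derivative. The
    difference then grows at rate at most \<open>?L * h \<tau>\<close> from the velocities plus
    \<open>h \<tau>\<close> from the errors, which is the slope of the barrier at
    \<open>\<tau>\<close>; the barrier is convex, so no crossing follows shortly after
    \<open>\<tau>\<close>, contrary to the choice of \<open>\<tau>\<close>.\<close>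
  have e: "0 < h \<tau> / 2" using h_pos by simp
  obtain d1 where d1: "0 < d1" "\<And>s. 0 \<le> s \<Longrightarrow> s \<noteq> \<tau> \<Longrightarrow> \<bar>s - \<tau>\<bar> < d1 \<Longrightarrow>
      (AE z in M \<Otimes>\<^sub>M M. \<bar>\<Phi> s z - \<Phi> \<tau> z - (s - \<tau>) * vel k (\<Phi> \<tau>) z\<bar> \<le> h \<tau> / 2 * \<bar>s - \<tau>\<bar>)"
    using trajectory_derivative[OF \<Phi> \<tau>(1) e] by auto
  obtain d2 where d2: "0 < d2" "\<And>s. 0 \<le> s \<Longrightarrow> s \<noteq> \<tau> \<Longrightarrow> \<bar>s - \<tau>\<bar> < d2 \<Longrightarrow>
      (AE z in M \<Otimes>\<^sub>M M. \<bar>\<Psi> s z - \<Psi> \<tau> z - (s - \<tau>) * vel k (\<Psi> \<tau>) z\<bar> \<le> h \<tau> / 2 * \<bar>s - \<tau>\<bar>)"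
    using trajectory_derivative[OF \<Psi> \<tau>(1) e] by auto
  have "Inf B < \<tau> + min d1 d2"
    using d1(1) d2(1) by (simp add: \<tau>_def)
  then obtain s where s: "s \<in> B" "s < \<tau> + min d1 d2"
    using \<open>T \<in> B\<close> cInf_lessD[of B] by blast
  have "\<tau> \<le> s"
    using s(1) bdd by (auto simp: \<tau>_def intro: cInf_lower)
  have "\<tau> \<noteq> s"
    using s(1) at by (auto simp: B_def)
  with \<open>\<tau> \<le> s\<close> have s': "0 \<le> s" "s \<noteq> \<tau>" "\<tau> < s" "\<bar>s - \<tau>\<bar> < d1" "\<bar>s - \<tau>\<bar> < d2"
    using s(2) \<tau> by auto
  have hs: "h \<tau> * (1 + (?L + 1) * (s - \<tau>)) \<le> h s"
  proof -
    have "h s = h \<tau> * exp ((?L + 1) * (s - \<tau>))"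
      by (simp add: h_def mult.assoc exp_add[symmetric] algebra_simps)
    then show ?thesis
      using h_pos[of \<tau>] exp_ge_add_one_self[of "(?L + 1) * (s - \<tau>)"] by (simp add: mult_left_mono)
  qed
  have "AE z in M \<Otimes>\<^sub>M M. \<bar>\<Phi> s z - \<Psi> s z\<bar> \<le> h s"
    using at lip d1(2)[OF s'(1,2,4)] d2(2)[OF s'(1,2,5)]
  proof eventually_elim
    case (elim z)
    define r where "r = s - \<tau>"
    have r: "0 < r" "\<bar>s - \<tau>\<bar> = r"
      using s'(3) by (auto simp: r_def)
    have "\<bar>r * (vel k (\<Phi> \<tau>) z - vel k (\<Psi> \<tau>) z)\<bar> \<le> r * (?L * h \<tau>)"
      using elim(2) r by (simp add: abs_mult mult_left_mono)
    then have v: "\<bar>r * vel k (\<Phi> \<tau>) z - r * vel k (\<Psi> \<tau>) z\<bar> \<le> r * (?L * h \<tau>)"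
      by (simp add: right_diff_distrib)
    have "\<bar>\<Phi> s z - \<Psi> s z\<bar> \<le> h \<tau> + r * (?L * h \<tau>) + h \<tau> / 2 * r + h \<tau> / 2 * r"
      using elim(1,3,4) v unfolding r_def[symmetric] abs_of_pos[OF r(1)] by linarith
    also have "\<dots> = h \<tau> * (1 + (?L + 1) * (s - \<tau>))"
      by (simp add: r_def field_simps)
    also note hs
    finally show ?case .
  qed
  then show False
    using s(1) by (simp add: B_def)
qed

lemma trajectory_unique:
  assumes \<Phi>: "trajectory k M (component_completion_rule k) W \<Phi>"
    and \<Psi>: "trajectory k M (component_completion_rule k) W \<Psi>"
    and \<Psi>1: "\<And>t. 0 \<le> t \<Longrightarrow> AE z in M \<Otimes>\<^sub>M M. \<bar>\<Psi> t z\<bar> \<le> 1"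
    and T: "0 \<le> T"
  shows "AE z in M \<Otimes>\<^sub>M M. \<Phi> T z = \<Psi> T z"
proof -
  let ?E = "exp ((lipschitz_const k + 1) * T)"
  have "AE z in M \<Otimes>\<^sub>M M. \<forall>n. \<bar>\<Phi> T z - \<Psi> T z\<bar> \<le> 1 / real (Suc n)"
  proof (subst AE_all_countable, rule allI)
    fix n
    \<comment> \<open>The initial height of the barrier is chosen so that its height at
      \<open>T\<close> is \<open>1 / Suc n\<close>, within the admissible 1.\<close>
    have "1 / real (Suc n) \<le> 1" by simp
    then show "AE z in M \<Otimes>\<^sub>M M. \<bar>\<Phi> T z - \<Psi> T z\<bar> \<le> 1 / real (Suc n)"
      using trajectories_distance[OF \<Phi> \<Psi> \<Psi>1 _ T, of "1 / real (Suc n) / ?E"] by simp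
  qed
  then show ?thesis
  proof eventually_elim
    case (elim z)
    have "(\<lambda>n. 1 / real (Suc n)) \<longlonglongrightarrow> 0"
      by (rule LIMSEQ_Suc[OF lim_const_over_n])
    then have "\<bar>\<Phi> T z - \<Psi> T z\<bar> \<le> 0"
      using elim by (intro LIMSEQ_le_const[of _ 0]) auto
    then show ?case by simp
  qed
qed

text \<open>The monotone limit in time is only pointwise, so the Lipschitz estimate for the supremum
  does not apply; dominated convergence on each fibre takes its place.\<close>

lemma velocity_tendsto:
  assumes f: "\<And>n::nat. regular_graphon (f n)" and g: "regular_graphon g"
    and lim: "\<And>z. z \<in> space (M \<Otimes>\<^sub>M M) \<Longrightarrow> (\<lambda>n. f n z) \<longlonglongrightarrow> g z"
    and z: "z \<in> space (M \<Otimes>\<^sub>M M)"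
  shows "(\<lambda>n. vel k (f n) z) \<longlonglongrightarrow> vel k g z"
proof -
  obtain x y where xy: "z = (x, y)" "x \<in> space M" "y \<in> space M"
    using z by (auto simp: space_pair_measure)
  have t: "(\<lambda>n. t_ind k M F a b (f n) x y) \<longlonglongrightarrow> t_ind k M F a b g x y"
    if p: "(F, a, b) \<in> completed_pairs k" for F a b
    unfolding t_ind_eq
  proof (rule integral_dominated_convergence[where w = "\<lambda>_. 3 ^ card (vertex_pairs k)"])
    interpret PJ: prob_space "PiM ({1..k} - {a, b}) (\<lambda>_. M)" by (rule prob_space_PiM_const)
    let ?v = "\<lambda>u. u(a := x, b := y)"
    show "(\<lambda>u. ind_weight k F g (?v u)) \<in> borel_measurable (PiM ({1..k} - {a, b}) (\<lambda>_. M))"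
      using g p xy by (intro borel_measurable_ind_weight_fiber) (auto simp: regular_graphon_def)
    show "(\<lambda>u. ind_weight k F (f n) (?v u)) \<in> borel_measurable (PiM ({1..k} - {a, b}) (\<lambda>_. M))" for n
      using f[of n] p xy by (intro borel_measurable_ind_weight_fiber) (auto simp: regular_graphon_def)
    show "integrable (PiM ({1..k} - {a, b}) (\<lambda>_. M)) (\<lambda>_. 3 ^ card (vertex_pairs k) :: real)"
      by (rule PJ.integrable_const)
    show "AE u in PiM ({1..k} - {a, b}) (\<lambda>_. M). (\<lambda>n. ind_weight k F (f n) (?v u)) \<longlonglongrightarrow> ind_weight k F g (?v u)"
    proof (rule AE_I2)
      fix u assume u: "u \<in> space (PiM ({1..k} - {a, b}) (\<lambda>_. M))"
      show "(\<lambda>n. ind_weight k F (f n) (?v u)) \<longlonglongrightarrow> ind_weight k F g (?v u)"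
        unfolding ind_weight_def split_def
      proof (rule tendsto_prod)
        fix p assume p: "p \<in> vertex_pairs k"
        have "(?v u (fst p), ?v u (snd p)) \<in> space (M \<Otimes>\<^sub>M M)"
          by (rule fiber_pair_in_space[OF u xy(2,3)]) (use p in simp)
        from lim[OF this] tendsto_diff[OF tendsto_const lim[OF this], of 1]
        show "(\<lambda>n. if {fst p, snd p} \<in> F then f n (?v u (fst p), ?v u (snd p)) else 1 - f n (?v u (fst p), ?v u (snd p)))
          \<longlonglongrightarrow> (if {fst p, snd p} \<in> F then g (?v u (fst p), ?v u (snd p)) else 1 - g (?v u (fst p), ?v u (snd p)))"
          by (cases "{fst p, snd p} \<in> F") (simp_all only: if_True if_False)
      qed
    qed
    show "AE u in PiM ({1..k} - {a, b}) (\<lambda>_. M). norm (ind_weight k F (f n) (?v u)) \<le> 3 ^ card (vertex_pairs k)" for n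
    proof (rule AE_I2)
      fix u assume u: "u \<in> space (PiM ({1..k} - {a, b}) (\<lambda>_. M))"
      show "norm (ind_weight k F (f n) (?v u)) \<le> 3 ^ card (vertex_pairs k)"
        unfolding real_norm_def
      proof (rule abs_ind_weight_le)
        fix i j assume "(i, j) \<in> vertex_pairs k"
        from fiber_pair_in_space[OF u xy(2,3) this] f[of n]
        have "0 \<le> f n (?v u i, ?v u j) \<and> f n (?v u i, ?v u j) \<le> 1"
          unfolding regular_graphon_def by blast
        then show "\<bar>f n (?v u i, ?v u j)\<bar> \<le> 2"
          by linarith
      qed
    qed
  qed
  show ?thesis
    unfolding xy(1) velocity_component_completion
    by (intro tendsto_sum) (use t in auto)
qed

lemma regular_flow_limit:
  assumes flow: "regular_flow k D \<Psi>"
  obtains S where "supported_graphon D S"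
    and "\<And>z. z \<in> space (M \<Otimes>\<^sub>M M) \<Longrightarrow> ((\<lambda>t. \<Psi> t z) \<longlongrightarrow> S z) at_top"
    and "\<And>z. z \<in> space (M \<Otimes>\<^sub>M M) \<Longrightarrow> \<Psi> 0 z \<le> S z"
    and "\<And>z. z \<in> space (M \<Otimes>\<^sub>M M) \<Longrightarrow> vel k S z = 0"
proof -
  have sup: "supported_graphon D (\<Psi> t)" if "0 \<le> t" for t
    using flow that unfolding regular_flow_def by blast
  have mono: "\<Psi> s z \<le> \<Psi> t z" if "z \<in> space (M \<Otimes>\<^sub>M M)" "0 \<le> s" "s \<le> t" for s t z
    using flow that unfolding regular_flow_def by blast
  obtain C where C: "\<And>z t s. z \<in> space (M \<Otimes>\<^sub>M M) \<Longrightarrow> 0 \<le> t \<Longrightarrow> 0 \<le> s \<Longrightarrow>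
      \<bar>\<Psi> (t + s) z - \<Psi> t z - s * vel k (\<Psi> t) z\<bar> \<le> C * s\<^sup>2"
    using flow unfolding regular_flow_def by blast
  define S where "S z = lim (\<lambda>n. \<Psi> (real n) z)" for z
  have lim: "((\<lambda>t. \<Psi> t z) \<longlongrightarrow> S z) at_top" if z: "z \<in> space (M \<Otimes>\<^sub>M M)" for z
    unfolding S_def using mono[OF z] supported_graphonD(4)[OF sup z]
    by (rule mono_bounded_tendsto_at_top)
  have lim_nat: "(\<lambda>n. \<Psi> (real n) z) \<longlonglongrightarrow> S z" if z: "z \<in> space (M \<Otimes>\<^sub>M M)" for z
    by (rule filterlim_compose[OF lim[OF z] filterlim_real_sequentially])
  have S: "supported_graphon D S"
    by (rule supported_graphon_limit[of D "\<lambda>n. \<Psi> (real n)"]) (auto intro: sup lim_nat)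
  have "vel k S z = 0" if z: "z \<in> space (M \<Otimes>\<^sub>M M)" for z
  proof -
    \<comment> \<open>For fixed \<open>s\<close> and time tending to infinity, both values of the
      flow in the remainder estimate tend to \<open>S z\<close>, and only the velocity term is left.
      Afterwards \<open>s\<close> tends to 0.\<close>
    have bound: "\<bar>vel k S z\<bar> \<le> C * s" if s: "0 < s" for s
    proof -
      have "(\<lambda>n. vel k (\<Psi> (real n)) z) \<longlonglongrightarrow> vel k S z"
        using z by (intro velocity_tendsto lim_nat supported_graphonD(1)[OF S] supported_graphonD(1)[OF sup]) auto
      moreover have "filterlim (\<lambda>n. s + real n) at_top sequentially"
        by (intro filterlim_tendsto_add_at_top[OF tendsto_const] filterlim_real_sequentially)
      then have "(\<lambda>n. \<Psi> (real n + s) z) \<longlonglongrightarrow> S z"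
        by (intro filterlim_compose[OF lim[OF z]]) (simp add: add.commute)
      ultimately have "(\<lambda>n. \<bar>\<Psi> (real n + s) z - \<Psi> (real n) z - s * vel k (\<Psi> (real n)) z\<bar>)
        \<longlonglongrightarrow> \<bar>S z - S z - s * vel k S z\<bar>"
        by (intro tendsto_intros lim_nat[OF z])
      then have "\<bar>S z - S z - s * vel k S z\<bar> \<le> C * s\<^sup>2"
        using C[OF z] s by (intro LIMSEQ_le_const2) auto
      then have "s * \<bar>vel k S z\<bar> \<le> s * (C * s)"
        using s by (simp add: abs_mult power2_eq_square algebra_simps)
      then show ?thesis
        using s by simp
    qed
    have "(\<lambda>n. C * (1 / real (Suc n))) \<longlonglongrightarrow> C * 0"
      by (intro tendsto_intros LIMSEQ_Suc[OF lim_const_over_n])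
    then have "\<bar>vel k S z\<bar> \<le> C * 0"
      by (rule LIMSEQ_le_const) (intro exI[of _ 0] allI impI bound, simp)
    then show ?thesis by simp
  qed
  moreover have "\<Psi> 0 z \<le> S z" if z: "z \<in> space (M \<Otimes>\<^sub>M M)" for z
    by (rule LIMSEQ_le_const[OF lim_nat[OF z]]) (use mono[OF z] in auto)
  ultimately show ?thesis
    using that S lim by blast
qed

end

section \<open>Convergence in the cut distance\<close>

lemma set_integral_abs_le:
  fixes f :: "'b \<Rightarrow> real"
  assumes f: "integrable N f" and C: "C \<in> sets N"
  shows "\<bar>LINT z:C|N. f z\<bar> \<le> (LINT z|N. \<bar>f z\<bar>)"
proof -
  have "\<bar>LINT z:C|N. f z\<bar> \<le> (LINT z|N. \<bar>indicator C z *\<^sub>R f z\<bar>)"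
    unfolding set_lebesgue_integral_def by (rule integral_abs_bound)
  also have "\<dots> \<le> (LINT z|N. \<bar>f z\<bar>)"
    using f C by (intro integral_mono integrable_abs integrable_mult_indicator) (auto simp: indicator_def)
  finally show ?thesis .
qed

context prob_space
begin

lemma kernel_integrable:
  assumes "kernel M W"
  shows "integrable (M \<Otimes>\<^sub>M M) W"
proof -
  interpret P: pair_prob_space M M by (rule pair_prob_space_self)
  from assms obtain C where "AE z in M \<Otimes>\<^sub>M M. \<bar>W z\<bar> \<le> C" "W \<in> borel_measurable (M \<Otimes>\<^sub>M M)"
    by (auto simp: kernel_def)
  then show ?thesis
    by (intro P.integrable_const_bound[of _ C]) auto
qed

lemma
  assumes "kernel M U" "kernel M W"
  shows cut_dist_ge: "A \<in> sets M \<Longrightarrow> B \<in> sets M \<Longrightarrow> \<bar>LINT z:A \<times> B|M \<Otimes>\<^sub>M M. (U z - W z)\<bar> \<le> cut_dist M U W"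
    and cut_dist_nonneg: "0 \<le> cut_dist M U W"
    and cut_dist_le: "cut_dist M U W \<le> (LINT z|(M \<Otimes>\<^sub>M M). \<bar>U z - W z\<bar>)"
proof -
  have le: "\<bar>LINT z:A \<times> B|M \<Otimes>\<^sub>M M. (U z - W z)\<bar> \<le> (LINT z|(M \<Otimes>\<^sub>M M). \<bar>U z - W z\<bar>)"
    if "A \<in> sets M" "B \<in> sets M" for A B
    using that assms by (intro set_integral_abs_le Bochner_Integration.integrable_diff kernel_integrable) auto
  have bdd: "bdd_above ((\<lambda>(A, B). \<bar>LINT z:A \<times> B|M \<Otimes>\<^sub>M M. (U z - W z)\<bar>) ` (sets M \<times> sets M))"
    using le by (intro bdd_aboveI2[where M = "LINT z|(M \<Otimes>\<^sub>M M). \<bar>U z - W z\<bar>"]) auto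
  show ge: "\<bar>LINT z:A \<times> B|M \<Otimes>\<^sub>M M. (U z - W z)\<bar> \<le> cut_dist M U W" if "A \<in> sets M" "B \<in> sets M" for A B
    unfolding cut_dist_def using that by (intro cSUP_upper2[OF bdd, of "(A, B)"]) auto
  show "0 \<le> cut_dist M U W"
    using ge[of "{}" "{}"] by simp
  show "cut_dist M U W \<le> (LINT z|(M \<Otimes>\<^sub>M M). \<bar>U z - W z\<bar>)"
    unfolding cut_dist_def using le by (intro cSUP_least) auto
qed

text \<open>Nonnegative integrable functions are densities of finite measures, and the measurable
  rectangles form an intersection-stable generator on which these measures agree.\<close>

lemma AE_eq_of_rectangle_integrals:
  fixes f g :: "'a \<times> 'a \<Rightarrow> real"
  assumes f: "integrable (M \<Otimes>\<^sub>M M) f" "AE z in M \<Otimes>\<^sub>M M. 0 \<le> f z"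
    and g: "integrable (M \<Otimes>\<^sub>M M) g" "AE z in M \<Otimes>\<^sub>M M. 0 \<le> g z"
    and eq: "\<And>A B. A \<in> sets M \<Longrightarrow> B \<in> sets M \<Longrightarrow>
      (LINT z:A \<times> B|M \<Otimes>\<^sub>M M. f z) = (LINT z:A \<times> B|M \<Otimes>\<^sub>M M. g z)"
  shows "AE z in M \<Otimes>\<^sub>M M. f z = g z"
proof -
  interpret P: pair_prob_space M M by (rule pair_prob_space_self)
  let ?E = "{a \<times> b | a b. a \<in> sets M \<and> b \<in> sets M}"
  have dens: "emeasure (density (M \<Otimes>\<^sub>M M) (\<lambda>z. ennreal (u z))) C = ennreal (LINT z:C|M \<Otimes>\<^sub>M M. u z)"
    if u: "integrable (M \<Otimes>\<^sub>M M) u" "AE z in M \<Otimes>\<^sub>M M. 0 \<le> u z" and C: "C \<in> sets (M \<Otimes>\<^sub>M M)" for u C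
  proof -
    have "emeasure (density (M \<Otimes>\<^sub>M M) (\<lambda>z. ennreal (u z))) C = (\<integral>\<^sup>+z. ennreal (indicator C z *\<^sub>R u z) \<partial>(M \<Otimes>\<^sub>M M))"
      using u C by (subst emeasure_density) (auto intro!: nn_integral_cong simp: indicator_def)
    also have "\<dots> = ennreal (LINT z:C|M \<Otimes>\<^sub>M M. u z)"
      unfolding set_lebesgue_integral_def using u C
      by (intro nn_integral_eq_integral integrable_mult_indicator) (auto simp: indicator_def)
    finally show ?thesis .
  qed
  have "density (M \<Otimes>\<^sub>M M) (\<lambda>z. ennreal (f z)) = density (M \<Otimes>\<^sub>M M) (\<lambda>z. ennreal (g z))"
  proof (rule measure_eqI_generator_eq[where E = ?E and \<Omega> = "space M \<times> space M" and A = "\<lambda>_. space M \<times> space M"])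
    show "Int_stable ?E" by (rule Int_stable_pair_measure_generator)
    show "?E \<subseteq> Pow (space M \<times> space M)"
      using sets.sets_into_space by auto
    show "emeasure (density (M \<Otimes>\<^sub>M M) (\<lambda>z. ennreal (f z))) (space M \<times> space M) \<noteq> \<infinity>"
      using f by (subst dens) auto
    fix X assume "X \<in> ?E"
    then obtain a b where X: "X = a \<times> b" "a \<in> sets M" "b \<in> sets M" by auto
    then show "emeasure (density (M \<Otimes>\<^sub>M M) (\<lambda>z. ennreal (f z))) X
      = emeasure (density (M \<Otimes>\<^sub>M M) (\<lambda>z. ennreal (g z))) X"
      using f g eq by (simp add: dens)
  qed (auto simp: sets_pair_measure)
  then have "AE z in M \<Otimes>\<^sub>M M. ennreal (f z) = ennreal (g z)"
    using f g by (subst (asm) P.density_unique_iff) auto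
  then show ?thesis
    using f(2) g(2) by eventually_elim auto
qed

text \<open>The integrals of \<open>S\<close> and \<open>S'\<close> over a rectangle differ by at
  most the sum of the two cut distances. This identifies an arbitrary destination with the
  constructed one.\<close>

lemma converges_to_unique:
  assumes \<Phi>: "\<And>t. 0 \<le> t \<Longrightarrow> kernel M (\<Phi> t)" and S: "converges_to M \<Phi> S" and S': "converges_to M \<Phi> S'"
  shows "AE z in M \<Otimes>\<^sub>M M. S z = S' z"
proof -
  have gr: "graphon M S" "graphon M S'" and ker: "kernel M S" "kernel M S'"
    using S S' by (auto simp: converges_to_def graphon_def)
  show ?thesis
  proof (rule AE_eq_of_rectangle_integrals)
    fix A B assume AB: "A \<in> sets M" "B \<in> sets M"
    let ?I = "\<lambda>W. LINT z:A \<times> B|M \<Otimes>\<^sub>M M. W z"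
    have int: "set_integrable (M \<Otimes>\<^sub>M M) (A \<times> B) W" if "kernel M W" for W
      unfolding set_integrable_def using AB by (intro integrable_mult_indicator kernel_integrable that) auto
    have "((\<lambda>t. cut_dist M (\<Phi> t) S + cut_dist M (\<Phi> t) S') \<longlongrightarrow> 0 + 0) at_top"
      using S S' by (intro tendsto_add) (auto simp: converges_to_def)
    moreover have "\<forall>\<^sub>F t in at_top. \<bar>?I S - ?I S'\<bar> \<le> cut_dist M (\<Phi> t) S + cut_dist M (\<Phi> t) S'"
      using eventually_ge_at_top[of 0]
    proof eventually_elim
      case (elim t)
      have "\<bar>?I (\<Phi> t) - ?I S\<bar> \<le> cut_dist M (\<Phi> t) S" "\<bar>?I (\<Phi> t) - ?I S'\<bar> \<le> cut_dist M (\<Phi> t) S'"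
        using cut_dist_ge[OF \<Phi>[OF elim] ker(1) AB] cut_dist_ge[OF \<Phi>[OF elim] ker(2) AB]
          int[OF \<Phi>[OF elim]] int[OF ker(1)] int[OF ker(2)]
        by (simp_all add: set_integral_diff)
      then show ?case by linarith
    qed
    ultimately have "\<bar>?I S - ?I S'\<bar> \<le> 0 + 0"
      by (rule tendsto_lowerbound) simp
    then show "?I S = ?I S'" by simp
  qed (use gr kernel_integrable[OF ker(1)] kernel_integrable[OF ker(2)] in \<open>auto simp: graphon_def\<close>)
qed

lemma regular_version:
  assumes "graphon M W"
  obtains W' where "regular_graphon W'" "AE z in M \<Otimes>\<^sub>M M. W' z = W z"
proof -
  \<comment> \<open>Averaging with the transpose makes the function symmetric everywhere, and
    truncation gives the range; both change \<open>W\<close> only on a null set.\<close>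
  define W' where "W' z = max 0 (min 1 ((W z + W (snd z, fst z)) / 2))" for z
  have [measurable]: "W \<in> borel_measurable (M \<Otimes>\<^sub>M M)"
    using assms by (auto simp: graphon_def kernel_def)
  have "W' \<in> borel_measurable (M \<Otimes>\<^sub>M M)"
    unfolding W'_def[abs_def] by measurable
  then have "regular_graphon W'"
    by (auto simp: regular_graphon_def W'_def add.commute)
  moreover have "AE (x, y) in M \<Otimes>\<^sub>M M. W (x, y) = W (y, x)" "AE z in M \<Otimes>\<^sub>M M. 0 \<le> W z \<and> W z \<le> 1"
    using assms by (auto simp: graphon_def kernel_def)
  then have "AE z in M \<Otimes>\<^sub>M M. W' z = W z"
    by eventually_elim (auto simp: W'_def split_def)
  ultimately show ?thesis ..
qed

text \<open>\<open>W\<close> is a regular version of \<open>W0\<close> supported in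
  \<open>D\<close>. By uniqueness, the limit \<open>S\<close> of its flow is the destination of
  every trajectory from \<open>W0\<close>; the claims about destinations of a given graphon all
  start from here.\<close>

lemma trajectory_and_destination:
  assumes "sym D" "trans D" "supported_graphon D W" and W: "AE z in M \<Otimes>\<^sub>M M. W z = W0 z"
  obtains \<Psi> S where "trajectory k M (component_completion_rule k) W0 \<Psi>"
    and "supported_graphon D S" "\<And>z. z \<in> space (M \<Otimes>\<^sub>M M) \<Longrightarrow> W z \<le> S z"
    and "\<And>z. z \<in> space (M \<Otimes>\<^sub>M M) \<Longrightarrow> vel k S z = 0"
    and "\<And>\<Phi>. trajectory k M (component_completion_rule k) W0 \<Phi> \<Longrightarrow> converges_to M \<Phi> S"
proof -
  interpret P: pair_prob_space M M by (rule pair_prob_space_self)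
  obtain \<Psi> where \<Psi>: "regular_flow k D \<Psi>" "\<Psi> 0 = W"
    using regular_flow_exists[OF assms(1-3)] .
  obtain S where S: "supported_graphon D S"
    "\<And>z. z \<in> space (M \<Otimes>\<^sub>M M) \<Longrightarrow> ((\<lambda>t. \<Psi> t z) \<longlongrightarrow> S z) at_top"
    "\<And>z. z \<in> space (M \<Otimes>\<^sub>M M) \<Longrightarrow> \<Psi> 0 z \<le> S z"
    "\<And>z. z \<in> space (M \<Otimes>\<^sub>M M) \<Longrightarrow> vel k S z = 0"
    using regular_flow_limit[OF \<Psi>(1)] by blast
  have sup: "supported_graphon D (\<Psi> t)" if "0 \<le> t" for t
    using \<Psi>(1) that unfolding regular_flow_def by blast
  have traj: "trajectory k M (component_completion_rule k) W0 \<Psi>"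
    using \<Psi> W by (intro regular_flow_trajectory) auto
  have grS: "graphon M S"
    using S(1) by (intro regular_graphon_graphon) (auto simp: supported_graphon_def)
  \<comment> \<open>The time is cut off at 0 since nothing is known about \<open>\<Psi>\<close> at
    negative times.\<close>
  have "((\<lambda>t. LINT z|(M \<Otimes>\<^sub>M M). \<bar>\<Psi> (max 0 t) z - S z\<bar>) \<longlongrightarrow> (LINT z|(M \<Otimes>\<^sub>M M). 0)) at_top"
  proof (rule integral_dominated_convergence_at_top[where w = "\<lambda>_. 1"])
    show "(\<lambda>z. \<bar>\<Psi> (max 0 t) z - S z\<bar>) \<in> borel_measurable (M \<Otimes>\<^sub>M M)" for t
      using supported_graphonD(2)[OF sup, of "max 0 t"] supported_graphonD(2)[OF S(1)] by measurable
    show "AE z in M \<Otimes>\<^sub>M M. ((\<lambda>t. \<bar>\<Psi> (max 0 t) z - S z\<bar>) \<longlongrightarrow> 0) at_top"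
    proof (rule AE_I2)
      fix z assume z: "z \<in> space (M \<Otimes>\<^sub>M M)"
      have "\<forall>\<^sub>F t in at_top. \<Psi> t z = \<Psi> (max 0 t) z"
        using eventually_ge_at_top[of "0::real"] by eventually_elim simp
      then have "((\<lambda>t. \<Psi> (max 0 t) z) \<longlongrightarrow> S z) at_top"
        using S(2)[OF z] by (rule Lim_transform_eventually[rotated])
      from tendsto_rabs[OF tendsto_diff[OF this tendsto_const[of "S z"]]]
      show "((\<lambda>t. \<bar>\<Psi> (max 0 t) z - S z\<bar>) \<longlongrightarrow> 0) at_top" by simp
    qed
    show "\<forall>\<^sub>F t in at_top. AE z in M \<Otimes>\<^sub>M M. norm \<bar>\<Psi> (max 0 t) z - S z\<bar> \<le> 1"
    proof (rule always_eventually, rule allI, rule AE_I2)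
      fix t :: real and z assume z: "z \<in> space (M \<Otimes>\<^sub>M M)"
      show "norm \<bar>\<Psi> (max 0 t) z - S z\<bar> \<le> 1"
        using supported_graphonD(3,4)[OF sup z, of "max 0 t"] supported_graphonD(3,4)[OF S(1) z] by simp
    qed
  qed auto
  then have L1: "((\<lambda>t. LINT z|(M \<Otimes>\<^sub>M M). \<bar>\<Psi> (max 0 t) z - S z\<bar>) \<longlongrightarrow> 0) at_top"
    by simp
  have conv: "converges_to M \<Phi> S" if \<Phi>: "trajectory k M (component_completion_rule k) W0 \<Phi>" for \<Phi>
  proof -
    have ker: "kernel M (\<Phi> t)" if "0 \<le> t" for t
      using \<Phi> that by (auto simp: trajectory_def)
    have kerS: "kernel M S"
      using grS by (simp add: graphon_def)
    have "((\<lambda>t. cut_dist M (\<Phi> t) S) \<longlongrightarrow> 0) at_top"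
    proof (rule tendsto_sandwich[OF _ _ tendsto_const L1])
      show "\<forall>\<^sub>F t in at_top. 0 \<le> cut_dist M (\<Phi> t) S"
        using eventually_ge_at_top[of "0::real"] by eventually_elim (intro cut_dist_nonneg ker kerS)
      show "\<forall>\<^sub>F t in at_top. cut_dist M (\<Phi> t) S \<le> (LINT z|(M \<Otimes>\<^sub>M M). \<bar>\<Psi> (max 0 t) z - S z\<bar>)"
        using eventually_ge_at_top[of "0::real"]
      proof eventually_elim
        case (elim t)
        have "AE z in M \<Otimes>\<^sub>M M. \<Phi> t z = \<Psi> t z"
        proof (rule trajectory_unique[OF \<Phi> traj _ elim], rule AE_I2)
          fix t z assume "0 \<le> (t::real)" "z \<in> space (M \<Otimes>\<^sub>M M)"
          then show "\<bar>\<Psi> t z\<bar> \<le> 1"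
            using supported_graphonD(3,4)[OF sup, of t z] by simp
        qed
        then have "AE z in M \<Otimes>\<^sub>M M. \<bar>\<Phi> t z - S z\<bar> = \<bar>\<Psi> (max 0 t) z - S z\<bar>"
          by eventually_elim (use elim in simp)
        moreover have "\<Phi> t \<in> borel_measurable (M \<Otimes>\<^sub>M M)" "S \<in> borel_measurable (M \<Otimes>\<^sub>M M)"
          "\<Psi> (max 0 t) \<in> borel_measurable (M \<Otimes>\<^sub>M M)"
          using ker[OF elim] kerS supported_graphonD(2)[OF sup, of "max 0 t"] by (auto simp: kernel_def)
        ultimately have "(LINT z|(M \<Otimes>\<^sub>M M). \<bar>\<Phi> t z - S z\<bar>) = (LINT z|(M \<Otimes>\<^sub>M M). \<bar>\<Psi> (max 0 t) z - S z\<bar>)"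
          by (intro integral_cong_AE) auto
        then show ?case
          using cut_dist_le[OF ker[OF elim] kerS] by simp
      qed
    qed
    with grS show ?thesis by (simp add: converges_to_def)
  qed
  show ?thesis
    by (rule that[OF traj S(1) _ S(4) conv]) (use S(3) \<Psi>(2) in auto)
qed

end

section \<open>Stationary graphons\<close>

lemma doubleton_eq_ordered:
  fixes i j i' j' :: nat
  shows "i < j \<Longrightarrow> i' < j' \<Longrightarrow> {i, j} = {i', j'} \<longleftrightarrow> i = i' \<and> j = j'"
  by (auto simp: doubleton_eq_iff)

context prob_space
begin

text \<open>The velocity is a sum of nonnegative densities, so each of them vanishes, and a
  nonnegative weight with integral 0 vanishes almost everywhere on its fibre; the fibres are then
  put together.\<close>

lemma ind_weight_eq_0_of_velocity:
  assumes S: "regular_graphon S" and vel: "\<And>z. z \<in> space (M \<Otimes>\<^sub>M M) \<Longrightarrow> vel k S z = 0"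
    and p: "(F, a, b) \<in> completed_pairs k"
  shows "AE v in PiM {1..k} (\<lambda>_. M). ind_weight k F S v = 0"
proof -
  have ab: "a \<in> {1..k}" "b \<in> {1..k}" "a \<noteq> b"
    using p by (auto simp: completed_pairs_def)
  have [measurable]: "ind_weight k F S \<in> borel_measurable (PiM {1..k} (\<lambda>_. M))"
    using S by (intro borel_measurable_ind_weight) (auto simp: regular_graphon_def)
  have "AE u in PiM ({1..k} - {a, b}) (\<lambda>_. M). ind_weight k F S (u(a := x, b := y)) = 0"
    if xy: "x \<in> space M" "y \<in> space M" for x y
  proof -
    have "(\<Sum>(F, a, b)\<in>completed_pairs k. t_ind k M F a b S x y) = 0"
      using vel[of "(x, y)"] xy by (simp add: velocity_component_completion space_pair_measure)
    moreover have "\<And>p. p \<in> completed_pairs k \<Longrightarrow> 0 \<le> (case p of (F, a, b) \<Rightarrow> t_ind k M F a b S x y)"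
      using t_ind_bounds(1)[OF S xy] by auto
    ultimately have "t_ind k M F a b S x y = 0"
      using p by (subst (asm) sum_nonneg_eq_0_iff) auto
    then show ?thesis
      unfolding t_ind_eq using ind_weight_fiber[OF S xy p]
      by (subst (asm) integral_nonneg_eq_0_iff_AE) (auto intro: AE_I2)
  qed
  then have "AE z in M \<Otimes>\<^sub>M M. AE u in PiM ({1..k} - {a, b}) (\<lambda>_. M). ind_weight k F S (u(a := fst z, b := snd z)) = 0"
    by (rule_tac AE_I2) (auto simp: space_pair_measure)
  moreover have "Measurable.pred (PiM {1..k} (\<lambda>_. M)) (\<lambda>v. ind_weight k F S v = 0)"
    by measurable
  ultimately show ?thesis
    using AE_PiM_split2[OF finite_atLeastAtMost ab] by blast
qed

text \<open>If the conclusion fails, the graph of all pairs of positive weight except \<open>{1, 3}\<close> is sampled with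
  positive probability, although its completion adds \<open>{1, 3}\<close>.\<close>

lemma AE_transitive_sample:
  assumes S: "regular_graphon S" and vel: "\<And>z. z \<in> space (M \<Otimes>\<^sub>M M) \<Longrightarrow> vel k S z = 0"
    and k: "3 \<le> k"
  shows "AE v in PiM {1..k} (\<lambda>_. M). S (v 1, v 2) > 0 \<and> S (v 2, v 3) > 0 \<longrightarrow> S (v 1, v 3) = 1"
proof -
  let ?G = "{F \<in> graphs k. {1, 2} \<in> F \<and> {2, 3} \<in> F \<and> {1, 3} \<notin> F}"
  have "(F, 1, 3) \<in> completed_pairs k" if F: "F \<in> ?G" for F
  proof -
    have "(1, 2) \<in> {(p, q). {p, q} \<in> F}" "(2, 3) \<in> {(p, q). {p, q} \<in> F}"
      using F by auto
    then have "(1, 3) \<in> {(p, q). {p, q} \<in> F}\<^sup>*"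
      by (meson r_into_rtrancl rtrancl_trans)
    then have "{1, 3} \<in> component_completion k F"
      unfolding component_completion_def using k by (intro CollectI exI[of _ 1] exI[of _ 3]) auto
    then show ?thesis
      using F k by (auto simp: completed_pairs_def)
  qed
  then have "AE v in PiM {1..k} (\<lambda>_. M). \<forall>F\<in>?G. ind_weight k F S v = 0"
    by (intro AE_finite_allI ind_weight_eq_0_of_velocity[OF S vel]) auto
  then show ?thesis
    using AE_space
  proof eventually_elim
    case (elim v)
    show ?case
    proof (rule ccontr)
      assume "\<not> ?case"
      then have pos: "S (v 1, v 2) > 0" "S (v 2, v 3) > 0" and ne: "S (v 1, v 3) \<noteq> 1"
        by auto
      define F where "F = {{i, j} | i j. (i, j) \<in> vertex_pairs k \<and> S (v i, v j) > 0} - {{1, 3}}"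
      have iff: "{i, j} \<in> F \<longleftrightarrow> S (v i, v j) > 0 \<and> (i, j) \<noteq> (1, 3)" if "(i, j) \<in> vertex_pairs k" for i j
      proof -
        have "{i, j} \<in> {{i, j} | i j. (i, j) \<in> vertex_pairs k \<and> S (v i, v j) > 0} \<longleftrightarrow> S (v i, v j) > 0"
          using that doubleton_eq_ordered[of i j] by (auto simp: vertex_pairs_def)
        moreover have "{i, j} = {1, 3} \<longleftrightarrow> (i, j) = (1, 3)"
          using that doubleton_eq_ordered[of i j 1 3] by (auto simp: vertex_pairs_def)
        ultimately show ?thesis
          by (simp add: F_def)
      qed
      have "F \<in> graphs k"
        by (auto simp: F_def graphs_def vertex_pairs_def)
      moreover have "{1, 2} \<in> F" "{2, 3} \<in> F"
        using iff[of 1 2] iff[of 2 3] pos k by (auto simp: vertex_pairs_def)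
      moreover have "{1, 3} \<notin> F"
        by (simp add: F_def)
      ultimately have "ind_weight k F S v = 0"
        using elim(1) by blast
      \<comment> \<open>No factor can vanish: edges of \<open>F\<close> have \<open>S > 0\<close>,
        non-edges other than \<open>{1, 3}\<close> have \<open>S = 0\<close>, and
        \<open>{1, 3}\<close> has \<open>S \<noteq> 1\<close>.\<close>
      then obtain i j where ij: "(i, j) \<in> vertex_pairs k" "(if {i, j} \<in> F then S (v i, v j) else 1 - S (v i, v j)) = 0"
        unfolding ind_weight_def by (auto simp: prod_zero_iff)
      have "v i \<in> space M" "v j \<in> space M"
        using elim(2) ij(1) by (auto simp: space_PiM vertex_pairs_def PiE_iff)
      then have "(v i, v j) \<in> space (M \<Otimes>\<^sub>M M)"
        by (simp add: space_pair_measure)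
      then have "0 \<le> S (v i, v j)"
        using S by (auto simp: regular_graphon_def)
      then show False
        using ij ne iff[OF ij(1)] by (auto split: if_splits)
    qed
  qed
qed

text \<open>Two coordinates are split off, and the third is the image of the fibre measure under a
  projection with law \<open>M\<close>. The order of \<open>a\<close>, \<open>b\<close>,
  \<open>c\<close> decides which variable is outermost.\<close>

lemma AE_PiM_triple:
  assumes "finite I" "a \<in> I" "b \<in> I" "c \<in> I" "a \<noteq> b" "a \<noteq> c" "b \<noteq> c"
    and meas: "Measurable.pred (M \<Otimes>\<^sub>M M \<Otimes>\<^sub>M M) (\<lambda>p. Q (fst p) (fst (snd p)) (snd (snd p)))"
    and AE: "AE v in PiM I (\<lambda>_. M). Q (v a) (v b) (v c)"
  shows "AE x in M. AE y in M. AE z in M. Q x y z"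
proof -
  interpret P: pair_prob_space M M by (rule pair_prob_space_self)
  have [measurable]: "Measurable.pred (PiM I (\<lambda>_. M)) (\<lambda>v. Q (v a) (v b) (v c))"
  proof -
    have "(\<lambda>v. (v a, v b, v c)) \<in> PiM I (\<lambda>_. M) \<rightarrow>\<^sub>M M \<Otimes>\<^sub>M M \<Otimes>\<^sub>M M"
      using assms(2-4) by measurable
    from measurable_compose[OF this meas] show ?thesis by simp
  qed
  have fiber: "AE z in M \<Otimes>\<^sub>M M. AE u in PiM (I - {a, b}) (\<lambda>_. M). Q (fst z) (snd z) (u c)"
    using AE assms by (subst (asm) AE_PiM_split2[of I a b]) auto
  have "AE z in M \<Otimes>\<^sub>M M. AE w in M. Q (fst z) (snd z) w"
  proof (rule AE_mp[OF fiber], rule AE_I2, rule impI)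
    fix z assume z: "z \<in> space (M \<Otimes>\<^sub>M M)"
      and AE: "AE u in PiM (I - {a, b}) (\<lambda>_. M). Q (fst z) (snd z) (u c)"
    have "(\<lambda>w. (fst z, snd z, w)) \<in> M \<rightarrow>\<^sub>M M \<Otimes>\<^sub>M M \<Otimes>\<^sub>M M"
      using z by (auto simp: space_pair_measure)
    from measurable_compose[OF this meas]
    have [measurable]: "Measurable.pred M (Q (fst z) (snd z))" by simp
    have "c \<in> I - {a, b}" using assms by auto
    then have eq: "distr (PiM (I - {a, b}) (\<lambda>_. M)) M (\<lambda>u. u c) = M"
      by (intro distr_PiM_component) unfold_locales
    have "AE w in distr (PiM (I - {a, b}) (\<lambda>_. M)) M (\<lambda>u. u c). Q (fst z) (snd z) w"
      using AE \<open>c \<in> I - {a, b}\<close> by (subst AE_distr_iff) auto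
    then show "AE w in M. Q (fst z) (snd z) w"
      by (simp only: eq)
  qed
  from P.AE_pair[OF this] show ?thesis
    by simp
qed

text \<open>Up to null sets, a clique without edges to the outside: a block of a component complete
  graphon.\<close>

definition complete_part :: "('a \<times> 'a \<Rightarrow> real) \<Rightarrow> 'a set \<Rightarrow> bool" where
  "complete_part S A \<longleftrightarrow> A \<in> sets M \<and> 0 < measure M A \<and>
     (AE z in M \<Otimes>\<^sub>M M. z \<in> A \<times> A \<longrightarrow> S z = 1) \<and>
     (AE z in M \<Otimes>\<^sub>M M. z \<in> (space M - A) \<times> A \<longrightarrow> S z = 0)"

definition nbhd :: "('a \<times> 'a \<Rightarrow> real) \<Rightarrow> 'a \<Rightarrow> 'a set" where
  "nbhd S y = {x \<in> space M. S (y, x) > 0}"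

lemma nbhd_sets:
  assumes "regular_graphon S" "y \<in> space M"
  shows "nbhd S y \<in> sets M"
proof -
  have [measurable]: "S \<in> borel_measurable (M \<Otimes>\<^sub>M M)" using assms by (auto simp: regular_graphon_def)
  have [measurable]: "(\<lambda>x. S (y, x)) \<in> borel_measurable M"
    using assms(2) by measurable
  show ?thesis unfolding nbhd_def by measurable
qed

text \<open>Transitivity of a random triple is used twice. With \<open>y\<close> in the middle, it
  joins any two neighbours of \<open>y\<close>; with \<open>y\<close> at an end, a point joined to a
  neighbour of \<open>y\<close> is itself a neighbour of \<open>y\<close>.\<close>

lemma AE_nbhd_complete:
  assumes S: "regular_graphon S" and vel: "\<And>z. z \<in> space (M \<Otimes>\<^sub>M M) \<Longrightarrow> vel k S z = 0"
    and k: "3 \<le> k"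
  shows "AE y in M. 0 < measure M (nbhd S y) \<longrightarrow> complete_part S (nbhd S y)"
proof -
  interpret P: pair_prob_space M M by (rule pair_prob_space_self)
  have [measurable]: "S \<in> borel_measurable (M \<Otimes>\<^sub>M M)" using S by (auto simp: regular_graphon_def)
  have sym: "S (x, y) = S (y, x)" if "x \<in> space M" "y \<in> space M" for x y
    using S that by (auto simp: regular_graphon_def)
  have nonneg: "0 \<le> S (x, y)" if "x \<in> space M" "y \<in> space M" for x y
    using S that by (auto simp: regular_graphon_def space_pair_measure)
  note T = AE_transitive_sample[OF S vel k]
  have T1: "AE y in M. AE x in M. AE z in M. S (x, y) > 0 \<and> S (y, z) > 0 \<longrightarrow> S (x, z) = 1"
    by (rule AE_PiM_triple[of "{1..k}" 2 1 3]) (use T k in auto)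
  have T2: "AE y in M. AE x in M. AE z in M. S (y, z) > 0 \<and> S (z, x) > 0 \<longrightarrow> S (y, x) = 1"
    by (rule AE_PiM_triple[of "{1..k}" 1 3 2]) (use T k in auto)
  from T1 T2 AE_space show ?thesis
  proof eventually_elim
    case (elim y)
    let ?N = "nbhd S y"
    have N [measurable]: "?N \<in> sets M"
      using S elim(3) by (rule nbhd_sets)
    have "AE z in M \<Otimes>\<^sub>M M. z \<in> ?N \<times> ?N \<longrightarrow> S z = 1"
    proof (rule P.AE_pair_measure)
      show "AE x in M. AE z in M. (x, z) \<in> ?N \<times> ?N \<longrightarrow> S (x, z) = 1"
        using elim(1) by eventually_elim (auto simp: nbhd_def sym[OF _ elim(3)])
    qed measurable
    moreover have "AE z in M \<Otimes>\<^sub>M M. z \<in> (space M - ?N) \<times> ?N \<longrightarrow> S z = 0"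
    proof (rule P.AE_pair_measure)
      show "AE x in M. AE z in M. (x, z) \<in> (space M - ?N) \<times> ?N \<longrightarrow> S (x, z) = 0"
        using elim(2) AE_space
      proof eventually_elim
        case (elim x)
        from elim(1) AE_space show ?case
        proof eventually_elim
          case (elim z)
          then show ?case
            using sym[of x z] nonneg[of x z] \<open>x \<in> space M\<close> by (fastforce simp: nbhd_def)
        qed
      qed
    qed measurable
    ultimately show ?case
      using N by (simp add: complete_part_def)
  qed
qed

lemma AE_fst: "AE x in M. Q x \<Longrightarrow> AE z in M \<Otimes>\<^sub>M M. Q (fst z)"
  and AE_snd: "AE x in M. Q x \<Longrightarrow> AE z in M \<Otimes>\<^sub>M M. Q (snd z)"
proof -
  interpret P: pair_prob_space M M by (rule pair_prob_space_self)
  assume "AE x in M. Q x"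
  then obtain N where N: "N \<in> null_sets M" "{x \<in> space M. \<not> Q x} \<subseteq> N"
    by (auto simp: eventually_ae_filter)
  then have "N \<times> space M \<in> null_sets (M \<Otimes>\<^sub>M M)" "space M \<times> N \<in> null_sets (M \<Otimes>\<^sub>M M)"
    by (auto simp: null_sets_def emeasure_pair_measure_Times)
  moreover have "{z \<in> space (M \<Otimes>\<^sub>M M). \<not> Q (fst z)} \<subseteq> N \<times> space M"
    "{z \<in> space (M \<Otimes>\<^sub>M M). \<not> Q (snd z)} \<subseteq> space M \<times> N"
    using N by (auto simp: space_pair_measure)
  ultimately show "AE z in M \<Otimes>\<^sub>M M. Q (fst z)" "AE z in M \<Otimes>\<^sub>M M. Q (snd z)"
    by (auto intro: AE_I')
qed

lemma AE_not_in_Times: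
  assumes "A \<in> sets M" "B \<in> sets M" "AE z in M \<Otimes>\<^sub>M M. z \<notin> A \<times> B"
  shows "measure M A = 0 \<or> measure M B = 0"
proof -
  have "emeasure (M \<Otimes>\<^sub>M M) (A \<times> B) = 0"
    using assms by (subst (asm) AE_iff_measurable[of "A \<times> B"]) (auto dest: sets.sets_into_space simp: space_pair_measure)
  then show ?thesis
    using assms by (auto simp: emeasure_pair_measure_Times measure_def)
qed

lemma AE_not_in_measure_0: "N \<in> sets M \<Longrightarrow> measure M N = 0 \<Longrightarrow> AE x in M. x \<notin> N"
  by (intro AE_not_in) (auto simp: null_sets_def emeasure_eq_measure)

text \<open>On \<open>(A - B) \<times> (A \<inter> B)\<close> the value of \<open>S\<close> would be
  1, inside \<open>A\<close>, and 0, across the boundary of \<open>B\<close>.\<close>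

lemma complete_parts_overlap:
  assumes A: "complete_part S A" and B: "complete_part S B" and pos: "0 < measure M (A \<inter> B)"
  shows "measure M (A - B) = 0"
proof -
  have AB: "A \<in> sets M" "B \<in> sets M"
    using A B by (auto simp: complete_part_def)
  have "AE z in M \<Otimes>\<^sub>M M. z \<in> A \<times> A \<longrightarrow> S z = 1"
    "AE z in M \<Otimes>\<^sub>M M. z \<in> (space M - B) \<times> B \<longrightarrow> S z = 0"
    using A B by (simp_all add: complete_part_def)
  then have "AE z in M \<Otimes>\<^sub>M M. z \<notin> (A - B) \<times> (A \<inter> B)"
  proof eventually_elim
    case (elim z)
    then show ?case
      using sets.sets_into_space[OF AB(1)] by (cases z) auto
  qed
  from AE_not_in_Times[OF _ _ this] AB pos show ?thesis
    by auto
qed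

lemma complete_part_subset:
  assumes A: "complete_part S A" and B: "B \<in> sets M" "B \<subseteq> A" "measure M (A - B) = 0" "0 < measure M B"
  shows "complete_part S B"
proof -
  have A': "A \<in> sets M" "AE z in M \<Otimes>\<^sub>M M. z \<in> A \<times> A \<longrightarrow> S z = 1"
      "AE z in M \<Otimes>\<^sub>M M. z \<in> (space M - A) \<times> A \<longrightarrow> S z = 0"
    using A by (auto simp: complete_part_def)
  have "AE z in M \<Otimes>\<^sub>M M. fst z \<notin> A - B"
    using A' B by (intro AE_fst AE_not_in_measure_0) auto
  then have "AE z in M \<Otimes>\<^sub>M M. z \<in> (space M - B) \<times> B \<longrightarrow> S z = 0"
    using A'(3) by eventually_elim (use B(2) in auto)
  moreover have "AE z in M \<Otimes>\<^sub>M M. z \<in> B \<times> B \<longrightarrow> S z = 1"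
    using A'(2) by eventually_elim (use B(2) in auto)
  ultimately show ?thesis
    using B by (simp add: complete_part_def)
qed

text \<open>Distinct complete parts are disjoint up to null sets, so a set within a quarter of the measure of a
  complete part determines this part; hence a countable dense family lists all complete parts.\<close>

lemma complete_parts_enumeration:
  assumes "separable_sigma_algebra M"
  obtains A :: "nat \<Rightarrow> 'a set" where "\<And>n. A n = {} \<or> complete_part S (A n)"
    and "\<And>B. complete_part S B \<Longrightarrow> \<exists>n. 0 < measure M (A n \<inter> B)"
proof -
  let ?d = "\<lambda>A B. measure M ((A - B) \<union> (B - A))"
  obtain D where D: "countable D" "D \<subseteq> sets M" "\<And>A e. A \<in> sets M \<Longrightarrow> 0 < e \<Longrightarrow> \<exists>B\<in>D. ?d A B < e"
    using assms by (auto simp: separable_sigma_algebra_def)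
  then have "D \<noteq> {}"
    using D(3)[of "{}" 1] by auto
  let ?near = "\<lambda>C A. complete_part S A \<and> ?d A C < measure M A / 4"
  \<comment> \<open>Any nearby part is chosen; it need not be the part that led to \<open>C\<close>,
    but it will overlap it. The empty set is the default for sets \<open>C\<close> near no
    part.\<close>
  define f where "f C = (if \<exists>A. ?near C A then SOME A. ?near C A else {})" for C
  have f: "f C = {} \<or> complete_part S (f C)" for C
    using someI_ex[of "?near C"] by (auto simp: f_def)
  show ?thesis
  proof (rule that[of "\<lambda>n. f (from_nat_into D n)"])
    fix B assume B: "complete_part S B"
    then have Bs: "B \<in> sets M" "0 < measure M B"
      by (auto simp: complete_part_def)
    then obtain C where C: "C \<in> D" "?d B C < measure M B / 4"
      using D(3)[of B "measure M B / 4"] by auto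
    then have near: "?near C (f C)"
      using someI_ex[of "?near C"] B by (auto simp: f_def)
    then have As: "f C \<in> sets M" "0 < measure M (f C)"
      by (auto simp: complete_part_def)
    have Cs: "C \<in> sets M" using C D by auto
    \<comment> \<open>If the intersection were null, each of the two measures would be at most the
      sum of the distances to \<open>C\<close>, which is less than a quarter of their total; adding
      the two inequalities is contradictory.\<close>
    have overlap: "measure M X \<le> measure M (X \<inter> Y) + ?d Y C + ?d X C" if "X \<in> sets M" "Y \<in> sets M" for X Y
    proof -
      have "measure M X \<le> measure M ((X \<inter> Y) \<union> ((Y - C) \<union> (C - Y)) \<union> ((X - C) \<union> (C - X)))"
        using that Cs by (intro finite_measure_mono) auto
      also have "\<dots> \<le> measure M ((X \<inter> Y) \<union> ((Y - C) \<union> (C - Y))) + ?d X C"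
        using that Cs by (intro measure_Un_le) auto
      also have "measure M ((X \<inter> Y) \<union> ((Y - C) \<union> (C - Y))) \<le> measure M (X \<inter> Y) + ?d Y C"
        using that Cs by (intro measure_Un_le) auto
      finally show ?thesis by simp
    qed
    have "0 < measure M (f C \<inter> B)"
    proof (rule ccontr)
      assume "\<not> ?thesis"
      then have "measure M (f C \<inter> B) = 0" "measure M (B \<inter> f C) = 0"
        by (auto simp: zero_less_measure_iff Int_commute)
      then show False
        using overlap[OF As(1) Bs(1)] overlap[OF Bs(1) As(1)] near C(2) As(2) Bs(2) by linarith
    qed
    then show "\<exists>n. 0 < measure M (f (from_nat_into D n) \<inter> B)"
      using from_nat_into_surj[OF D(1) C(1)] by metis
  qed (rule f)
qed

text \<open>The enumeration may repeat parts up to null sets. Removing the earlier sets from a part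
  leaves a null set if it overlapped one of them, and otherwise takes away only a null set;
  \<open>J\<close> keeps the indices with positive measure.\<close>

lemma complete_parts_partition:
  assumes "separable_sigma_algebra M"
  obtains A :: "nat \<Rightarrow> 'a set" and J where "disjoint_family A" "\<And>n. n \<in> J \<Longrightarrow> complete_part S (A n)"
    and "\<And>B. complete_part S B \<Longrightarrow> \<exists>n\<in>J. measure M (B - A n) = 0"
proof -
  obtain A where A: "\<And>n::nat. A n = {} \<or> complete_part S (A n)"
    and cover: "\<And>B. complete_part S B \<Longrightarrow> \<exists>n. 0 < measure M (A n \<inter> B)"
    using complete_parts_enumeration[OF assms] by blast
  have sets [measurable]: "A n \<in> sets M" for n
    using A[of n] by (auto simp: complete_part_def)
  define J where "J = {n. 0 < measure M (disjointed A n)}"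
  have dis_sets [measurable]: "disjointed A n \<in> sets M" for n
    using sets.range_disjointed_sets[of A M] sets by (auto simp: image_subset_iff)
  have complete: "complete_part S (disjointed A n)" if n: "n \<in> J" for n
  proof -
    have "disjointed A n \<subseteq> A n" by (rule disjointed_subset)
    then have "A n \<noteq> {}"
      using n by (auto simp: J_def)
    then have An: "complete_part S (A n)"
      using A by auto
    have null: "measure M (A n \<inter> A m) = 0" if "m < n" for m
    proof (rule ccontr)
      assume *: "measure M (A n \<inter> A m) \<noteq> 0"
      then have "A m \<noteq> {}" by auto
      then have "measure M (A n - A m) = 0"
        using A[of m] An * by (intro complete_parts_overlap) (auto simp: zero_less_measure_iff)
      moreover have "measure M (disjointed A n) \<le> measure M (A n - A m)"
        using that by (intro finite_measure_mono) (auto simp: disjointed_def)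
      ultimately show False
        using n by (simp add: J_def)
    qed
    have "A n - disjointed A n = (\<Union>m\<in>{0..<n}. A n \<inter> A m)"
      by (auto simp: disjointed_def)
    moreover have "measure M (\<Union>m\<in>{0..<n}. A n \<inter> A m) \<le> (\<Sum>m\<in>{0..<n}. measure M (A n \<inter> A m))"
      by (intro measure_UNION_le) auto
    ultimately have "measure M (A n - disjointed A n) \<le> 0"
      using null by simp
    then show ?thesis
      using n by (intro complete_part_subset[OF An]) (auto simp: J_def disjointed_subset measure_le_0_iff)
  qed
  have covered: "\<exists>n\<in>J. measure M (B - disjointed A n) = 0" if B: "complete_part S B" for B
  proof -
    have Bs [measurable]: "B \<in> sets M" using B by (simp add: complete_part_def)
    obtain m where m: "0 < measure M (A m \<inter> B)"
      using cover[OF B] by blast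
    have "\<exists>n. 0 < measure M (disjointed A n \<inter> B)"
    proof (rule ccontr)
      assume "\<not> ?thesis"
      then have "measure M (disjointed A n \<inter> B) = 0" for n
        by (simp add: zero_less_measure_iff)
      then have "emeasure M (\<Union>n. disjointed A n \<inter> B) = 0"
        by (intro emeasure_UN_eq_0) (auto simp: emeasure_eq_measure)
      then have "measure M (\<Union>n. disjointed A n \<inter> B) = 0"
        by (simp add: measure_def)
      moreover have "A m \<inter> B \<subseteq> (\<Union>n. disjointed A n \<inter> B)"
        using UN_disjointed_eq[of A] by auto
      then have "measure M (A m \<inter> B) \<le> measure M (\<Union>n. disjointed A n \<inter> B)"
        by (intro finite_measure_mono) auto
      ultimately show False
        using m by simp
    qed
    then obtain n where n: "0 < measure M (disjointed A n \<inter> B)" by blast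
    also have "\<dots> \<le> measure M (disjointed A n)"
      by (intro finite_measure_mono) auto
    finally have "n \<in> J" by (simp add: J_def)
    moreover have "measure M (B - disjointed A n) = 0"
      using n by (intro complete_parts_overlap[OF B complete[OF \<open>n \<in> J\<close>]]) (simp add: Int_commute)
    ultimately show ?thesis by blast
  qed
  show ?thesis
    by (rule that[OF disjoint_family_disjointed complete covered])
qed

end

section \<open>Component decompositions\<close>

context prob_space
begin

section \<open>The normalized measure on a part\<close>

context
  fixes A :: "'a set"
  assumes A: "A \<in> sets M" "0 < measure M A"
begin

lemma space_normalized_restriction: "space (normalized_restriction M A) = A"
  using sets.sets_into_space[OF A(1)]
  by (auto simp: normalized_restriction_def space_scale_measure space_restrict_space)

lemma sets_normalized_restriction: "B \<in> sets (normalized_restriction M A) \<longleftrightarrow> B \<in> sets M \<and> B \<subseteq> A"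
  using A sets.sets_into_space[OF A(1)] by (auto simp: normalized_restriction_def sets_restrict_space_iff)

lemma emeasure_normalized_restriction:
  assumes "B \<in> sets M" "B \<subseteq> A"
  shows "emeasure (normalized_restriction M A) B = ennreal (measure M B / measure M A)"
proof -
  have "emeasure (normalized_restriction M A) B = inverse (emeasure M A) * emeasure M B"
    using assms A by (simp add: normalized_restriction_def emeasure_restrict_space)
  also have "\<dots> = ennreal (inverse (measure M A) * measure M B)"
    using A by (simp add: emeasure_eq_measure inverse_ennreal ennreal_mult[symmetric])
  finally show ?thesis
    by (simp add: field_simps)
qed

lemma prob_space_normalized_restriction: "prob_space (normalized_restriction M A)"
  using A by (intro prob_spaceI) (simp add: space_normalized_restriction emeasure_normalized_restriction)

lemma AE_normalized_restriction:
  "(AE x in normalized_restriction M A. Q x) \<longleftrightarrow> (AE x in M. x \<in> A \<longrightarrow> Q x)"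
proof -
  have "inverse (emeasure M A) \<noteq> 0"
    by (simp add: emeasure_eq_measure)
  then have "null_sets (normalized_restriction M A) = null_sets (restrict_space M A)"
    by (auto simp: null_sets_def normalized_restriction_def)
  then have "(AE x in normalized_restriction M A. Q x) \<longleftrightarrow> (AE x in restrict_space M A. Q x)"
    by (simp add: eventually_ae_filter normalized_restriction_def space_scale_measure)
  also have "\<dots> \<longleftrightarrow> (AE x in M. x \<in> A \<longrightarrow> Q x)"
    using A by (intro AE_restrict_space_iff) auto
  finally show ?thesis .
qed

lemma measurable_normalized_restriction_pair:
  "f \<in> M \<Otimes>\<^sub>M M \<rightarrow>\<^sub>M N \<Longrightarrow> f \<in> normalized_restriction M A \<Otimes>\<^sub>M normalized_restriction M A \<rightarrow>\<^sub>M N"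
proof -
  have id: "(\<lambda>x. x) \<in> normalized_restriction M A \<rightarrow>\<^sub>M M"
    using sets.sets_into_space[OF A(1)]
    by (intro measurableI)
      (auto simp: space_normalized_restriction sets_normalized_restriction A(1))
  have "(\<lambda>z. (fst z, snd z)) \<in> normalized_restriction M A \<Otimes>\<^sub>M normalized_restriction M A \<rightarrow>\<^sub>M M \<Otimes>\<^sub>M M"
    by (intro measurable_Pair measurable_compose[OF measurable_fst id] measurable_compose[OF measurable_snd id])
  then show "f \<in> M \<Otimes>\<^sub>M M \<rightarrow>\<^sub>M N \<Longrightarrow> f \<in> normalized_restriction M A \<Otimes>\<^sub>M normalized_restriction M A \<rightarrow>\<^sub>M N"
    using measurable_compose by fastforce
qed

text \<open>Through iterated statements in one variable, where scaling by a nonzero constant does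
  not change the null sets.\<close>

lemma AE_normalized_restriction_pair:
  assumes Q [measurable]: "Measurable.pred (M \<Otimes>\<^sub>M M) Q"
  shows "(AE z in normalized_restriction M A \<Otimes>\<^sub>M normalized_restriction M A. Q z) \<longleftrightarrow>
    (AE z in M \<Otimes>\<^sub>M M. z \<in> A \<times> A \<longrightarrow> Q z)"
proof -
  interpret P: pair_prob_space M M by (rule pair_prob_space_self)
  interpret R: prob_space "normalized_restriction M A" by (rule prob_space_normalized_restriction)
  interpret RP: pair_prob_space "normalized_restriction M A" "normalized_restriction M A"
    by (rule R.pair_prob_space_self)
  let ?N = "normalized_restriction M A"
  note [measurable] = A(1)
  have "Measurable.pred (?N \<Otimes>\<^sub>M ?N) Q"
    by (rule measurable_normalized_restriction_pair[OF Q])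
  then have "(AE z in ?N \<Otimes>\<^sub>M ?N. Q z) \<longleftrightarrow> (AE x in ?N. AE y in ?N. Q (x, y))"
    using RP.AE_pair_iff[of "\<lambda>x y. Q (x, y)"] by (simp add: pred_def)
  also have "\<dots> \<longleftrightarrow> (AE x in M. AE y in M. (x, y) \<in> A \<times> A \<longrightarrow> Q (x, y))"
    unfolding AE_normalized_restriction by (intro AE_cong) auto
  also have "\<dots> \<longleftrightarrow> (AE z in M \<Otimes>\<^sub>M M. z \<in> A \<times> A \<longrightarrow> Q z)"
  proof -
    have "Measurable.pred (M \<Otimes>\<^sub>M M) (\<lambda>z. z \<in> A \<times> A \<longrightarrow> Q z)"
      by measurable
    then show ?thesis
      using P.AE_pair_iff[of "\<lambda>x y. (x, y) \<in> A \<times> A \<longrightarrow> Q (x, y)"] by (simp add: pred_def)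
  qed
  finally show ?thesis .
qed

lemma graphon_normalized_restriction:
  assumes "graphon M S"
  shows "graphon (normalized_restriction M A) S"
proof -
  have [measurable]: "S \<in> borel_measurable (M \<Otimes>\<^sub>M M)"
    using assms by (auto simp: graphon_def kernel_def)
  have restrict: "AE z in normalized_restriction M A \<Otimes>\<^sub>M normalized_restriction M A. Q z"
    if "AE z in M \<Otimes>\<^sub>M M. Q z" "Measurable.pred (M \<Otimes>\<^sub>M M) Q" for Q
    unfolding AE_normalized_restriction_pair[OF that(2)] using that(1) by eventually_elim simp
  obtain C where "AE z in M \<Otimes>\<^sub>M M. \<bar>S z\<bar> \<le> C" "AE (x, y) in M \<Otimes>\<^sub>M M. S (x, y) = S (y, x)"
    "AE z in M \<Otimes>\<^sub>M M. 0 \<le> S z \<and> S z \<le> 1"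
    using assms by (auto simp: graphon_def kernel_def)
  from this[THEN restrict] show ?thesis
    unfolding graphon_def kernel_def
    by (intro conjI exI[of _ C] measurable_normalized_restriction_pair) measurable
qed

text \<open>Either form of disconnectedness yields a rectangle \<open>B \<times> C\<close> inside
  \<open>A \<times> A\<close>, with sides of positive measure, on which \<open>S\<close>
  vanishes.\<close>

lemma complete_not_disconnected:
  assumes [measurable]: "S \<in> borel_measurable (M \<Otimes>\<^sub>M M)" and one: "AE z in M \<Otimes>\<^sub>M M. z \<in> A \<times> A \<longrightarrow> S z = 1"
  shows "\<not> disconnected (normalized_restriction M A) S"
proof
  note [measurable] = A(1)
  assume "disconnected (normalized_restriction M A) S"
  then obtain B C where BC: "B \<in> sets M" "C \<in> sets M" "B \<subseteq> A" "C \<subseteq> A" "measure M B > 0" "measure M C > 0"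
    and zero: "AE z in normalized_restriction M A \<Otimes>\<^sub>M normalized_restriction M A. z \<in> B \<times> C \<longrightarrow> S z = 0"
    unfolding disconnected_def
  proof (elim disjE bexE conjE)
    assume "AE z in normalized_restriction M A \<Otimes>\<^sub>M normalized_restriction M A. S z = 0"
    then show ?thesis
      by (intro that[of A A]) (use A in \<open>auto elim!: eventually_mono\<close>)
  next
    fix B assume B: "B \<in> sets (normalized_restriction M A)"
      "0 < measure (normalized_restriction M A) B" "measure (normalized_restriction M A) B < 1"
      "AE z in normalized_restriction M A \<Otimes>\<^sub>M normalized_restriction M A.
        z \<in> B \<times> (space (normalized_restriction M A) - B) \<longrightarrow> S z = 0"
    have B': "B \<in> sets M" "B \<subseteq> A"
      using B(1) by (auto simp: sets_normalized_restriction)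
    have eq: "measure (normalized_restriction M A) B = measure M B / measure M A"
      using emeasure_normalized_restriction[OF B'] A(2) by (simp add: measure_def[of "normalized_restriction M A"])
    have "0 < measure M B" "measure M B < measure M A"
      using B(2,3) A(2) unfolding eq by (simp_all add: zero_less_divide_iff divide_less_eq)
    then show ?thesis
      using B(4) B' A by (intro that[of B "A - B"]) (auto simp: space_normalized_restriction finite_measure_Diff)
  qed
  note [measurable] = BC(1,2)
  have "AE z in M \<Otimes>\<^sub>M M. z \<in> A \<times> A \<longrightarrow> z \<in> B \<times> C \<longrightarrow> S z = 0"
    using zero by (subst (asm) AE_normalized_restriction_pair) auto
  with one have "AE z in M \<Otimes>\<^sub>M M. z \<notin> B \<times> C"
    by eventually_elim (use BC in auto)
  from AE_not_in_Times[OF BC(1,2) this] BC(5,6) show False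
    by auto
qed

lemma connected_partD:
  assumes [measurable]: "W \<in> borel_measurable (M \<Otimes>\<^sub>M M)"
    and conn: "\<not> disconnected (normalized_restriction M A) W"
  shows "\<not> (AE z in M \<Otimes>\<^sub>M M. z \<in> A \<times> A \<longrightarrow> W z = 0)"
    and "\<And>B. B \<in> sets M \<Longrightarrow> B \<subseteq> A \<Longrightarrow> 0 < measure M B \<Longrightarrow> measure M B < measure M A \<Longrightarrow>
      \<not> (AE z in M \<Otimes>\<^sub>M M. z \<in> B \<times> (A - B) \<longrightarrow> W z = 0)"
proof -
  note [measurable] = A(1)
  show "\<not> (AE z in M \<Otimes>\<^sub>M M. z \<in> A \<times> A \<longrightarrow> W z = 0)"
    using conn by (auto simp: disconnected_def AE_normalized_restriction_pair)
  fix B assume B [measurable]: "B \<in> sets M" and "B \<subseteq> A" "0 < measure M B" "measure M B < measure M A"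
  then have "0 < measure (normalized_restriction M A) B" "measure (normalized_restriction M A) B < 1"
    using emeasure_normalized_restriction[of B] A(2) by (auto simp: measure_def[of "normalized_restriction M A"])
  then have "\<not> (AE z in normalized_restriction M A \<Otimes>\<^sub>M normalized_restriction M A.
      z \<in> B \<times> (A - B) \<longrightarrow> W z = 0)"
    using conn B \<open>B \<subseteq> A\<close> by (auto simp: disconnected_def sets_normalized_restriction space_normalized_restriction)
  then have "\<not> (AE z in M \<Otimes>\<^sub>M M. z \<in> A \<times> A \<longrightarrow> z \<in> B \<times> (A - B) \<longrightarrow> W z = 0)"
    by (subst (asm) AE_normalized_restriction_pair) auto
  then show "\<not> (AE z in M \<Otimes>\<^sub>M M. z \<in> B \<times> (A - B) \<longrightarrow> W z = 0)"
    by (auto elim!: contrapos_nn eventually_mono)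
qed

end

text \<open>A block on which \<open>S\<close> is 1 is automatically connected, so the clauses on
  restrictions need not be checked separately.\<close>

lemma component_complete_withI:
  assumes S: "graphon M S"
    and P: "\<And>i. enat i \<le> K \<Longrightarrow> P i \<in> sets M" "disjoint_family_on P {i. enat i \<le> K}"
      "(\<Union>i\<in>{i. enat i \<le> K}. P i) = space M"
      "\<And>i. 1 \<le> i \<Longrightarrow> enat i \<le> K \<Longrightarrow> 0 < measure M (P i)"
    and one: "\<And>i. 1 \<le> i \<Longrightarrow> enat i \<le> K \<Longrightarrow> AE z in M \<Otimes>\<^sub>M M. z \<in> P i \<times> P i \<longrightarrow> S z = 1"
    and zero: "AE z in M \<Otimes>\<^sub>M M. z \<notin> (\<Union>i\<in>{i. 1 \<le> i \<and> enat i \<le> K}. P i \<times> P i) \<longrightarrow> S z = 0"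
  shows "component_complete_with M S K P"
proof -
  have "S \<in> borel_measurable (M \<Otimes>\<^sub>M M)"
    using S by (auto simp: graphon_def kernel_def)
  then show ?thesis
    using assms graphon_normalized_restriction complete_not_disconnected
    by (simp add: component_complete_with_def component_decomposition_def)
qed

text \<open>If no clique of \<open>S\<close> met \<open>A\<close> in positive measure, then
  \<open>S\<close>, hence \<open>W\<close>, would vanish on \<open>A \<times> A\<close>. If a clique
  \<open>N\<close> met \<open>A\<close> without covering it, then \<open>S\<close>, hence
  \<open>W\<close>, would vanish between \<open>A - N\<close> and \<open>A \<inter> N\<close>. Both
  contradict connectedness.\<close>

lemma connected_part_complete:
  assumes S: "regular_graphon S" and vel: "\<And>z. z \<in> space (M \<Otimes>\<^sub>M M) \<Longrightarrow> vel k S z = 0" and k: "3 \<le> k"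
    and A: "A \<in> sets M" "0 < measure M A"
    and W: "W \<in> borel_measurable (M \<Otimes>\<^sub>M M)" "AE z in M \<Otimes>\<^sub>M M. 0 \<le> W z \<and> W z \<le> S z"
    and conn: "\<not> disconnected (normalized_restriction M A) W"
  shows "AE z in M \<Otimes>\<^sub>M M. z \<in> A \<times> A \<longrightarrow> S z = 1"
proof -
  interpret P: pair_prob_space M M by (rule pair_prob_space_self)
  have [measurable]: "S \<in> borel_measurable (M \<Otimes>\<^sub>M M)" "A \<in> sets M"
    using S A by (auto simp: regular_graphon_def)
  note conn' = connected_partD[OF A W(1) conn]
  have good: "AE y in M. 0 < measure M (nbhd S y) \<longrightarrow> complete_part S (nbhd S y)"
    by (rule AE_nbhd_complete[OF S _ k]) (rule vel)
  have "\<exists>y\<in>space M. complete_part S (nbhd S y) \<and> 0 < measure M (nbhd S y \<inter> A)"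
  proof (rule ccontr)
    assume no: "\<not> ?thesis"
    have "AE z in M \<Otimes>\<^sub>M M. z \<in> A \<times> A \<longrightarrow> S z \<le> 0"
    proof (rule P.AE_pair_measure)
      from good AE_space show "AE y in M. AE x in M. (y, x) \<in> A \<times> A \<longrightarrow> S (y, x) \<le> 0"
      proof eventually_elim
        case (elim y)
        have N [measurable]: "nbhd S y \<in> sets M"
          by (rule nbhd_sets[OF S elim(2)])
        have "measure M (nbhd S y \<inter> A) = 0"
        proof (rule ccontr)
          assume "measure M (nbhd S y \<inter> A) \<noteq> 0"
          then have pos: "0 < measure M (nbhd S y \<inter> A)"
            by (simp add: zero_less_measure_iff)
          also have "\<dots> \<le> measure M (nbhd S y)"
            by (intro finite_measure_mono) auto
          finally show False
            using elim no pos by blast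
        qed
        then have "AE x in M. x \<notin> nbhd S y \<inter> A"
          by (intro AE_not_in_measure_0) auto
        then show ?case
          using AE_space by eventually_elim (auto simp: nbhd_def)
      qed
    qed measurable
    then have "AE z in M \<Otimes>\<^sub>M M. z \<in> A \<times> A \<longrightarrow> W z = 0"
      using W(2) by eventually_elim auto
    with conn'(1) show False ..
  qed
  then obtain y where y: "y \<in> space M" "complete_part S (nbhd S y)" "0 < measure M (nbhd S y \<inter> A)"
    by blast
  define N where "N = nbhd S y"
  have N [measurable]: "N \<in> sets M" and N1: "AE z in M \<Otimes>\<^sub>M M. z \<in> N \<times> N \<longrightarrow> S z = 1"
    and N0: "AE z in M \<Otimes>\<^sub>M M. z \<in> (space M - N) \<times> N \<longrightarrow> S z = 0"
    using y(2) by (auto simp: complete_part_def N_def)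
  have "measure M (A - N) = 0"
  proof (rule ccontr)
    assume "measure M (A - N) \<noteq> 0"
    then have "0 < measure M (A - N)"
      by (simp add: zero_less_measure_iff)
    moreover have "measure M (A - N) < measure M A"
      using y(3) finite_measure_Diff'[of A N] by (simp add: N_def[symmetric] Int_commute)
    moreover have "AE z in M \<Otimes>\<^sub>M M. z \<in> (A - N) \<times> (A - (A - N)) \<longrightarrow> W z = 0"
      using N0 W(2) by eventually_elim (use sets.sets_into_space[OF A(1)] in auto)
    ultimately show False
      using conn'(2)[of "A - N"] by auto
  qed
  then have "AE x in M. x \<notin> A - N"
    by (intro AE_not_in_measure_0) auto
  from AE_fst[OF this] AE_snd[OF this] N1 show ?thesis
    by eventually_elim auto
qed

text \<open>Almost every point has almost all its neighbours in listed parts, its neighbourhood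
  being null or essentially inside one of them. So \<open>S z > 0\<close> puts the second coordinate
  into some \<open>A n\<close>, and no edge leaves \<open>A n\<close>.\<close>

lemma AE_zero_off_complete_parts:
  assumes S: "regular_graphon S" and vel: "\<And>z. z \<in> space (M \<Otimes>\<^sub>M M) \<Longrightarrow> vel k S z = 0" and k: "3 \<le> k"
    and parts: "\<And>n::nat. n \<in> J \<Longrightarrow> complete_part S (A n)"
    and cover: "\<And>B. complete_part S B \<Longrightarrow> \<exists>n\<in>J. measure M (B - A n) = 0"
  shows "AE z in M \<Otimes>\<^sub>M M. z \<notin> (\<Union>n\<in>J. A n \<times> A n) \<longrightarrow> S z = 0"
proof -
  interpret P: pair_prob_space M M by (rule pair_prob_space_self)
  have [measurable]: "S \<in> borel_measurable (M \<Otimes>\<^sub>M M)"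
    using S by (auto simp: regular_graphon_def)
  have sets: "A n \<in> sets M" if "n \<in> J" for n
    using parts[OF that] by (simp add: complete_part_def)
  let ?U = "\<Union>n\<in>J. A n"
  have [measurable]: "?U \<in> sets M"
    using sets by (intro sets.countable_UN') auto
  have good: "AE y in M. 0 < measure M (nbhd S y) \<longrightarrow> complete_part S (nbhd S y)"
    by (rule AE_nbhd_complete[OF S _ k]) (rule vel)
  have "AE z in M \<Otimes>\<^sub>M M. snd z \<in> ?U \<or> S z \<le> 0"
  proof (rule P.AE_pair_measure)
    from good AE_space
    show "AE y in M. AE x in M. snd (y, x) \<in> ?U \<or> S (y, x) \<le> 0"
    proof eventually_elim
      case (elim y)
      have N [measurable]: "nbhd S y \<in> sets M"
        by (rule nbhd_sets[OF S elim(2)])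
      have "AE x in M. x \<notin> nbhd S y - ?U"
      proof (rule AE_not_in_measure_0)
        show "measure M (nbhd S y - ?U) = 0"
        proof (cases "0 < measure M (nbhd S y)")
          case True
          then obtain n where n: "n \<in> J" "measure M (nbhd S y - A n) = 0"
            using elim cover by blast
          have "measure M (nbhd S y - ?U) \<le> measure M (nbhd S y - A n)"
            using n(1) sets by (intro finite_measure_mono) auto
          then show ?thesis
            using n(2) by (simp add: measure_le_0_iff)
        next
          case False
          have "measure M (nbhd S y - ?U) \<le> measure M (nbhd S y)"
            by (intro finite_measure_mono) auto
          then show ?thesis
            using False by (simp add: zero_less_measure_iff measure_le_0_iff)
        qed
      qed measurable
      then show ?case
        using AE_space by eventually_elim (auto simp: nbhd_def)
    qed
  qed measurable
  moreover have "AE z in M \<Otimes>\<^sub>M M. \<forall>n\<in>J. z \<in> (space M - A n) \<times> A n \<longrightarrow> S z = 0"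
    using parts by (subst AE_ball_countable) (auto simp: complete_part_def)
  ultimately show ?thesis
    using AE_space
  proof eventually_elim
    case (elim z)
    moreover have "0 \<le> S z"
      using S elim(3) by (auto simp: regular_graphon_def)
    ultimately show ?case
      by (cases z) (force simp: space_pair_measure)
  qed
qed

lemma component_complete_of_parts:
  fixes A :: "nat \<Rightarrow> 'a set"
  assumes S: "graphon M S" and dis: "disjoint_family A"
    and A: "\<And>n. n \<in> J \<Longrightarrow> A n \<in> sets M" "\<And>n. n \<in> J \<Longrightarrow> 0 < measure M (A n)"
    and one: "\<And>n. n \<in> J \<Longrightarrow> AE z in M \<Otimes>\<^sub>M M. z \<in> A n \<times> A n \<longrightarrow> S z = 1"
    and zero: "AE z in M \<Otimes>\<^sub>M M. z \<notin> (\<Union>n\<in>J. A n \<times> A n) \<longrightarrow> S z = 0"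
  shows "component_complete M S"
proof -
  \<comment> \<open>\<open>J\<close> is enumerated without gaps by an initial segment of the
    naturals; the shift by one reserves index 0 for the points outside all parts.\<close>
  define K where "K = (if finite J then enat (card J) else \<infinity>)"
  define e where "e = from_nat_into J"
  define P where "P i = (case i of 0 \<Rightarrow> space M - (\<Union>n\<in>J. A n) | Suc n \<Rightarrow> A (e n))" for i
  have e: "bij_betw e {n. enat (Suc n) \<le> K} J"
  proof (cases "finite J")
    case True
    then have "{n. enat (Suc n) \<le> K} = {..<card J}"
      by (auto simp: K_def)
    then show ?thesis
      using bij_betw_from_nat_into_finite[OF True] by (simp add: e_def)
  next
    case False
    then show ?thesis
      using bij_betw_from_nat_into[of J] by (simp add: e_def K_def)
  qed
  then have e_in: "e n \<in> J" if "enat (Suc n) \<le> K" for n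
    using that by (auto dest: bij_betwE)
  have P_Suc: "\<exists>n. i = Suc n \<and> P i = A (e n) \<and> e n \<in> J" if "1 \<le> i" "enat i \<le> K" for i
    using that e_in by (cases i) (auto simp: P_def)
  have UN: "(\<Union>i\<in>{i. 1 \<le> i \<and> enat i \<le> K}. f (P i)) = (\<Union>n\<in>J. f (A n))" for f :: "'a set \<Rightarrow> 'c set"
  proof -
    have "{i. 1 \<le> i \<and> enat i \<le> K} = Suc ` {n. enat (Suc n) \<le> K}"
      by (auto simp: image_iff) (metis Suc_le_D)
    then have "(\<Union>i\<in>{i. 1 \<le> i \<and> enat i \<le> K}. f (P i)) = (\<Union>n\<in>{n. enat (Suc n) \<le> K}. f (A (e n)))"
      by (simp add: P_def)
    also have "\<dots> = (\<Union>n\<in>e ` {n. enat (Suc n) \<le> K}. f (A n))"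
      by simp
    also have "e ` {n. enat (Suc n) \<le> K} = J"
      using e by (rule bij_betw_imp_surj_on)
    finally show ?thesis .
  qed
  have "component_complete_with M S K P"
  proof (rule component_complete_withI[OF S])
    show "P i \<in> sets M" if "enat i \<le> K" for i
    proof (cases i)
      case 0
      have "(\<Union>n\<in>J. A n) \<in> sets M"
        using A(1) by (intro sets.countable_UN') auto
      then show ?thesis by (simp add: 0 P_def)
    next
      case (Suc n)
      then show ?thesis using that e_in A(1) by (simp add: P_def)
    qed
    show "disjoint_family_on P {i. enat i \<le> K}"
      unfolding disjoint_family_on_def
    proof (intro ballI impI)
      fix i j assume ij: "i \<in> {i. enat i \<le> K}" "j \<in> {i. enat i \<le> K}" "i \<noteq> j"
      show "P i \<inter> P j = {}"
      proof (cases "i = 0 \<or> j = 0")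
        case True
        then show ?thesis
          using ij e_in by (cases i; cases j) (auto simp: P_def)
      next
        case False
        then obtain m n where mn: "i = Suc m" "j = Suc n"
          by (metis not0_implies_Suc)
        then have "e m \<noteq> e n"
          using ij e by (auto simp: bij_betw_def inj_on_def)
        then show ?thesis
          using dis mn by (auto simp: P_def disjoint_family_on_def)
      qed
    qed
    show "(\<Union>i\<in>{i. enat i \<le> K}. P i) = space M"
    proof -
      have "{i. enat i \<le> K} = insert 0 {i. 1 \<le> i \<and> enat i \<le> K}"
        by (auto simp: zero_enat_def[symmetric])
      then have "(\<Union>i\<in>{i. enat i \<le> K}. P i) = P 0 \<union> (\<Union>n\<in>J. A n)"
        using UN[of "\<lambda>X. X"] by simp
      moreover have "A n \<subseteq> space M" if "n \<in> J" for n
        using A(1)[OF that] by (rule sets.sets_into_space)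
      then have "(\<Union>n\<in>J. A n) \<subseteq> space M" by blast
      ultimately show ?thesis
        by (auto simp: P_def)
    qed
    show "0 < measure M (P i)" if "1 \<le> i" "enat i \<le> K" for i
      using P_Suc[OF that] A(2) by auto
    show "AE z in M \<Otimes>\<^sub>M M. z \<in> P i \<times> P i \<longrightarrow> S z = 1" if "1 \<le> i" "enat i \<le> K" for i
      using P_Suc[OF that] one by auto
    show "AE z in M \<Otimes>\<^sub>M M. z \<notin> (\<Union>i\<in>{i. 1 \<le> i \<and> enat i \<le> K}. P i \<times> P i) \<longrightarrow> S z = 0"
      using zero UN[of "\<lambda>X. X \<times> X"] by simp
  qed
  then show ?thesis
    using S by (auto simp: component_complete_def)
qed

section \<open>Destinations of the component completion rule\<close>

lemma destination_component_complete:
  assumes sep: "separable_sigma_algebra M" and k: "3 \<le> k"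
    and dest: "destination_of_rule k M (component_completion_rule k) S"
  shows "component_complete M S"
proof -
  obtain W \<Phi> where W: "graphon M W" and \<Phi>: "trajectory k M (component_completion_rule k) W \<Phi>"
    and conv: "converges_to M \<Phi> S"
    using dest by (auto simp: destination_of_rule_def is_dest_def)
  obtain W' where W': "regular_graphon W'" "AE z in M \<Otimes>\<^sub>M M. W' z = W z"
    using regular_version[OF W] .
  have UNIV: "sym (UNIV :: ('a \<times> 'a) set)" "trans (UNIV :: ('a \<times> 'a) set)" "supported_graphon UNIV W'"
    using W'(1) by (auto simp: supported_graphon_def sym_def trans_def)
  obtain \<Psi> T where "trajectory k M (component_completion_rule k) W \<Psi>"
    and T: "supported_graphon UNIV T" and "\<And>z. z \<in> space (M \<Otimes>\<^sub>M M) \<Longrightarrow> W' z \<le> T z"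
    and vel: "\<And>z. z \<in> space (M \<Otimes>\<^sub>M M) \<Longrightarrow> vel k T z = 0"
    and convT: "\<And>\<Phi>. trajectory k M (component_completion_rule k) W \<Phi> \<Longrightarrow> converges_to M \<Phi> T"
    using trajectory_and_destination[OF UNIV W'(2), of k] by blast
  have ST: "AE z in M \<Otimes>\<^sub>M M. S z = T z"
    by (rule converges_to_unique[OF _ conv convT[OF \<Phi>]]) (use \<Phi> in \<open>simp add: trajectory_def\<close>)
  have regT: "regular_graphon T"
    using T by (simp add: supported_graphon_def)
  obtain A J where A: "disjoint_family (A :: nat \<Rightarrow> 'a set)" "\<And>n. n \<in> J \<Longrightarrow> complete_part T (A n)"
    "\<And>B. complete_part T B \<Longrightarrow> \<exists>n\<in>J. measure M (B - A n) = 0"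
    using complete_parts_partition[OF sep, of T] by blast
  show ?thesis
  proof (rule component_complete_of_parts[OF _ A(1), of S J])
    show "graphon M S"
      using conv by (simp add: converges_to_def)
    have "AE z in M \<Otimes>\<^sub>M M. z \<notin> (\<Union>n\<in>J. A n \<times> A n) \<longrightarrow> T z = 0"
    proof (rule AE_zero_off_complete_parts[OF regT _ k])
      show "\<And>z. z \<in> space (M \<Otimes>\<^sub>M M) \<Longrightarrow> vel k T z = 0" by (rule vel)
      show "\<And>n. n \<in> J \<Longrightarrow> complete_part T (A n)" by (rule A(2))
      show "\<And>B. complete_part T B \<Longrightarrow> \<exists>n\<in>J. measure M (B - A n) = 0" by (rule A(3))
    qed
    then show "AE z in M \<Otimes>\<^sub>M M. z \<notin> (\<Union>n\<in>J. A n \<times> A n) \<longrightarrow> S z = 0"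
      using ST by eventually_elim simp
    fix n assume "n \<in> J"
    then have n: "A n \<in> sets M" "0 < measure M (A n)" "AE z in M \<Otimes>\<^sub>M M. z \<in> A n \<times> A n \<longrightarrow> T z = 1"
      using A(2) by (auto simp: complete_part_def)
    show "A n \<in> sets M" "0 < measure M (A n)" by (fact n)+
    show "AE z in M \<Otimes>\<^sub>M M. z \<in> A n \<times> A n \<longrightarrow> S z = 1"
      using n(3) ST by eventually_elim simp
  qed
qed

text \<open>A partial equivalence relation: a point of \<open>P 0\<close> is related to nothing, not
  even to itself.\<close>

definition block_relation :: "enat \<Rightarrow> (nat \<Rightarrow> 'a set) \<Rightarrow> ('a \<times> 'a) set" where
  "block_relation K P = (\<Union>i\<in>{i. 1 \<le> i \<and> enat i \<le> K}. P i \<times> P i)"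

lemma block_relation:
  assumes "component_decomposition M W K P"
  shows "sym (block_relation K P)" "trans (block_relation K P)" "block_relation K P \<in> sets (M \<Otimes>\<^sub>M M)"
proof -
  show "sym (block_relation K P)"
    by (auto simp: sym_def block_relation_def)
  have "disjoint_family_on P {i. enat i \<le> K}"
    using assms by (auto simp: component_decomposition_def)
  then have eq: "i = j" if "x \<in> P i" "x \<in> P j" "enat i \<le> K" "enat j \<le> K" for x i j
    using that by (fastforce simp: disjoint_family_on_def)
  show "trans (block_relation K P)"
    by (rule transI) (auto simp: block_relation_def dest: eq)
  have "P i \<times> P i \<in> sets (M \<Otimes>\<^sub>M M)" if "enat i \<le> K" for i
    using assms that by (auto simp: component_decomposition_def)
  then show "block_relation K P \<in> sets (M \<Otimes>\<^sub>M M)"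
    unfolding block_relation_def by (intro sets.countable_UN') auto
qed

lemma destination_same_decomposition:
  assumes k: "3 \<le> k" and W: "graphon M W" and dec: "component_decomposition M W K P"
    and dest: "is_dest k M (component_completion_rule k) W S"
  shows "component_complete_with M S K P"
proof -
  obtain \<Phi> where \<Phi>: "trajectory k M (component_completion_rule k) W \<Phi>" and conv: "converges_to M \<Phi> S"
    using dest by (auto simp: is_dest_def)
  let ?D = "block_relation K P"
  note D = block_relation[OF dec]
  have off: "AE z in M \<Otimes>\<^sub>M M. z \<notin> ?D \<longrightarrow> W z = 0"
    using dec by (simp add: component_decomposition_def block_relation_def)
  obtain W1 where W1: "regular_graphon W1" "AE z in M \<Otimes>\<^sub>M M. W1 z = W z"
    using regular_version[OF W] .
  \<comment> \<open>The indicator makes \<open>W'\<close> vanish off the blocks at every point, so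
    that it lies in the invariant class for \<open>?D\<close>.\<close>
  define W' where "W' z = indicator ?D z * W1 z" for z
  have "W' \<in> borel_measurable (M \<Otimes>\<^sub>M M)"
    unfolding W'_def[abs_def] using D(3) W1(1) by (intro borel_measurable_times) (auto simp: regular_graphon_def)
  then have sup: "supported_graphon ?D W'"
    using W1(1) D(1) by (auto simp: supported_graphon_def regular_graphon_def W'_def indicator_def dest: symD)
  have W': "AE z in M \<Otimes>\<^sub>M M. W' z = W z"
    using W1(2) off by eventually_elim (auto simp: W'_def indicator_def)
  obtain \<Psi> T where "trajectory k M (component_completion_rule k) W \<Psi>"
    and T: "supported_graphon ?D T" "\<And>z. z \<in> space (M \<Otimes>\<^sub>M M) \<Longrightarrow> W' z \<le> T z"
      "\<And>z. z \<in> space (M \<Otimes>\<^sub>M M) \<Longrightarrow> vel k T z = 0"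
    and convT: "\<And>\<Phi>. trajectory k M (component_completion_rule k) W \<Phi> \<Longrightarrow> converges_to M \<Phi> T"
    using trajectory_and_destination[OF D(1,2) sup W', of k] by blast
  have ST: "AE z in M \<Otimes>\<^sub>M M. S z = T z"
    by (rule converges_to_unique[OF _ conv convT[OF \<Phi>]]) (use \<Phi> in \<open>simp add: trajectory_def\<close>)
  show ?thesis
  proof (rule component_complete_withI)
    show "graphon M S"
      using conv by (simp add: converges_to_def)
    show "P i \<in> sets M" if "enat i \<le> K" for i
      using dec that by (simp add: component_decomposition_def)
    show "disjoint_family_on P {i. enat i \<le> K}" "(\<Union>i\<in>{i. enat i \<le> K}. P i) = space M"
      using dec by (simp_all add: component_decomposition_def)
    show "0 < measure M (P i)" if "1 \<le> i" "enat i \<le> K" for i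
      using dec that by (simp add: component_decomposition_def)
    have "AE z in M \<Otimes>\<^sub>M M. z \<notin> ?D \<longrightarrow> T z = 0"
      using supported_graphonD(6)[OF T(1)] by (intro AE_I2) auto
    then show "AE z in M \<Otimes>\<^sub>M M. z \<notin> (\<Union>i\<in>{i. 1 \<le> i \<and> enat i \<le> K}. P i \<times> P i) \<longrightarrow> S z = 0"
      unfolding block_relation_def using ST by eventually_elim simp
    fix i :: nat assume i: "1 \<le> i" "enat i \<le> K"
    have "AE z in M \<Otimes>\<^sub>M M. z \<in> P i \<times> P i \<longrightarrow> T z = 1"
    proof (rule connected_part_complete[OF supported_graphonD(1)[OF T(1)] _ k])
      show "\<And>z. z \<in> space (M \<Otimes>\<^sub>M M) \<Longrightarrow> vel k T z = 0" by (rule T(3))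
      show "P i \<in> sets M" "0 < measure M (P i)" "\<not> disconnected (normalized_restriction M (P i)) W"
        using dec i by (simp_all add: component_decomposition_def)
      show "W \<in> borel_measurable (M \<Otimes>\<^sub>M M)"
        using W by (auto simp: graphon_def kernel_def)
      have "AE z in M \<Otimes>\<^sub>M M. 0 \<le> W z \<and> W z \<le> 1"
        using W by (simp add: graphon_def)
      with W' AE_space show "AE z in M \<Otimes>\<^sub>M M. 0 \<le> W z \<and> W z \<le> T z"
        by eventually_elim (use T(2) in force)
    qed
    then show "AE z in M \<Otimes>\<^sub>M M. z \<in> P i \<times> P i \<longrightarrow> S z = 1"
      using ST by eventually_elim simp
  qed
qed

lemma component_complete_is_destination:
  assumes "component_complete M S"
  shows "destination_of_rule k M (component_completion_rule k) S"
proof -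
  obtain K P where S: "graphon M S" and P: "component_complete_with M S K P"
    using assms by (auto simp: component_complete_def)
  have dec: "component_decomposition M S K P"
    and one: "\<And>i. 1 \<le> i \<Longrightarrow> enat i \<le> K \<Longrightarrow> AE z in M \<Otimes>\<^sub>M M. z \<in> P i \<times> P i \<longrightarrow> S z = 1"
    using P by (auto simp: component_complete_with_def)
  let ?D = "block_relation K P"
  note D = block_relation[OF dec]
  have "AE z in M \<Otimes>\<^sub>M M. \<forall>i\<in>{i. 1 \<le> i \<and> enat i \<le> K}. z \<in> P i \<times> P i \<longrightarrow> S z = 1"
    using one by (subst AE_ball_countable) auto
  moreover have "AE z in M \<Otimes>\<^sub>M M. z \<notin> ?D \<longrightarrow> S z = 0"
    using dec by (simp add: component_decomposition_def block_relation_def)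
  ultimately have eq: "AE z in M \<Otimes>\<^sub>M M. S z = indicator ?D z"
    by eventually_elim (auto simp: block_relation_def indicator_def)
  have meas: "S \<in> borel_measurable (M \<Otimes>\<^sub>M M)" and ker: "kernel M S"
    using S by (auto simp: graphon_def kernel_def)
  \<comment> \<open>The Lipschitz estimate with \<open>c = 0\<close> says that a.e. equal kernels
    have a.e. equal velocities; it moves the claim from \<open>S\<close> to the block
    indicator.\<close>
  have "AE z in M \<Otimes>\<^sub>M M. \<bar>vel k S z - vel k (indicator ?D) z\<bar> \<le> lipschitz_const k * 0"
  proof (rule velocity_lipschitz_AE[OF meas])
    show "AE z in M \<Otimes>\<^sub>M M. \<bar>S z\<bar> \<le> 2" "AE z in M \<Otimes>\<^sub>M M. \<bar>S z - indicator ?D z\<bar> \<le> 0"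
      using eq by (eventually_elim, simp add: indicator_def)+
    show "AE z in M \<Otimes>\<^sub>M M. \<bar>indicator ?D z :: real\<bar> \<le> 2"
      by (intro AE_I2) (simp add: indicator_def)
  qed (use D(3) in auto)
  then have vel: "AE z in M \<Otimes>\<^sub>M M. vel k S z = 0"
    using AE_space by eventually_elim (use velocity_indicator[OF D(1,2) _ D(3)] in simp)
  have deriv: "linf_norm M (\<lambda>z. (S z - S z) / (s - t) - vel k S z) = 0" for s t
  proof (rule antisym)
    show "linf_norm M (\<lambda>z. (S z - S z) / (s - t) - vel k S z) \<le> 0"
      unfolding linf_norm_def using vel borel_measurable_velocity[OF meas]
      by (intro esssup_I) (auto elim!: eventually_mono)
    show "0 \<le> linf_norm M (\<lambda>z. (S z - S z) / (s - t) - vel k S z)"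
      using borel_measurable_velocity[OF meas] by (intro linf_norm_nonneg) auto
  qed
  have "trajectory k M (component_completion_rule k) S (\<lambda>_. S)"
    unfolding trajectory_def deriv using ker by simp
  moreover have "cut_dist M S S = 0"
    using cut_dist_le[OF ker ker] cut_dist_nonneg[OF ker ker] by simp
  then have "converges_to M (\<lambda>_. S) S"
    using S by (simp add: converges_to_def)
  ultimately show ?thesis
    using S by (auto simp: destination_of_rule_def is_dest_def)
qed

lemma trajectories_have_destination:
  assumes W: "graphon M W"
  shows "\<exists>\<Phi>. trajectory k M (component_completion_rule k) W \<Phi>"
    and "\<And>\<Phi>. trajectory k M (component_completion_rule k) W \<Phi> \<Longrightarrow> \<exists>S. converges_to M \<Phi> S"
proof -
  obtain W' where W': "regular_graphon W'" "AE z in M \<Otimes>\<^sub>M M. W' z = W z"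
    using regular_version[OF W] .
  have UNIV: "sym (UNIV :: ('a \<times> 'a) set)" "trans (UNIV :: ('a \<times> 'a) set)" "supported_graphon UNIV W'"
    using W'(1) by (auto simp: supported_graphon_def sym_def trans_def)
  obtain \<Psi> S where \<Psi>: "trajectory k M (component_completion_rule k) W \<Psi>"
    and "supported_graphon UNIV S" and "\<And>z. z \<in> space (M \<Otimes>\<^sub>M M) \<Longrightarrow> W' z \<le> S z"
    and "\<And>z. z \<in> space (M \<Otimes>\<^sub>M M) \<Longrightarrow> vel k S z = 0"
    and S: "\<And>\<Phi>. trajectory k M (component_completion_rule k) W \<Phi> \<Longrightarrow> converges_to M \<Phi> S"
    using trajectory_and_destination[OF UNIV W'(2), of k] by blast
  from \<Psi> S show "\<exists>\<Phi>. trajectory k M (component_completion_rule k) W \<Phi>"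
    "\<And>\<Phi>. trajectory k M (component_completion_rule k) W \<Phi> \<Longrightarrow> \<exists>S. converges_to M \<Phi> S"
    by blast+
qed

end

theorem theorem9p6:
  fixes M :: "'a measure" and k :: nat
  assumes "prob_space M" and "atomless M" and "separable_sigma_algebra M"
    and "k \<ge> 3"
  shows "(\<forall>W. graphon M W \<longrightarrow>
            (\<exists>\<Phi>. trajectory k M (component_completion_rule k) W \<Phi>) \<and>
            (\<forall>\<Phi>. trajectory k M (component_completion_rule k) W \<Phi> \<longrightarrow> (\<exists>S. converges_to M \<Phi> S))) \<and>
         (\<forall>S. destination_of_rule k M (component_completion_rule k) S \<longrightarrow> component_complete M S) \<and>
         (\<forall>W K P S. graphon M W \<and> component_decomposition M W K P \<and> is_dest k M (component_completion_rule k) W S \<longrightarrow>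
            component_complete_with M S K P) \<and>
         (\<forall>S. component_complete M S \<longrightarrow> destination_of_rule k M (component_completion_rule k) S)"
proof -
  interpret prob_space M by fact
  show ?thesis
    using trajectories_have_destination destination_component_complete[OF assms(3,4)]
      destination_same_decomposition[OF assms(4)] component_complete_is_destination
    by (intro conjI allI impI) blast+
qed

end
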